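(* Let $\kappa$ be a $C^\infty$ function germ at $0\in\mathbb{R}$ with Taylor expansion $\sum_{i\ge0}\kappa_i s^i/i!$, and for $m\in\{2,3,4\}$ let $\phi_m:(\mathbb{R},0)\to(\mathbb{R}^2,0)$ be the plane curve germ of multiplicity $m$ determined by $\kappa$ (see context). Let $k\ge1$ and $q\ge1$ be integers. (i) $\phi_2$ defines an $A_{2k}$ singularity at $0$ if and only if $\kappa_0=\kappa_2=\dots=\kappa_{2k-4}=0$ and $\kappa_{2k-2}\ne0$. (ii) $\phi_3$ defines - an $E_{6k}$ singularity at $0$ if and only if $\kappa_{i-1}=0$ for all $i\ge1$ with $i\not\equiv0\bmod 3$ and $i<3k-2$, and $\kappa_{3k-3}\ne0$; - an $E_{6k+2}$ singularity at $0$ if and only if $\kappa_{i-1}=0$ for all $i\ge1$ with $i\not\equiv0\bmod 3$ and $i<3k-1$, and $\kappa_{3k-2}\ne0$. (iii) $\phi_4$ defines - a $W_{12}$ singularity at $0$ if and only if $\kappa_0\ne0$; - a $W^{\#}_{1,2q-1}$ singularity at $0$ if and only if $\kappa_0=0$, $\kappa_1\ne0$, $\kappa_2=\kappa_4=\cdots=\kappa_{2q-2}=0$ and $\kappa_{2q}\ne0$; - a $W_{18}$ singularity at $0$ if and only if $\kappa_0=\kappa_1=0$ and $\kappa_2\ne0$.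
   Context: Setup. Given a $C^\infty$ function germ $\kappa$ at $0\in\mathbb{R}$, put $\theta(s)=\int_0^s\kappa(u)\,du$, $\boldsymbol{t}(s)=(\cos\theta(s),\sin\theta(s))$, $\boldsymbol{n}(s)=(-\sin\theta(s),\cos\theta(s))$; equivalently $\boldsymbol t'=\kappa\boldsymbol n$, $\boldsymbol n'=-\kappa\boldsymbol t$, $\boldsymbol t(0)=(1,0)$, $\boldsymbol n(0)=(0,1)$. For an integer $m\ge1$ define $\phi_m(s)=\int_0^s\frac{u^{m-1}}{(m-1)!}\,\boldsymbol{t}(u)\,du$. Two $C^\infty$ map germs $f,g:(\mathbb{R},0)\to(\mathbb{R}^2,0)$ are $\mathcal A$-equivalent if there are diffeomorphism germs $h$ of $(\mathbb{R},0)$ and $\psi$ of $(\mathbb{R}^2,0)$ with $f\circ h=\psi\circ g$. Singularity types (for $k\ge1$, $q\ge1$). A map germ $\phi:(\mathbb{R},0)\to(\mathbb{R}^2,0)$ is said to define a singularity of the given type at $0$ if it is $\mathcal A$-equivalent to one of the corresponding normal forms: $A_{2k}$: $(t^2,t^{2k+1})$; $E_{6k}$: $(t^3,t^{3k+1}+\varepsilon_p t^{3(k+p)+2})$ with $0\le p\le k-2$, or $(t^3,t^{3k+1})$; $E_{6k+2}$: $(t^3,t^{3k+2}+\varepsilon_{p+1}t^{3(k+p)+4})$ with $0\le p\le k-2$, or $(t^3,t^{3k+2})$; $W_{12}$: $(t^4,t^5\pm t^7)$ or $(t^4,t^5)$; $W^\#_{1,2q-1}$: $(t^4,t^6+t^{2q+5})$;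 $W_{18}$: $(t^4,t^7\pm t^9)$, $(t^4,t^7\pm t^{13})$ or $(t^4,t^7)$. Here $\varepsilon_p=1$ if $p$ is even and $\varepsilon_p\in\{1,-1\}$ if $p$ is odd. *)

theory Defs
  imports "HOL-Analysis.Analysis"
begin

text \<open>
  Germs at 0 are represented by total functions; every notion below depends only on the values
  near 0.
\<close>

primrec Ck_on :: "nat \<Rightarrow> 'a::real_normed_vector set \<Rightarrow> ('a \<Rightarrow> 'b::real_normed_vector) \<Rightarrow> bool" where
  "Ck_on 0 S f \<longleftrightarrow> continuous_on S f"
| "Ck_on (Suc n) S f \<longleftrightarrow> (\<forall>x\<in>S. f differentiable (at x)) \<and>
     (\<forall>v. Ck_on n S (\<lambda>x. frechet_derivative f (at x) v))"

text \<open>Meant for finite-dimensional domains and open \<open>S\<close>.\<close>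

definition smooth_on :: "'a::real_normed_vector set \<Rightarrow> ('a \<Rightarrow> 'b::real_normed_vector) \<Rightarrow> bool" where
  "smooth_on S f \<longleftrightarrow> (\<forall>n. Ck_on n S f)"

definition smooth_germ :: "('a::real_normed_vector \<Rightarrow> 'b::real_normed_vector) \<Rightarrow> bool" where
  "smooth_germ f \<longleftrightarrow> (\<exists>U. open U \<and> 0 \<in> U \<and> smooth_on U f)"

definition diffeo_germ :: "('a::real_normed_vector \<Rightarrow> 'a) \<Rightarrow> bool" where
  "diffeo_germ h \<longleftrightarrow> h 0 = 0 \<and>
     (\<exists>U V g. open U \<and> 0 \<in> U \<and> open V \<and> 0 \<in> V \<and> homeomorphism U V h g \<and>
        smooth_on U h \<and> smooth_on V g)"

definition plane_curve_germ :: "(real \<Rightarrow> real \<times> real) \<Rightarrow> bool" where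
  "plane_curve_germ f \<longleftrightarrow> smooth_germ f \<and> f 0 = 0"

definition A_equivalent :: "(real \<Rightarrow> real \<times> real) \<Rightarrow> (real \<Rightarrow> real \<times> real) \<Rightarrow> bool" where
  "A_equivalent f g \<longleftrightarrow> plane_curve_germ f \<and> plane_curve_germ g \<and>
     (\<exists>h \<psi>. diffeo_germ h \<and> diffeo_germ \<psi> \<and> (\<forall>\<^sub>F t in nhds 0. f (h t) = \<psi> (g t)))"

text \<open>
  The interval integrals are oriented, so the formulas also hold for \<open>s < 0\<close>.
\<close>

definition turning_angle :: "(real \<Rightarrow> real) \<Rightarrow> real \<Rightarrow> real" where
  "turning_angle \<kappa> s = (LBINT u=ereal 0..ereal s. \<kappa> u)"

definition unit_tangent :: "(real \<Rightarrow> real) \<Rightarrow> real \<Rightarrow> real \<times> real" where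
  "unit_tangent \<kappa> s = (cos (turning_angle \<kappa> s), sin (turning_angle \<kappa> s))"

definition curve_of_mult :: "nat \<Rightarrow> (real \<Rightarrow> real) \<Rightarrow> real \<Rightarrow> real \<times> real" where
  "curve_of_mult m \<kappa> s =
     (LBINT u=ereal 0..ereal s. (u ^ (m - 1) / fact (m - 1)) *\<^sub>R unit_tangent \<kappa> u)"

text \<open>The Taylor expansion is normalised as \<open>\<Sum>i. \<kappa>\<^sub>i s\<^sup>i / i!\<close>.\<close>

definition taylor_coeff :: "(real \<Rightarrow> real) \<Rightarrow> nat \<Rightarrow> real" where
  "taylor_coeff \<kappa> i = (deriv ^^ i) \<kappa> 0"

definition defines_singularity ::
    "(real \<Rightarrow> real \<times> real) \<Rightarrow> (real \<Rightarrow> real \<times> real) set \<Rightarrow> bool" where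
  "defines_singularity \<phi> N \<longleftrightarrow> (\<exists>g\<in>N. A_equivalent \<phi> g)"

text \<open>
  A singularity type is given by its set of normal forms. \<open>sign_choices p\<close> is the set of values
  allowed for the sign \<open>\<epsilon>\<^sub>p\<close>.
\<close>

definition sign_choices :: "nat \<Rightarrow> real set" where
  "sign_choices p = (if even p then {1} else {1, -1})"

definition A_even :: "nat \<Rightarrow> (real \<Rightarrow> real \<times> real) set" where
  "A_even k = {\<lambda>t. (t ^ 2, t ^ (2 * k + 1))}"

text \<open>
  \<open>E_6k k\<close> and \<open>E_6k2 k\<close> are the types with Milnor numbers \<open>6 k\<close> and \<open>6 k + 2\<close>. The bound
  \<open>p + 2 \<le> k\<close> is \<open>p \<le> k - 2\<close> read in the integers, so there is no such form for \<open>k = 1\<close>.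
\<close>

definition E_6k :: "nat \<Rightarrow> (real \<Rightarrow> real \<times> real) set" where
  "E_6k k = {\<lambda>t. (t ^ 3, t ^ (3 * k + 1) + \<epsilon> * t ^ (3 * (k + p) + 2)) | p \<epsilon>.
               p + 2 \<le> k \<and> \<epsilon> \<in> sign_choices p}
     \<union> {\<lambda>t. (t ^ 3, t ^ (3 * k + 1))}"

definition E_6k2 :: "nat \<Rightarrow> (real \<Rightarrow> real \<times> real) set" where
  "E_6k2 k = {\<lambda>t. (t ^ 3, t ^ (3 * k + 2) + \<epsilon> * t ^ (3 * (k + p) + 4)) | p \<epsilon>.
               p + 2 \<le> k \<and> \<epsilon> \<in> sign_choices (p + 1)}
     \<union> {\<lambda>t. (t ^ 3, t ^ (3 * k + 2))}"

definition W_12 :: "(real \<Rightarrow> real \<times> real) set" where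
  "W_12 = {\<lambda>t. (t ^ 4, t ^ 5 + t ^ 7), \<lambda>t. (t ^ 4, t ^ 5 - t ^ 7), \<lambda>t. (t ^ 4, t ^ 5)}"

text \<open>\<open>W_sharp q\<close> is the type with lower index \<open>1, 2 q - 1\<close>.\<close>

definition W_sharp :: "nat \<Rightarrow> (real \<Rightarrow> real \<times> real) set" where
  "W_sharp q = {\<lambda>t. (t ^ 4, t ^ 6 + t ^ (2 * q + 5))}"

definition W_18 :: "(real \<Rightarrow> real \<times> real) set" where
  "W_18 = {\<lambda>t. (t ^ 4, t ^ 7 + t ^ 9), \<lambda>t. (t ^ 4, t ^ 7 - t ^ 9),
           \<lambda>t. (t ^ 4, t ^ 7 + t ^ 13), \<lambda>t. (t ^ 4, t ^ 7 - t ^ 13), \<lambda>t. (t ^ 4, t ^ 7)}"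

end

theory Submission imports Defs "HOL-Computational_Algebra.Polynomial" begin

text \<open>
  A smooth reparametrisation turns \<open>\<phi>\<^sub>m\<close> into \<open>(t\<^sup>m, y(t))\<close>. Let \<open>i\<close> be the least index not divisible
  by \<open>m\<close> with \<open>\<kappa>\<^bsub>i-1\<^esub> \<noteq> 0\<close>; the first exponent of \<open>y\<close> that is not a multiple of \<open>m\<close> is then \<open>m + i\<close>,
  because its coefficient is a nonzero multiple of \<open>\<kappa>\<^bsub>i-1\<^esub>\<close>, and multiples of \<open>m\<close> are
  removed by a shear \<open>y - r(x)\<close>. This exponent is an invariant of \<open>\<A>\<close>-equivalence.

  No finite determinacy theorem is needed for the normal forms. Borel's lemma, applied to the Taylor
  series and completed by a flat remainder, splits \<open>y\<close> exactly as \<open>\<Sum>e. t\<^sup>e r\<^sub>e(t\<^sup>m)\<close> with smooth \<open>r\<^sub>e\<close> and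
  one exponent \<open>e\<close> in each class modulo \<open>m\<close>. Choosing the \<open>e\<close> in the semigroup generated by \<open>m\<close> and the
  leading exponent, apart from finitely many gaps, makes the remaining coordinate changes explicit.
  The gaps are treated by adding \<open>\<mu> y\<^sup>j\<close> to \<open>x\<close> and by scaling.

  For \<open>W\<^sup>#\<close> the leading term \<open>t\<^sup>6\<close> is even and the index \<open>q\<close> is seen by the first odd exponent: a
  reparametrisation with \<open>x(\<sigma>(t)) = x(t)\<close> that reverses orientation is used to compare \<open>y(\<sigma>(t))\<close> with \<open>y(t)\<close>.
\<close>

section \<open>Smooth maps\<close>

text \<open>Once \<open>x = t^m\<close> and \<open>y = t^n\<close> are available, a series
  \<open>t^e r(t^m)\<close> with \<open>e\<close> a multiple of \<open>n\<close> is an exact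
  function of \<open>x\<close> and \<open>y\<close>, and one coordinate change of the plane removes
  it, infinite tail included. The exponents that resist lie in a class \<open>j n\<close> modulo
  \<open>m\<close>, strictly between \<open>n\<close> and \<open>j n\<close>. The largest,
  \<open>j n - m\<close>, falls to adding a power of \<open>y\<close> to \<open>x\<close>. The least
  survivor \<open>e\<close> can only be rescaled: relative to \<open>t^n\<close>, a substitution
  acts on its coefficient by an \<open>(e - n)\<close>-th power, so a sign may remain when
  \<open>e - n\<close> is even. The leading exponent is invariant because a plane map that raises it
  along the curve has a second component with zero differential. For exponents 4 and 6 the semigroup
  contains only even numbers. Odd exponents are reached through
  \<open>y^2 - x^3 = 2 t^(2q+11) + ...\<close>, so \<open>t^(2q+7)\<close> needs a coordinate change
  of its own. The order obstruction sees only the 6 and is complemented by one that measures the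
  failure of evenness.\<close>

lemma Ck_on_cong:
  assumes "open S" "\<And>x. x \<in> S \<Longrightarrow> f x = g x" "Ck_on n S f"
  shows "Ck_on n S g"
  using assms(2,3)
proof (induction n arbitrary: f g)
  case 0
  then show ?case using continuous_on_cong by force
next
  case (Suc n)
  have d: "(g has_derivative frechet_derivative f (at x)) (at x)" if "x \<in> S" for x
    using Suc.prems that assms(1)
    by (auto simp: frechet_derivative_works intro!: has_derivative_transform_within_open[of f _ x UNIV S g])
  then have e: "frechet_derivative g (at x) = frechet_derivative f (at x)" if "x \<in> S" for x
    using frechet_derivative_at[OF d[OF that]] by simp
  show ?case
    using Suc.prems Suc.IH[of "\<lambda>x. frechet_derivative f (at x) v" "\<lambda>x. frechet_derivative g (at x) v" for v]
      d e by (auto simp: differentiable_def)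
qed

lemma Ck_on_SucI:
  assumes "open S" "\<And>x. x \<in> S \<Longrightarrow> (f has_derivative f' x) (at x)" "\<And>v. Ck_on n S (\<lambda>x. f' x v)"
  shows "Ck_on (Suc n) S f"
proof -
  have "frechet_derivative f (at x) = f' x" if "x \<in> S" for x
    using frechet_derivative_at[OF assms(2)[OF that]] by simp
  then have "Ck_on n S (\<lambda>x. frechet_derivative f (at x) v)" for v
    using Ck_on_cong[OF assms(1) _ assms(3)[of v]] by simp
  then show ?thesis using assms(2) by (auto simp: differentiable_def)
qed

lemma Ck_on_SucD:
  assumes "Ck_on (Suc n) S f" "x \<in> S"
  shows "(f has_derivative frechet_derivative f (at x)) (at x)"
  using assms frechet_derivative_works by auto

lemma Ck_on_frechet:
  "Ck_on (Suc n) S f \<Longrightarrow> Ck_on n S (\<lambda>x. frechet_derivative f (at x) v)"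
  by simp

lemma Ck_on_continuous: "Ck_on n S f \<Longrightarrow> continuous_on S f"
  by (cases n) (auto simp: differentiable_imp_continuous_on continuous_at_imp_continuous_on differentiable_imp_continuous_within)

lemma Ck_on_mono_Suc: "Ck_on (Suc n) S f \<Longrightarrow> Ck_on n S f"
proof (induction n arbitrary: f)
  case 0
  then show ?case using Ck_on_continuous Ck_on.simps(1) by blast
next
  case (Suc n)
  then show ?case by (metis Ck_on.simps(2))
qed

lemma Ck_on_subset: "T \<subseteq> S \<Longrightarrow> Ck_on n S f \<Longrightarrow> Ck_on n T f"
  by (induction n arbitrary: f) (auto intro: continuous_on_subset)

lemma Ck_on_const: "Ck_on n S (\<lambda>x. c)"
  by (induction n arbitrary: c) (auto simp: frechet_derivative_const)

lemma Ck_on_linear: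
  assumes "open S" "bounded_linear L" "Ck_on n S f"
  shows "Ck_on n S (\<lambda>x. L (f x))"
  using assms(3)
proof (induction n arbitrary: f)
  case 0
  then show ?case using assms(2) by (simp add: bounded_linear.continuous_on)
next
  case (Suc n)
  show ?case
    by (rule Ck_on_SucI[OF assms(1), where f' = "\<lambda>x v. L (frechet_derivative f (at x) v)"])
      (use Suc in \<open>auto intro!: bounded_linear.has_derivative[OF assms(2)] simp: frechet_derivative_works\<close>)
qed

lemma Ck_on_add:
  assumes "open S" "Ck_on n S f" "Ck_on n S g"
  shows "Ck_on n S (\<lambda>x. f x + g x)"
  using assms(2,3)
proof (induction n arbitrary: f g)
  case 0
  then show ?case by (simp add: continuous_on_add)
next
  case (Suc n)
  show ?case
    by (rule Ck_on_SucI[OF assms(1), where f' = "\<lambda>x v. frechet_derivative f (at x) v + frechet_derivative g (at x) v"])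
      (use Suc in \<open>auto intro!: has_derivative_add simp: frechet_derivative_works\<close>)
qed

lemma Ck_on_bilinear:
  assumes "open S" "bounded_bilinear h" "Ck_on n S f" "Ck_on n S g"
  shows "Ck_on n S (\<lambda>x. h (f x) (g x))"
  using assms(3,4)
proof (induction n arbitrary: f g)
  case 0
  then show ?case using bounded_bilinear.continuous_on[OF assms(2)] by simp
next
  case (Suc n)
  have m: "Ck_on n S f" "Ck_on n S g" using Suc.prems Ck_on_mono_Suc by blast+
  show ?case
    by (rule Ck_on_SucI[OF assms(1), where f' = "\<lambda>x v. h (f x) (frechet_derivative g (at x) v) + h (frechet_derivative f (at x) v) (g x)"])
      (use Suc m in \<open>auto intro!: bounded_bilinear.FDERIV[OF assms(2)] Ck_on_add[OF assms(1)] simp: frechet_derivative_works\<close>)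
qed

lemma Ck_on_sum:
  assumes "open S" "finite I" "\<And>i. i \<in> I \<Longrightarrow> Ck_on n S (f i)"
  shows "Ck_on n S (\<lambda>x. \<Sum>i\<in>I. f i x)"
  using assms(2,3) by (induction I rule: finite_induct) (auto intro: Ck_on_const Ck_on_add[OF assms(1)])

text \<open>The chain rule applies the derivative of \<open>g\<close> to a direction that moves with
  \<open>x\<close>, while \<open>Ck_on\<close> only speaks of fixed directions. Expanding the moving
  vector in \<open>Basis\<close> turns the derivative into a finite sum of products to which the
  induction hypothesis and \<open>Ck_on_bilinear\<close> apply.\<close>

lemma Ck_on_compose:
  fixes f :: "'a::real_normed_vector \<Rightarrow> 'b::euclidean_space" and g :: "'b \<Rightarrow> 'c::real_normed_vector"
  assumes "open S" "open T" "f ` S \<subseteq> T" "Ck_on n S f" "Ck_on n T g"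
  shows "Ck_on n S (\<lambda>x. g (f x))"
  using assms(4,5)
proof (induction n arbitrary: g)
  case 0
  then show ?case using continuous_on_compose2[of T g S f] assms(3) by auto
next
  case (Suc n)
  have m: "Ck_on n S f" using Suc.prems Ck_on_mono_Suc by blast
  let ?f' = "\<lambda>x v. \<Sum>b\<in>Basis. (frechet_derivative f (at x) v \<bullet> b) *\<^sub>R frechet_derivative g (at (f x)) b"
  have "((\<lambda>x. g (f x)) has_derivative ?f' x) (at x)" if "x \<in> S" for x
  proof -
    have 1: "(f has_derivative frechet_derivative f (at x)) (at x)"
      using Suc.prems that Ck_on_SucD by blast
    have 2: "(g has_derivative frechet_derivative g (at (f x))) (at (f x))"
      using Suc.prems that assms(3) Ck_on_SucD by blast
    then have l: "linear (frechet_derivative g (at (f x)))"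
      using has_derivative_linear by blast
    have "frechet_derivative g (at (f x)) w = (\<Sum>b\<in>Basis. (w \<bullet> b) *\<^sub>R frechet_derivative g (at (f x)) b)" for w
    proof -
      have "frechet_derivative g (at (f x)) (\<Sum>b\<in>Basis. (w \<bullet> b) *\<^sub>R b)
          = (\<Sum>b\<in>Basis. (w \<bullet> b) *\<^sub>R frechet_derivative g (at (f x)) b)"
        by (simp only: linear_sum[OF l] linear_scale[OF l])
      then show ?thesis by (simp only: euclidean_representation)
    qed
    then have "?f' x = (\<lambda>v. frechet_derivative g (at (f x)) (frechet_derivative f (at x) v))"
      by (intro ext) (rule sym)
    then show ?thesis using has_derivative_compose[OF 1 2] by simp
  qed
  moreover have "Ck_on n S (\<lambda>x. ?f' x v)" for v
  proof (rule Ck_on_sum[OF assms(1) finite_Basis])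
    fix b :: 'b
    have "Ck_on n S (\<lambda>x. frechet_derivative f (at x) v \<bullet> b)"
      by (rule Ck_on_linear[OF assms(1) bounded_linear_inner_left Ck_on_frechet[OF Suc.prems(1)]])
    moreover have "Ck_on n S (\<lambda>x. frechet_derivative g (at (f x)) b)"
      by (rule Suc.IH[OF m Ck_on_frechet[OF Suc.prems(2)]])
    ultimately show "Ck_on n S (\<lambda>x. (frechet_derivative f (at x) v \<bullet> b) *\<^sub>R frechet_derivative g (at (f x)) b)"
      using Ck_on_bilinear[OF assms(1) bounded_bilinear_scaleR] by blast
  qed
  ultimately show ?case by (rule Ck_on_SucI[OF assms(1)])
qed

lemma smooth_on_id: "open S \<Longrightarrow> smooth_on S (\<lambda>x. x)"
  unfolding smooth_on_def
proof
  fix n assume S: "open S"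
  show "Ck_on n S (\<lambda>x. x)"
    \<comment> \<open>Order \<open>n\<close> is read off from order \<open>n + 1\<close>, where the
      directional derivatives are constants.\<close>
    by (rule Ck_on_mono_Suc, rule Ck_on_SucI[OF S has_derivative_ident Ck_on_const])
qed

lemma smooth_on_const: "smooth_on S (\<lambda>x. c)"
  by (simp add: smooth_on_def Ck_on_const)

lemma smooth_on_linear:
  "open S \<Longrightarrow> bounded_linear L \<Longrightarrow> smooth_on S f \<Longrightarrow> smooth_on S (\<lambda>x. L (f x))"
  unfolding smooth_on_def by (rule allI, rule Ck_on_linear) auto

lemma smooth_on_add:
  "open S \<Longrightarrow> smooth_on S f \<Longrightarrow> smooth_on S g \<Longrightarrow> smooth_on S (\<lambda>x. f x + g x)"
  unfolding smooth_on_def by (rule allI, rule Ck_on_add) auto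

lemma smooth_on_mult:
  fixes f g :: "'a::real_normed_vector \<Rightarrow> real"
  shows "open S \<Longrightarrow> smooth_on S f \<Longrightarrow> smooth_on S g \<Longrightarrow> smooth_on S (\<lambda>x. f x * g x)"
  unfolding smooth_on_def
  by (rule allI, rule Ck_on_bilinear[OF _ bounded_bilinear_mult]) auto

lemma smooth_on_subset: "T \<subseteq> S \<Longrightarrow> smooth_on S f \<Longrightarrow> smooth_on T f"
  unfolding smooth_on_def by (auto intro: Ck_on_subset)

lemma smooth_on_cong:
  "open S \<Longrightarrow> (\<And>x. x \<in> S \<Longrightarrow> f x = g x) \<Longrightarrow> smooth_on S f \<Longrightarrow> smooth_on S g"
  unfolding smooth_on_def by (rule allI, rule Ck_on_cong[of S f g]) auto

lemma smooth_on_compose: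
  fixes f :: "'a::real_normed_vector \<Rightarrow> 'b::euclidean_space" and g :: "'b \<Rightarrow> 'c::real_normed_vector"
  shows "open S \<Longrightarrow> open T \<Longrightarrow> f ` S \<subseteq> T \<Longrightarrow> smooth_on S f \<Longrightarrow> smooth_on T g \<Longrightarrow> smooth_on S (\<lambda>x. g (f x))"
  unfolding smooth_on_def by (rule allI, rule Ck_on_compose) auto

lemma smooth_on_has_derivative:
  "smooth_on S f \<Longrightarrow> x \<in> S \<Longrightarrow> (f has_derivative frechet_derivative f (at x)) (at x)"
  unfolding smooth_on_def by (rule Ck_on_SucD) auto

lemma smooth_on_frechet:
  "smooth_on S f \<Longrightarrow> smooth_on S (\<lambda>x. frechet_derivative f (at x) v)"
  unfolding smooth_on_def by (auto intro: Ck_on_frechet)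

lemma smooth_on_continuous: "smooth_on S f \<Longrightarrow> continuous_on S f"
  unfolding smooth_on_def by (auto intro: Ck_on_continuous)

lemma Ck_on_real_SucI:
  fixes f :: "real \<Rightarrow> 'a::real_normed_vector"
  assumes "open S" "\<And>x. x \<in> S \<Longrightarrow> (f has_vector_derivative f' x) (at x)" "Ck_on n S f'"
  shows "Ck_on (Suc n) S f"
proof (rule Ck_on_SucI[OF assms(1)])
  show "(f has_derivative (\<lambda>v. v *\<^sub>R f' x)) (at x)" if "x \<in> S" for x
    using assms(2)[OF that] by (simp add: has_vector_derivative_def)
  show "Ck_on n S (\<lambda>x. v *\<^sub>R f' x)" for v
    by (rule Ck_on_linear[OF assms(1) bounded_linear_scaleR_right assms(3)])
qed

lemma smooth_on_real_I:
  fixes f :: "real \<Rightarrow> 'a::real_normed_vector"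
  assumes "open S" "\<And>x. x \<in> S \<Longrightarrow> (f has_vector_derivative f' x) (at x)" "smooth_on S f'"
  shows "smooth_on S f"
  unfolding smooth_on_def
proof
  fix n
  show "Ck_on n S f"
    using Ck_on_mono_Suc Ck_on_real_SucI[OF assms(1,2)] assms(3) unfolding smooth_on_def by blast
qed

lemma smooth_on_deriv:
  fixes f :: "real \<Rightarrow> real"
  assumes "smooth_on S f" "open S"
  shows "smooth_on S (deriv f)" "x \<in> S \<Longrightarrow> (f has_real_derivative deriv f x) (at x)"
proof -
  have *: "(f has_real_derivative frechet_derivative f (at x) 1) (at x)" if "x \<in> S" for x
    using smooth_on_has_derivative[OF assms(1) that]
    by (metis has_derivative_bounded_linear has_derivative_imp_has_field_derivative mult.commute mult.right_neutral
        real_bounded_linear)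
  then have e: "frechet_derivative f (at x) 1 = deriv f x" if "x \<in> S" for x
    using that by (metis DERIV_imp_deriv)
  show "smooth_on S (deriv f)"
    by (rule smooth_on_cong[OF assms(2) e smooth_on_frechet[OF assms(1)]])
  show "x \<in> S \<Longrightarrow> (f has_real_derivative deriv f x) (at x)" using * e by simp
qed

section \<open>Smoothness of elementary functions\<close>

lemma smooth_on_inverse: "smooth_on {x::real. x \<noteq> 0} inverse"
proof -
  let ?S = "{x::real. x \<noteq> 0}"
  have o: "open ?S" by (simp add: open_delete Compl_eq[symmetric] open_Collect_neq)
  have "Ck_on n ?S inverse" for n
  proof (induction n)
    case 0
    then show ?case by (auto intro!: continuous_intros)
  next
    case (Suc n)
    have "Ck_on n ?S (\<lambda>x. - (inverse x * inverse x))"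
      by (rule Ck_on_linear[OF o bounded_linear_minus[OF bounded_linear_ident] Ck_on_bilinear[OF o bounded_bilinear_mult Suc Suc]])
    then show ?case
      by (rule Ck_on_real_SucI[OF o, rotated])
        (use DERIV_inverse in \<open>auto simp: has_real_derivative_iff_has_vector_derivative[symmetric] power2_eq_square\<close>)
  qed
  then show ?thesis by (simp add: smooth_on_def)
qed

lemma smooth_on_exp: "smooth_on UNIV (exp :: real \<Rightarrow> real)"
proof -
  have "Ck_on n UNIV (exp :: real \<Rightarrow> real)" for n
  proof (induction n)
    case (Suc n)
    show ?case
      by (rule Ck_on_real_SucI[OF open_UNIV _ Suc])
       (auto simp: has_real_derivative_iff_has_vector_derivative[symmetric])
  qed (auto intro!: continuous_intros)
  then show ?thesis by (simp add: smooth_on_def)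
qed

lemma smooth_on_sin_cos:
  "smooth_on UNIV (sin :: real \<Rightarrow> real)" "smooth_on UNIV (cos :: real \<Rightarrow> real)"
proof -
  have "Ck_on n UNIV (sin :: real \<Rightarrow> real) \<and> Ck_on n UNIV (cos :: real \<Rightarrow> real)" for n
  proof (induction n)
    case (Suc n)
    have m: "Ck_on n UNIV (\<lambda>x::real. - sin x)"
      by (rule Ck_on_linear[OF open_UNIV bounded_linear_minus[OF bounded_linear_ident] conjunct1[OF Suc]])
    show ?case
    proof
      show "Ck_on (Suc n) UNIV (sin :: real \<Rightarrow> real)"
        by (rule Ck_on_real_SucI[OF open_UNIV _ conjunct2[OF Suc]])
          (simp add: has_real_derivative_iff_has_vector_derivative[symmetric])
      show "Ck_on (Suc n) UNIV (cos :: real \<Rightarrow> real)"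
        by (rule Ck_on_real_SucI[OF open_UNIV _ m])
          (simp add: has_real_derivative_iff_has_vector_derivative[symmetric])
    qed
  qed (auto intro!: continuous_intros)
  then show "smooth_on UNIV (sin :: real \<Rightarrow> real)" "smooth_on UNIV (cos :: real \<Rightarrow> real)"
    by (auto simp: smooth_on_def)
qed

lemma smooth_on_ln: "smooth_on {0<..} (ln :: real \<Rightarrow> real)"
proof (rule smooth_on_real_I)
  show "(ln has_vector_derivative inverse x) (at x)" if "x \<in> {0<..}" for x :: real
    using that DERIV_ln by (auto simp: has_real_derivative_iff_has_vector_derivative[symmetric])
  show "smooth_on {0<..} (inverse :: real \<Rightarrow> real)"
    by (rule smooth_on_subset[OF _ smooth_on_inverse]) auto
qed auto

lemma smooth_on_powr: "smooth_on {0<..} (\<lambda>x::real. x powr a)"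
proof (rule smooth_on_cong)
  show "smooth_on {0<..} (\<lambda>x::real. exp (a * ln x))"
    by (rule smooth_on_compose[of _ UNIV "\<lambda>x. a * ln x" exp])
      (simp_all add: smooth_on_mult smooth_on_const smooth_on_ln smooth_on_exp)
qed (auto simp: powr_def)

text \<open>\<open>A x\<close> is the inverse of the derivative of \<open>f\<close> at
  \<open>x\<close>, supplied as a smooth family. The inverse function theorem gives a differentiable
  local inverse \<open>g\<close> with \<open>g' y = A (g y)\<close>; if \<open>g\<close> is
  \<open>C^n\<close>, so is the right-hand side, hence \<open>g\<close> is
  \<open>C^(n+1)\<close>.\<close>

lemma diffeo_germ_aux:
  fixes f :: "'a::euclidean_space \<Rightarrow> 'a"
  assumes "smooth_on U f" "open U" "0 \<in> U" "f 0 = 0"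
    and A: "\<And>v. smooth_on U (\<lambda>x. A x v)" "\<And>x. x \<in> U \<Longrightarrow> bounded_linear (A x)"
      "\<And>x v. x \<in> U \<Longrightarrow> A x (frechet_derivative f (at x) v) = v"
      "\<And>x v. x \<in> U \<Longrightarrow> frechet_derivative f (at x) (A x v) = v"
  shows "diffeo_germ f"
proof -
  \<comment> \<open>\<open>inverse_function_theorem\<close> wants the derivative as a continuous map
    into the bounded linear maps; in finite dimension continuity on each basis vector is
    enough.\<close>
  define F where "F x = Blinfun (frechet_derivative f (at x))" for x
  have d: "(f has_derivative frechet_derivative f (at x)) (at x)" if "x \<in> U" for x
    using smooth_on_has_derivative assms(1) that by blast
  then have bl: "bounded_linear (frechet_derivative f (at x))" if "x \<in> U" for x
    using that has_derivative_bounded_linear by blast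
  have F: "blinfun_apply (F x) = frechet_derivative f (at x)" if "x \<in> U" for x
    using bl that unfolding F_def by (simp add: bounded_linear_Blinfun_apply)
  have "continuous_on U F"
  proof (rule continuous_on_blinfun_componentwise)
    fix i :: 'a
    have "continuous_on U (\<lambda>x. frechet_derivative f (at x) i)"
      using smooth_on_frechet smooth_on_continuous assms(1) by blast
    then show "continuous_on U (\<lambda>x. blinfun_apply (F x) i)"
      using F by (simp cong: continuous_on_cong)
  qed
  moreover have "(f has_derivative blinfun_apply (F x)) (at x)" if "x \<in> U" for x
    using F d that by simp
  moreover have "Blinfun (A 0) o\<^sub>L F 0 = id_blinfun"
    by (rule blinfun_eqI) (use F A assms(3) in \<open>simp add: bounded_linear_Blinfun_apply\<close>)
  ultimately obtain U' V g g' where *: "open U'" "U' \<subseteq> U" "0 \<in> U'" "open V" "f 0 \<in> V" "homeomorphism U' V f g"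
    "\<And>y. y \<in> V \<Longrightarrow> (g has_derivative (g' y)) (at y)"
    "\<And>y. y \<in> V \<Longrightarrow> g' y = inv (blinfun_apply (F(g y)))"
    using inverse_function_theorem[OF assms(2) _ _ assms(3)] by metis
  have gU: "g ` V \<subseteq> U'" using *(6) homeomorphism_def by blast
  have g': "g' y = A (g y)" if "y \<in> V" for y
  proof -
    have "g y \<in> U" using gU *(2) that by blast
    then show ?thesis using *(8)[OF that] F A(3,4)
      by (metis inv_equality)
  qed
  have "Ck_on n V g" for n
  proof (induction n)
    case 0
    then show ?case using *(6) by (simp add: homeomorphism_def)
  next
    case (Suc n)
    show ?case
    proof (rule Ck_on_SucI[OF *(4) *(7)])
      show "Ck_on n V (\<lambda>x. g' x v)" for v
      proof (rule Ck_on_cong[OF *(4)])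
        show "Ck_on n V (\<lambda>x. A (g x) v)"
          using Ck_on_compose[OF *(4) assms(2) _ Suc, of "\<lambda>x. A x v"] A(1)[of v] gU *(2)
          unfolding smooth_on_def by blast
      qed (use g' in auto)
    qed
  qed
  then have "smooth_on V g" by (simp add: smooth_on_def)
  moreover have "smooth_on U' f" using smooth_on_subset * assms by blast
  ultimately show ?thesis
    unfolding diffeo_germ_def using *(1,3-6) assms(4) by auto
qed

section \<open>Germs and their equivalence\<close>

lemma smooth_germI: "open U \<Longrightarrow> 0 \<in> U \<Longrightarrow> smooth_on U f \<Longrightarrow> smooth_germ f"
  unfolding smooth_germ_def by blast

lemma smooth_germ_cong:
  assumes "\<forall>\<^sub>F x in nhds 0. f x = g x" "smooth_germ f"
  shows "smooth_germ g"
proof -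
  obtain U where U: "open U" "0 \<in> U" "smooth_on U f" using assms(2) smooth_germ_def by blast
  obtain V where V: "open V" "0 \<in> V" "\<And>x. x \<in> V \<Longrightarrow> f x = g x" using assms(1) by (auto simp: eventually_nhds)
  have "smooth_on (U \<inter> V) g"
    by (rule smooth_on_cong[OF _ _ smooth_on_subset[OF _ U(3)]]) (use U V in auto)
  then show ?thesis using smooth_germI[of "U \<inter> V"] U V by auto
qed

lemma smooth_germ_eventually_on:
  assumes "smooth_germ f" "smooth_germ g"
  obtains U where "open U" "0 \<in> U" "smooth_on U f" "smooth_on U g"
proof -
  obtain U where U: "open U" "0 \<in> U" "smooth_on U f" using assms(1) smooth_germ_def by blast
  obtain V where V: "open V" "0 \<in> V" "smooth_on V g" using assms(2) smooth_germ_def by blast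
  have "smooth_on (U \<inter> V) f" "smooth_on (U \<inter> V) g"
    by (rule smooth_on_subset[OF _ U(3)], simp) (rule smooth_on_subset[OF _ V(3)], simp)
  then show ?thesis using that[of "U \<inter> V"] U V by auto
qed

lemma smooth_germ_isCont: "smooth_germ f \<Longrightarrow> isCont f 0"
  unfolding smooth_germ_def using smooth_on_continuous continuous_on_eq_continuous_at by blast

lemma eventually_nhds_compose:
  assumes "isCont f a" "\<forall>\<^sub>F y in nhds (f a). P y"
  shows "\<forall>\<^sub>F x in nhds a. P (f x)"
proof -
  obtain W where W: "open W" "f a \<in> W" "\<And>y. y \<in> W \<Longrightarrow> P y" using assms(2) by (auto simp: eventually_nhds)
  have "filterlim f (nhds (f a)) (nhds a)"
    using assms(1) by (metis continuous_at filterlim_at_within_not_equal isCont_def tendsto_at_iff_tendsto_nhds)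
  then have "\<forall>\<^sub>F x in nhds a. f x \<in> W" using W topological_tendstoD by blast
  then show ?thesis by (rule eventually_mono) (use W in auto)
qed

lemma smooth_germ_compose_on:
  fixes f :: "'a::real_normed_vector \<Rightarrow> 'b::euclidean_space" and g :: "'b \<Rightarrow> 'c::real_normed_vector"
  assumes "smooth_germ f" "open T" "f 0 \<in> T" "smooth_on T g"
  shows "smooth_germ (\<lambda>x. g (f x))"
proof -
  obtain U where U: "open U" "0 \<in> U" "smooth_on U f" using assms(1) smooth_germ_def by blast
  have o: "open (U \<inter> f -` T)"
    using continuous_open_preimage[OF smooth_on_continuous[OF U(3)] U(1) assms(2)] by (simp add: Int_def vimage_def)
  have "smooth_on (U \<inter> f -` T) f" by (rule smooth_on_subset[OF _ U(3)]) auto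
  then have "smooth_on (U \<inter> f -` T) (\<lambda>x. g (f x))"
    by (rule smooth_on_compose[OF o assms(2) _ _ assms(4), rotated]) auto
  then show ?thesis by (rule smooth_germI[OF o, rotated]) (use U assms(3) in auto)
qed

lemma smooth_germ_compose:
  fixes f :: "'a::real_normed_vector \<Rightarrow> 'b::euclidean_space" and g :: "'b \<Rightarrow> 'c::real_normed_vector"
  assumes "smooth_germ f" "f 0 = 0" "smooth_germ g"
  shows "smooth_germ (\<lambda>x. g (f x))"
proof -
  obtain T where "open T" "0 \<in> T" "smooth_on T g" using assms(3) smooth_germ_def by blast
  then show ?thesis using smooth_germ_compose_on[OF assms(1), of T g] assms(2) by auto
qed

lemma smooth_germ_const: "smooth_germ (\<lambda>x. c)"
  using smooth_germI[OF open_UNIV _ smooth_on_const] by blast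

lemma smooth_germ_id: "smooth_germ (\<lambda>x. x)"
  using smooth_germI[OF open_UNIV _ smooth_on_id] by blast

lemma smooth_germ_linear: "bounded_linear L \<Longrightarrow> smooth_germ f \<Longrightarrow> smooth_germ (\<lambda>x. L (f x))"
  unfolding smooth_germ_def using smooth_on_linear[of _ L f] by blast

lemma smooth_germ_fst: "smooth_germ (fst :: real \<times> real \<Rightarrow> real)"
  using smooth_germ_linear[OF bounded_linear_fst smooth_germ_id] by simp

lemma smooth_germ_snd: "smooth_germ (snd :: real \<times> real \<Rightarrow> real)"
  using smooth_germ_linear[OF bounded_linear_snd smooth_germ_id] by simp

lemma smooth_germ_add:
  assumes "smooth_germ f" "smooth_germ g" shows "smooth_germ (\<lambda>x. f x + g x)"
proof -
  obtain U where U: "open U" "0 \<in> U" "smooth_on U f" "smooth_on U g"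
    using smooth_germ_eventually_on[OF assms] .
  show ?thesis by (rule smooth_germI[OF U(1,2) smooth_on_add[OF U(1,3,4)]])
qed

lemma smooth_germ_mult:
  fixes f g :: "'a::real_normed_vector \<Rightarrow> real"
  assumes "smooth_germ f" "smooth_germ g" shows "smooth_germ (\<lambda>x. f x * g x)"
proof -
  obtain U where U: "open U" "0 \<in> U" "smooth_on U f" "smooth_on U g"
    using smooth_germ_eventually_on[OF assms] .
  show ?thesis by (rule smooth_germI[OF U(1,2) smooth_on_mult[OF U(1,3,4)]])
qed

lemma smooth_germ_minus: "smooth_germ f \<Longrightarrow> smooth_germ (\<lambda>x. - f x)"
  using smooth_germ_linear[OF bounded_linear_minus[OF bounded_linear_ident]] by blast

lemma smooth_germ_diff:
  assumes "smooth_germ f" "smooth_germ g" shows "smooth_germ (\<lambda>x. f x - g x)"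
  using smooth_germ_add[OF assms(1) smooth_germ_minus[OF assms(2)]] by simp

lemma smooth_germ_power:
  fixes f :: "'a::real_normed_vector \<Rightarrow> real"
  assumes "smooth_germ f" shows "smooth_germ (\<lambda>x. f x ^ n)"
  by (induction n) (auto intro: smooth_germ_const smooth_germ_mult[OF assms])

lemma smooth_germ_sum:
  assumes "finite I" "\<And>i. i \<in> I \<Longrightarrow> smooth_germ (f i)" shows "smooth_germ (\<lambda>x. \<Sum>i\<in>I. f i x)"
  using assms by (induction I rule: finite_induct) (auto intro: smooth_germ_const smooth_germ_add)

lemma smooth_germ_inverse:
  fixes f :: "'a::real_normed_vector \<Rightarrow> real"
  assumes "smooth_germ f" "f 0 \<noteq> 0" shows "smooth_germ (\<lambda>x. inverse (f x))"
proof -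
  have o: "open {x::real. x \<noteq> 0}" by (simp add: open_delete Compl_eq[symmetric] open_Collect_neq)
  show ?thesis using smooth_germ_compose_on[OF assms(1) o _ smooth_on_inverse] assms(2) by blast
qed

lemma smooth_germ_divide:
  fixes f g :: "'a::real_normed_vector \<Rightarrow> real"
  assumes "smooth_germ f" "smooth_germ g" "g 0 \<noteq> 0" shows "smooth_germ (\<lambda>x. f x / g x)"
  using smooth_germ_mult[OF assms(1) smooth_germ_inverse[OF assms(2,3)]] by (simp add: divide_inverse)

lemma smooth_germ_powr:
  fixes f :: "'a::real_normed_vector \<Rightarrow> real"
  assumes "smooth_germ f" "f 0 > 0" shows "smooth_germ (\<lambda>x. f x powr a)"
  using smooth_germ_compose_on[OF assms(1) open_greaterThan _ smooth_on_powr] assms(2) by auto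

lemma smooth_germ_sin:
  fixes f :: "'a::real_normed_vector \<Rightarrow> real"
  assumes "smooth_germ f" shows "smooth_germ (\<lambda>x. sin (f x))"
  using smooth_germ_compose_on[OF assms(1) open_UNIV _ smooth_on_sin_cos(1)] by auto

lemma smooth_germ_cos:
  fixes f :: "'a::real_normed_vector \<Rightarrow> real"
  assumes "smooth_germ f" shows "smooth_germ (\<lambda>x. cos (f x))"
  using smooth_germ_compose_on[OF assms(1) open_UNIV _ smooth_on_sin_cos(2)] by auto

lemma smooth_germ_Pair:
  fixes f g :: "'a::real_normed_vector \<Rightarrow> real"
  assumes "smooth_germ f" "smooth_germ g" shows "smooth_germ (\<lambda>x. (f x, g x))"
proof -
  have 1: "bounded_linear (\<lambda>u::real. (u, 0::real))" and 2: "bounded_linear (\<lambda>u::real. (0::real, u))"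
    by (auto intro!: bounded_linear_Pair bounded_linear_ident bounded_linear_zero)
  show ?thesis
    using smooth_germ_add[OF smooth_germ_linear[OF 1 assms(1)] smooth_germ_linear[OF 2 assms(2)]] by simp
qed

lemma smooth_germ_snd_comp: "smooth_germ f \<Longrightarrow> smooth_germ (\<lambda>x. snd (f x :: real \<times> real))"
  using smooth_germ_linear[OF bounded_linear_snd] by blast

lemma smooth_germ_of_fst: "smooth_germ f \<Longrightarrow> smooth_germ (\<lambda>z :: real \<times> real. f (fst z))"
  by (rule smooth_germ_compose[OF smooth_germ_fst]) auto

lemmas smooth_germ_intros = smooth_germ_const smooth_germ_id smooth_germ_fst smooth_germ_snd smooth_germ_add
  smooth_germ_mult smooth_germ_minus smooth_germ_diff smooth_germ_power smooth_germ_divide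
  smooth_germ_Pair smooth_germ_sin smooth_germ_cos

lemma smooth_germ_deriv:
  fixes f :: "real \<Rightarrow> real"
  assumes "smooth_germ f"
  shows "smooth_germ (deriv f)" "\<forall>\<^sub>F t in nhds 0. (f has_real_derivative deriv f t) (at t)"
    "(f has_real_derivative deriv f 0) (at 0)"
proof -
  obtain U where U: "open U" "0 \<in> U" "smooth_on U f" using assms smooth_germ_def by blast
  show "smooth_germ (deriv f)" using smooth_on_deriv(1)[OF U(3,1)] U smooth_germI by blast
  show "\<forall>\<^sub>F t in nhds 0. (f has_real_derivative deriv f t) (at t)"
    using smooth_on_deriv(2)[OF U(3,1)] U eventually_nhds by blast
  show "(f has_real_derivative deriv f 0) (at 0)" using smooth_on_deriv(2)[OF U(3,1)] U by blast
qed

lemma smooth_germ_real_I: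
  fixes f :: "real \<Rightarrow> real"
  assumes "\<forall>\<^sub>F t in nhds 0. (f has_real_derivative f' t) (at t)" "smooth_germ f'"
  shows "smooth_germ f"
proof -
  obtain U where U: "open U" "0 \<in> U" "smooth_on U f'" using assms(2) smooth_germ_def by blast
  obtain V where V: "open V" "0 \<in> V" "\<And>t. t \<in> V \<Longrightarrow> (f has_real_derivative f' t) (at t)"
    using assms(1) by (auto simp: eventually_nhds)
  have "smooth_on (U \<inter> V) f"
    by (rule smooth_on_real_I[OF _ _ smooth_on_subset[OF _ U(3)]])
      (use U V in \<open>auto simp: has_real_derivative_iff_has_vector_derivative[symmetric]\<close>)
  then show ?thesis using smooth_germI[of "U \<inter> V"] U V by auto
qed

section \<open>Local diffeomorphisms of the line and of the plane\<close>

lemma diffeo_germ_real: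
  fixes h :: "real \<Rightarrow> real"
  assumes "smooth_germ h" "h 0 = 0" "deriv h 0 \<noteq> 0"
  shows "diffeo_germ h"
proof -
  obtain U where U: "open U" "0 \<in> U" "smooth_on U h" using assms smooth_germ_def by blast
  note d = smooth_on_deriv[OF U(3,1)]
  let ?T = "{x::real. x \<noteq> 0}"
  have oT: "open ?T" by (simp add: open_delete Compl_eq[symmetric] open_Collect_neq)
  define W where "W = U \<inter> deriv h -` ?T"
  have oW: "open W" unfolding W_def
    using continuous_open_preimage[OF smooth_on_continuous[OF d(1)] U(1) oT] by simp
  have sW: "smooth_on W h" "smooth_on W (deriv h)" using U d(1) smooth_on_subset[of W U] by (auto simp: W_def)
  have fr: "frechet_derivative h (at x) = (\<lambda>v. v * deriv h x)" if "x \<in> W" for x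
    using d(2)[of x] that frechet_derivative_at[of h "\<lambda>v. v * deriv h x" x]
    by (simp add: W_def has_field_derivative_def mult_commute_abs)
  show ?thesis
  proof (rule diffeo_germ_aux[OF sW(1) oW _ assms(2), of "\<lambda>x v. v * inverse (deriv h x)"])
    show "0 \<in> W" using U assms by (simp add: W_def)
    show "smooth_on W (\<lambda>x. v * inverse (deriv h x))" for v
      by (rule smooth_on_mult[OF oW smooth_on_const smooth_on_compose[OF oW oT _ sW(2) smooth_on_inverse]])
        (auto simp: W_def)
    show "bounded_linear (\<lambda>v. v * inverse (deriv h x))" for x by (rule bounded_linear_mult_left)
  qed (auto simp: fr W_def)
qed

lemma diffeo_germ_plane:
  fixes f :: "real \<times> real \<Rightarrow> real \<times> real"
  assumes "smooth_germ f" "f 0 = 0" 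
    and D0: "(f has_derivative (\<lambda>v. (a * fst v + b * snd v, c * fst v + d * snd v))) (at 0)"
    and det: "a * d - b * c \<noteq> 0"
  shows "diffeo_germ f"
proof -
  obtain U where U: "open U" "0 \<in> U" "smooth_on U f" using assms smooth_germ_def by blast
  define D where "D x = frechet_derivative f (at x)" for x
  define A C B E where "A x = fst (D x (1,0))" and "C x = snd (D x (1,0))"
    and "B x = fst (D x (0,1))" and "E x = snd (D x (0,1))" for x
  have sm: "smooth_on U A" "smooth_on U B" "smooth_on U C" "smooth_on U E"
    unfolding A_def B_def C_def E_def D_def
    by (rule smooth_on_linear[OF U(1)] bounded_linear_fst bounded_linear_snd smooth_on_frechet[OF U(3)])+
  define J where "J x = A x * E x + - (B x * C x)" for x
  have sJ: "smooth_on U J" unfolding J_def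
    by (rule smooth_on_add[OF U(1)] smooth_on_mult[OF U(1)] sm smooth_on_linear[OF U(1) bounded_linear_minus[OF bounded_linear_ident]])+
  let ?T = "{x::real. x \<noteq> 0}"
  have oT: "open ?T" by (simp add: open_delete Compl_eq[symmetric] open_Collect_neq)
  define W where "W = U \<inter> J -` ?T"
  have oW: "open W" unfolding W_def
    using continuous_open_preimage[OF smooth_on_continuous[OF sJ] U(1) oT] by simp
  have WU: "W \<subseteq> U" by (auto simp: W_def)
  note smW = sm[THEN smooth_on_subset[OF WU]] sJ[THEN smooth_on_subset[OF WU]]
  have Dlin: "D x v = (A x * fst v + B x * snd v, C x * fst v + E x * snd v)" if "x \<in> U" for x v
  proof -
    have l: "linear (D x)" unfolding D_def
      using has_derivative_linear[OF smooth_on_has_derivative[OF U(3) that]] .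
    have "v = fst v *\<^sub>R (1,0) + snd v *\<^sub>R (0,1)" by (cases v) auto
    then have "D x v = fst v *\<^sub>R D x (1,0) + snd v *\<^sub>R D x (0,1)"
      using linear_add[OF l] linear_scale[OF l] by metis
    then show ?thesis by (simp add: prod_eq_iff A_def B_def C_def E_def mult.commute)
  qed
  have "D 0 = (\<lambda>v. (a * fst v + b * snd v, c * fst v + d * snd v))"
    unfolding D_def using frechet_derivative_at[OF D0] by simp
  then have J0: "J 0 \<noteq> 0" using det by (simp add: J_def A_def B_def C_def E_def)
  \<comment> \<open>Cramer's rule for the Jacobian matrix with rows \<open>(A, B)\<close> and
    \<open>(C, E)\<close>, whose determinant \<open>J\<close> is nonzero on
    \<open>W\<close>.\<close>
  define G where "G x v = ((E x * fst v + - (B x * snd v)) * inverse (J x), (A x * snd v + - (C x * fst v)) * inverse (J x))" for x v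
  have 1: "bounded_linear (\<lambda>u::real. (u, 0::real))" and 2: "bounded_linear (\<lambda>u::real. (0::real, u))"
    by (auto intro!: bounded_linear_Pair bounded_linear_ident bounded_linear_zero)
  have inv: "smooth_on W (\<lambda>x. inverse (J x))"
    by (rule smooth_on_compose[OF oW oT _ smW(5) smooth_on_inverse]) (auto simp: W_def)
  show ?thesis
  proof (rule diffeo_germ_aux[OF smooth_on_subset[OF WU U(3)] oW _ assms(2), of G])
    show "0 \<in> W" using U J0 by (simp add: W_def)
    show "smooth_on W (\<lambda>x. G x v)" for v
    proof -
      have "smooth_on W (\<lambda>x. (E x * fst v + - (B x * snd v)) * inverse (J x))"
        "smooth_on W (\<lambda>x. (A x * snd v + - (C x * fst v)) * inverse (J x))"
        by (rule smooth_on_add[OF oW] inv smooth_on_mult[OF oW] smW smooth_on_const smooth_on_linear[OF oW bounded_linear_minus[OF bounded_linear_ident]])+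
      from smooth_on_add[OF oW smooth_on_linear[OF oW 1 this(1)] smooth_on_linear[OF oW 2 this(2)]]
      show ?thesis by (simp add: G_def)
    qed
    show "bounded_linear (G x)" for x unfolding G_def
      by (intro bounded_linear_Pair bounded_linear_mult_const bounded_linear_add bounded_linear_minus bounded_linear_const_mult
          bounded_linear_fst bounded_linear_snd)
    fix x v assume x: "x \<in> W"
    then have J: "J x \<noteq> 0" and xU: "x \<in> U" by (auto simp: W_def)
    have J': "A x * E x - B x * C x = J x" by (simp add: J_def)
    show "G x (frechet_derivative f (at x) v) = v" "frechet_derivative f (at x) (G x v) = v"
      unfolding D_def[symmetric] Dlin[OF xU] G_def prod_eq_iff fst_conv snd_conv
      using J J' by (auto simp: field_simps; algebra)+
  qed
qed

section \<open>Composition and inversion of diffeomorphism germs; the equivalence relation\<close>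

lemma diffeo_germ_smooth: "diffeo_germ h \<Longrightarrow> smooth_germ h" "diffeo_germ h \<Longrightarrow> h 0 = 0"
  unfolding diffeo_germ_def smooth_germ_def by blast+

lemma diffeo_germ_compose:
  fixes f g :: "'a::euclidean_space \<Rightarrow> 'a"
  assumes "diffeo_germ f" "diffeo_germ g"
  shows "diffeo_germ (\<lambda>x. g (f x))"
proof -
  obtain U V f' where f: "f 0 = 0" "open U" "0 \<in> U" "open V" "0 \<in> V" "homeomorphism U V f f'" "smooth_on U f" "smooth_on V f'"
    using assms(1) unfolding diffeo_germ_def by blast
  obtain X Y g' where g: "g 0 = 0" "open X" "0 \<in> X" "open Y" "0 \<in> Y" "homeomorphism X Y g g'" "smooth_on X g" "smooth_on Y g'"
    using assms(2) unfolding diffeo_germ_def by blast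
  let ?A = "U \<inter> f -` (V \<inter> X)" let ?B = "Y \<inter> g' -` (V \<inter> X)"
  have oA: "open ?A"
    by (rule continuous_open_preimage[OF smooth_on_continuous[OF f(7)] f(2)]) (use f g in auto)
  have oB: "open ?B"
    by (rule continuous_open_preimage[OF smooth_on_continuous[OF g(8)] g(4)]) (use f g in auto)
  have fh: "f ` U = V" "f' ` V = U" "\<And>x. x \<in> U \<Longrightarrow> f' (f x) = x" "\<And>x. x \<in> V \<Longrightarrow> f (f' x) = x"
    using f(6) by (auto simp: homeomorphism_def)
  have gh: "g ` X = Y" "g' ` Y = X" "\<And>x. x \<in> X \<Longrightarrow> g' (g x) = x" "\<And>x. x \<in> Y \<Longrightarrow> g (g' x) = x"
    using g(6) by (auto simp: homeomorphism_def)
  have s1: "smooth_on ?A (\<lambda>x. g (f x))"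
    by (rule smooth_on_compose[OF oA g(2) _ smooth_on_subset[OF _ f(7)] g(7)]) auto
  have s2: "smooth_on ?B (\<lambda>x. f' (g' x))"
    by (rule smooth_on_compose[OF oB f(4) _ smooth_on_subset[OF _ g(8)] f(8)]) auto
  have hom: "homeomorphism ?A ?B (\<lambda>x. g (f x)) (\<lambda>x. f' (g' x))"
  proof (rule homeomorphismI)
    show "continuous_on ?A (\<lambda>x. g (f x))" "continuous_on ?B (\<lambda>x. f' (g' x))"
      using s1 s2 smooth_on_continuous by blast+
    show "(\<lambda>x. g (f x)) ` ?A \<subseteq> ?B" using gh fh by auto
    show "(\<lambda>x. f' (g' x)) ` ?B \<subseteq> ?A" using gh fh by auto
  qed (use fh gh in auto)
  have "g' 0 = 0" using gh(3)[OF g(3)] g(1) by simp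
  then have "0 \<in> ?B" using f g by simp
  moreover have "0 \<in> ?A" using f g by simp
  moreover have "g (f 0) = 0" using f g by simp
  ultimately show ?thesis unfolding diffeo_germ_def using hom oA oB s1 s2 by blast
qed

lemma diffeo_germ_inverse:
  fixes f :: "'a::euclidean_space \<Rightarrow> 'a"
  assumes "diffeo_germ f"
  obtains g where "diffeo_germ g" "\<forall>\<^sub>F x in nhds 0. g (f x) = x" "\<forall>\<^sub>F x in nhds 0. f (g x) = x"
proof -
  obtain U V g where f: "f 0 = 0" "open U" "0 \<in> U" "open V" "0 \<in> V" "homeomorphism U V f g" "smooth_on U f" "smooth_on V g"
    using assms(1) unfolding diffeo_germ_def by blast
  have fh: "\<And>x. x \<in> U \<Longrightarrow> g (f x) = x" "\<And>x. x \<in> V \<Longrightarrow> f (g x) = x"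
    using f(6) by (auto simp: homeomorphism_def)
  show ?thesis
  proof (rule that)
    show "diffeo_germ g" unfolding diffeo_germ_def
      using f homeomorphism_symD fh(1)[OF f(3)] by metis
    show "\<forall>\<^sub>F x in nhds 0. g (f x) = x" "\<forall>\<^sub>F x in nhds 0. f (g x) = x"
      using f fh eventually_nhds by blast+
  qed
qed

lemma diffeo_eventually:
  assumes "diffeo_germ h" "\<forall>\<^sub>F x in nhds 0. P x"
  shows "\<forall>\<^sub>F x in nhds 0. P (h x)"
  by (rule eventually_nhds_compose[OF smooth_germ_isCont[OF diffeo_germ_smooth(1)[OF assms(1)]]])
    (use diffeo_germ_smooth(2)[OF assms(1)] assms(2) in simp)

lemma diffeo_germ_id: "diffeo_germ (\<lambda>x::'a::euclidean_space. x)"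
  unfolding diffeo_germ_def using smooth_on_id[OF open_UNIV] homeomorphism_ident by blast

lemma A_equivalent_sym:
  assumes "A_equivalent f g" shows "A_equivalent g f"
proof -
  obtain h p where *: "plane_curve_germ f" "plane_curve_germ g" "diffeo_germ h" "diffeo_germ p"
    "\<forall>\<^sub>F t in nhds 0. f (h t) = p (g t)" using assms unfolding A_equivalent_def by auto
  obtain k where k: "diffeo_germ k" "\<forall>\<^sub>F x in nhds 0. k (h x) = x" "\<forall>\<^sub>F x in nhds 0. h (k x) = x"
    using diffeo_germ_inverse[OF *(3)] by blast
  obtain q where q: "diffeo_germ q" "\<forall>\<^sub>F x in nhds 0. q (p x) = x"
    using diffeo_germ_inverse[OF *(4)] by blast
  have "smooth_germ g" "g 0 = 0" using *(2) unfolding plane_curve_germ_def by auto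
  then have "\<forall>\<^sub>F x in nhds 0. q (p (g x)) = g x"
    using eventually_nhds_compose[OF smooth_germ_isCont, of g "\<lambda>x. q (p x) = x"] q(2) by simp
  from diffeo_eventually[OF k(1) this] diffeo_eventually[OF k(1) *(5)] k(3)
  have "\<forall>\<^sub>F t in nhds 0. g (k t) = q (f t)"
    by eventually_elim auto
  then show ?thesis unfolding A_equivalent_def using * k q by blast
qed

lemma A_equivalent_trans:
  assumes "A_equivalent f g" "A_equivalent g l" shows "A_equivalent f l"
proof -
  obtain h p where *: "plane_curve_germ f" "plane_curve_germ g" "diffeo_germ h" "diffeo_germ p"
    "\<forall>\<^sub>F t in nhds 0. f (h t) = p (g t)" using assms unfolding A_equivalent_def by auto
  obtain k q where k: "plane_curve_germ l" "diffeo_germ k" "diffeo_germ q"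
    "\<forall>\<^sub>F t in nhds 0. g (k t) = q (l t)" using assms unfolding A_equivalent_def by auto
  from diffeo_eventually[OF k(2) *(5)] k(4)
  have "\<forall>\<^sub>F t in nhds 0. f (h (k t)) = p (q (l t))" by eventually_elim auto
  then show ?thesis unfolding A_equivalent_def
    using * k diffeo_germ_compose[OF k(2) *(3)] diffeo_germ_compose[OF k(3) *(4)] by blast
qed

lemma A_equivalent_right:
  assumes "smooth_germ f" "f 0 = 0" "diffeo_germ h" "\<forall>\<^sub>F t in nhds 0. f (h t) = g t"
  shows "A_equivalent f g"
proof -
  have "smooth_germ (\<lambda>t. f (h t))" using smooth_germ_compose diffeo_germ_smooth[OF assms(3)] assms(1) by blast
  then have "smooth_germ g" by (rule smooth_germ_cong[OF assms(4)])
  moreover have "g 0 = 0" using eventually_nhds_x_imp_x[OF assms(4)] diffeo_germ_smooth[OF assms(3)] assms(2) by auto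
  ultimately show ?thesis unfolding A_equivalent_def plane_curve_germ_def
    using assms diffeo_germ_id by blast
qed

lemma A_equivalent_left:
  assumes "smooth_germ g" "g 0 = 0" "diffeo_germ p" "\<forall>\<^sub>F t in nhds 0. f t = p (g t)"
  shows "A_equivalent f g"
proof -
  have "smooth_germ (\<lambda>t. p (g t))" using smooth_germ_compose diffeo_germ_smooth[OF assms(3)] assms(1,2) by blast
  have "\<forall>\<^sub>F t in nhds 0. p (g t) = f t" using assms(4) by eventually_elim auto
  then have "smooth_germ f" by (rule smooth_germ_cong) fact
  moreover have "f 0 = 0" using eventually_nhds_x_imp_x[OF assms(4)] diffeo_germ_smooth[OF assms(3)] assms(2) by auto
  ultimately show ?thesis unfolding A_equivalent_def plane_curve_germ_def
    using assms diffeo_germ_id by blast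
qed

lemma smooth_germ_fst_deriv:
  assumes "smooth_germ f"
  shows "((\<lambda>z :: real \<times> real. f (fst z)) has_derivative (\<lambda>v. deriv f 0 * fst v)) (at 0)"
proof -
  have "(f has_derivative (*) (deriv f 0)) (at (fst (0 :: real \<times> real)))"
    using smooth_germ_deriv(3)[OF assms] by (simp add: has_field_derivative_def)
  with bounded_linear_imp_has_derivative[OF bounded_linear_fst]
  show ?thesis by (rule has_derivative_compose)
qed

section \<open>Order of vanishing and Taylor coefficients\<close>

text \<open>The filter is \<open>nhds 0\<close>, not \<open>at 0\<close>, so that \<open>ord_ge N f\<close> with \<open>N > 0\<close> forces \<open>f 0 = 0\<close>.\<close>

definition ord_ge :: "nat \<Rightarrow> (real \<Rightarrow> real) \<Rightarrow> bool" where
  "ord_ge N f \<longleftrightarrow> (\<exists>C. \<forall>\<^sub>F t in nhds 0. \<bar>f t\<bar> \<le> C * \<bar>t\<bar> ^ N)"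

definition co :: "(real \<Rightarrow> real) \<Rightarrow> nat \<Rightarrow> real" where
  "co f i = taylor_coeff f i / fact i"

lemma ord_geI: "\<forall>\<^sub>F t in nhds 0. \<bar>f t\<bar> \<le> C * \<bar>t\<bar> ^ N \<Longrightarrow> ord_ge N f"
  unfolding ord_ge_def by blast

lemma ord_geE:
  assumes "ord_ge N f"
  obtains C where "C > 0" "\<forall>\<^sub>F t in nhds 0. \<bar>f t\<bar> \<le> C * \<bar>t\<bar> ^ N"
proof -
  obtain C where C: "\<forall>\<^sub>F t in nhds 0. \<bar>f t\<bar> \<le> C * \<bar>t\<bar> ^ N" using assms ord_ge_def by blast
  have "\<forall>\<^sub>F t in nhds 0. \<bar>f t\<bar> \<le> (\<bar>C\<bar> + 1) * \<bar>t\<bar> ^ N"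
    using C
  proof eventually_elim
    case (elim t)
    have "C * \<bar>t\<bar> ^ N \<le> (\<bar>C\<bar> + 1) * \<bar>t\<bar> ^ N" by (intro mult_right_mono) auto
    then show ?case using elim by linarith
  qed
  then show ?thesis using that[of "\<bar>C\<bar> + 1"] by linarith
qed

lemma ord_ge_cong: "\<forall>\<^sub>F t in nhds 0. f t = g t \<Longrightarrow> ord_ge N f \<Longrightarrow> ord_ge N g"
  unfolding ord_ge_def by (elim exE, rule exI) (erule (1) eventually_elim2, simp)

lemma eventually_abs_le: "e > 0 \<Longrightarrow> \<forall>\<^sub>F t in nhds (0::real). \<bar>t\<bar> \<le> e"
  unfolding eventually_nhds_metric by (intro exI[of _ e]) (auto simp: dist_real_def)

lemma ord_ge_mono:
  assumes "ord_ge N f" "M \<le> N" shows "ord_ge M f"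
proof (rule ord_geE[OF assms(1)])
  fix C assume C: "C > 0" "\<forall>\<^sub>F t in nhds 0. \<bar>f t\<bar> \<le> C * \<bar>t\<bar> ^ N"
  have "\<forall>\<^sub>F t in nhds 0. \<bar>f t\<bar> \<le> C * \<bar>t\<bar> ^ M"
    using C(2) eventually_abs_le[of 1, simplified]
  proof eventually_elim
    case (elim t)
    have "\<bar>t\<bar> ^ N \<le> \<bar>t\<bar> ^ M" using elim assms(2) by (intro power_decreasing) auto
    then show ?case using elim C(1) mult_left_mono[of "\<bar>t\<bar> ^ N" "\<bar>t\<bar> ^ M" C] by linarith
  qed
  then show ?thesis by (rule ord_geI)
qed

lemma ord_ge_add:
  assumes "ord_ge N f" "ord_ge N g" shows "ord_ge N (\<lambda>t. f t + g t)"
proof -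
  obtain C D where C: "\<forall>\<^sub>F t in nhds 0. \<bar>f t\<bar> \<le> C * \<bar>t\<bar> ^ N" and D: "\<forall>\<^sub>F t in nhds 0. \<bar>g t\<bar> \<le> D * \<bar>t\<bar> ^ N"
    using assms ord_ge_def by blast
  have "\<forall>\<^sub>F t in nhds 0. \<bar>f t + g t\<bar> \<le> (C + D) * \<bar>t\<bar> ^ N"
    using C D by eventually_elim (simp add: distrib_right)
  then show ?thesis by (rule ord_geI)
qed

lemma ord_ge_mult:
  assumes "ord_ge N f" "ord_ge M g" shows "ord_ge (N + M) (\<lambda>t. f t * g t)"
proof -
  obtain C D where C: "C > 0" "\<forall>\<^sub>F t in nhds 0. \<bar>f t\<bar> \<le> C * \<bar>t\<bar> ^ N" and D: "\<forall>\<^sub>F t in nhds 0. \<bar>g t\<bar> \<le> D * \<bar>t\<bar> ^ M"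
    using assms ord_geE by metis
  have "\<forall>\<^sub>F t in nhds 0. \<bar>f t * g t\<bar> \<le> (C * D) * \<bar>t\<bar> ^ (N + M)"
    using C(2) D
  proof eventually_elim
    case (elim t)
    have "\<bar>f t\<bar> * \<bar>g t\<bar> \<le> (C * \<bar>t\<bar> ^ N) * (D * \<bar>t\<bar> ^ M)"
      by (rule mult_mono) (use elim C(1) in auto)
    then show ?case by (simp add: abs_mult power_add mult_ac)
  qed
  then show ?thesis by (rule ord_geI)
qed

lemma ord_ge_const: "ord_ge 0 (\<lambda>t. c)"
  by (rule ord_geI[of _ "\<bar>c\<bar>"]) simp

lemma ord_ge_zero: "ord_ge N (\<lambda>t. 0)"
  by (rule ord_geI[of _ 0]) simp

lemma ord_ge_cmult: "ord_ge N f \<Longrightarrow> ord_ge N (\<lambda>t. c * f t)"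
  using ord_ge_mult[OF ord_ge_const] by simp

lemma ord_ge_minus: "ord_ge N f \<Longrightarrow> ord_ge N (\<lambda>t. - f t)"
  using ord_ge_cmult[of N f "-1"] by simp

lemma ord_ge_diff: "ord_ge N f \<Longrightarrow> ord_ge N g \<Longrightarrow> ord_ge N (\<lambda>t. f t - g t)"
  using ord_ge_add[of N f "\<lambda>t. - g t"] ord_ge_minus by simp

lemma ord_ge_id: "ord_ge 1 (\<lambda>t. t)"
  by (rule ord_geI[of _ 1]) simp

lemma ord_ge_monom: "N \<le> n \<Longrightarrow> ord_ge N (\<lambda>t. t ^ n)"
  by (rule ord_ge_mono[of n], rule ord_geI[of _ 1]) (auto simp: power_abs)

lemma ord_ge_power: "ord_ge N f \<Longrightarrow> ord_ge (N * k) (\<lambda>t. f t ^ k)"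
proof (induction k)
  case (Suc k)
  then show ?case using ord_ge_mult[OF Suc.prems Suc.IH[OF Suc.prems]] by simp
qed (simp add: ord_ge_const)

lemma isCont_ord_ge_0:
  assumes "isCont f 0" shows "ord_ge 0 f"
proof -
  have "\<forall>\<^sub>F y in nhds (f 0). \<bar>y\<bar> \<le> \<bar>f 0\<bar> + 1"
    unfolding eventually_nhds_metric by (intro exI[of _ 1]) (auto simp: dist_real_def)
  from eventually_nhds_compose[OF assms this] show ?thesis
    by (intro ord_geI[of _ "\<bar>f 0\<bar> + 1"]) simp
qed

lemma smooth_ord_ge_0: "smooth_germ f \<Longrightarrow> ord_ge 0 f"
  using isCont_ord_ge_0 smooth_germ_isCont by blast

lemma ord_ge_compose:
  assumes "ord_ge N f" "ord_ge M g" "isCont g 0" "g 0 = 0"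
  shows "ord_ge (M * N) (\<lambda>t. f (g t))"
proof -
  obtain C where C: "C > 0" "\<forall>\<^sub>F t in nhds 0. \<bar>f t\<bar> \<le> C * \<bar>t\<bar> ^ N" using assms(1) by (rule ord_geE)
  obtain D where D: "D > 0" "\<forall>\<^sub>F t in nhds 0. \<bar>g t\<bar> \<le> D * \<bar>t\<bar> ^ M" using assms(2) by (rule ord_geE)
  have "\<forall>\<^sub>F t in nhds 0. \<bar>f (g t)\<bar> \<le> C * \<bar>g t\<bar> ^ N"
    by (rule eventually_nhds_compose[OF assms(3)]) (use C assms(4) in simp)
  then have "\<forall>\<^sub>F t in nhds 0. \<bar>f (g t)\<bar> \<le> (C * D ^ N) * \<bar>t\<bar> ^ (M * N)"
    using D(2)
  proof eventually_elim
    case (elim t)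
    have "\<bar>g t\<bar> ^ N \<le> (D * \<bar>t\<bar> ^ M) ^ N" by (rule power_mono) (use elim in auto)
    then have "C * \<bar>g t\<bar> ^ N \<le> C * (D * \<bar>t\<bar> ^ M) ^ N" using C(1) by (intro mult_left_mono) auto
    then show ?case using elim by (simp add: power_mult_distrib power_mult mult_ac)
  qed
  then show ?thesis by (rule ord_geI)
qed

text \<open>Mean value inequality on \<open>[-|t|, |t|]\<close>, where the derivative is at most
  \<open>C |t|^N\<close>; the symmetric interval serves both signs of \<open>t\<close>. Taylor's
  theorem and the expansions of the curves rest on this.\<close>

lemma ord_ge_integrate:
  assumes "\<forall>\<^sub>F t in nhds 0. (f has_real_derivative f' t) (at t)" "f 0 = 0" "ord_ge N f'"
  shows "ord_ge (Suc N) f"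
proof -
  obtain C where C: "C > 0" "\<forall>\<^sub>F t in nhds 0. \<bar>f' t\<bar> \<le> C * \<bar>t\<bar> ^ N" using assms(3) by (rule ord_geE)
  from eventually_conj[OF assms(1) C(2)] obtain d where d: "d > 0"
    "\<And>t. \<bar>t\<bar> < d \<Longrightarrow> (f has_real_derivative f' t) (at t) \<and> \<bar>f' t\<bar> \<le> C * \<bar>t\<bar> ^ N"
    by (auto simp: eventually_nhds_metric dist_real_def)
  have "\<bar>f t\<bar> \<le> C * \<bar>t\<bar> ^ Suc N" if "\<bar>t\<bar> < d" for t
  proof -
    have "norm (f t - f 0) \<le> (C * \<bar>t\<bar> ^ N) * norm (t - 0)"
    proof (rule field_differentiable_bound[of "{-\<bar>t\<bar>..\<bar>t\<bar>}" f f'])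
      fix z assume "z \<in> {-\<bar>t\<bar>..\<bar>t\<bar>}"
      then have z: "\<bar>z\<bar> \<le> \<bar>t\<bar>" by auto
      then show "(f has_real_derivative f' z) (at z within {-\<bar>t\<bar>..\<bar>t\<bar>})"
        using d(2)[of z] that has_field_derivative_at_within by auto
      have "C * \<bar>z\<bar> ^ N \<le> C * \<bar>t\<bar> ^ N" using z C(1) by (intro mult_left_mono power_mono) auto
      then show "norm (f' z) \<le> C * \<bar>t\<bar> ^ N" using d(2)[of z] that z by auto
    qed auto
    then show ?thesis using assms(2) by (simp add: mult_ac)
  qed
  then have "\<forall>\<^sub>F t in nhds 0. \<bar>f t\<bar> \<le> C * \<bar>t\<bar> ^ Suc N"
    using d(1) by (auto simp: eventually_nhds_metric dist_real_def)
  then show ?thesis by (rule ord_geI)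
qed

lemma ord_ge_monom_zero:
  assumes "ord_ge (Suc n) (\<lambda>t. c * t ^ n)" shows "c = 0"
proof (rule ccontr)
  assume c: "c \<noteq> 0"
  obtain C where C: "C > 0" "\<forall>\<^sub>F t in nhds 0. \<bar>c * t ^ n\<bar> \<le> C * \<bar>t\<bar> ^ Suc n" using assms by (rule ord_geE)
  then obtain d where d: "d > 0" "\<And>t. \<bar>t\<bar> < d \<Longrightarrow> \<bar>c * t ^ n\<bar> \<le> C * \<bar>t\<bar> ^ Suc n"
    by (auto simp: eventually_nhds_metric dist_real_def)
  \<comment> \<open>Small enough that \<open>C * t\<close> is at most half of \<open>|c|\<close>;
    the positive factor \<open>t ^ n\<close> then cancels.\<close>
  define t where "t = min (d / 2) (\<bar>c\<bar> / (2 * C))"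
  have t: "t > 0" "t < d" "t \<le> \<bar>c\<bar> / (2 * C)" using c d(1) C(1) by (auto simp: t_def min_def)
  have "\<bar>c\<bar> * t ^ n \<le> (C * t) * t ^ n" using d(2)[of t] t by (simp add: abs_mult power_abs mult_ac)
  then have "\<bar>c\<bar> \<le> C * t" using t(1) by simp
  also have "\<dots> \<le> C * (\<bar>c\<bar> / (2 * C))" using t C(1) by (intro mult_left_mono) auto
  also have "\<dots> = \<bar>c\<bar> / 2" using C(1) by simp
  finally show False using c by auto
qed

lemma taylor_coeff_deriv: "taylor_coeff (deriv f) i = taylor_coeff f (Suc i)"
  by (simp add: taylor_coeff_def funpow_swap1)

lemma co_deriv: "co (deriv f) i = real (Suc i) * co f (Suc i)"
  by (simp add: co_def taylor_coeff_deriv del: of_nat_Suc)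

lemma co_0: "co f 0 = f 0"
  by (simp add: co_def taylor_coeff_def)

lemma co_1: "co f (Suc 0) = deriv f 0"
  by (simp add: co_def taylor_coeff_def)

text \<open>Taylor's theorem by integration: the derivative of the remainder of \<open>f\<close> at
  order \<open>Suc N\<close> is the remainder of \<open>deriv f\<close> at order \<open>N\<close>,
  since \<open>co_deriv\<close> matches the coefficients.\<close>

lemma taylor_ord_ge:
  assumes "smooth_germ f" shows "ord_ge N (\<lambda>t. f t - (\<Sum>i<N. co f i * t ^ i))"
  using assms
proof (induction N arbitrary: f)
  case 0
  then show ?case by (simp add: smooth_ord_ge_0)
next
  case (Suc N)
  let ?g = "\<lambda>t. f t - (\<Sum>i<Suc N. co f i * t ^ i)"
  have "((\<lambda>t. \<Sum>i<Suc N. co f i * t ^ i) has_real_derivative (\<Sum>i<N. co (deriv f) i * t ^ i)) (at t)" for t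
  proof -
    have "((\<lambda>t. co f 0 + (\<Sum>i<N. co f (Suc i) * t ^ Suc i)) has_real_derivative 0 + (\<Sum>i<N. co f (Suc i) * (real (Suc i) * t ^ i))) (at t)"
    proof (rule DERIV_add[OF DERIV_const DERIV_sum])
      fix i
      show "((\<lambda>t. co f (Suc i) * t ^ Suc i) has_real_derivative co f (Suc i) * (real (Suc i) * t ^ i)) (at t)"
        by (rule DERIV_cmult) (use DERIV_pow[of "Suc i" t] in simp)
    qed
    then show ?thesis
      unfolding sum.lessThan_Suc_shift co_deriv by (simp only: add_0_left power_0 mult_1_right mult_1_left mult_ac)
  qed
  then have "\<forall>\<^sub>F t in nhds 0. (?g has_real_derivative deriv f t - (\<Sum>i<N. co (deriv f) i * t ^ i)) (at t)"
    using smooth_germ_deriv(2)[OF Suc.prems] by (elim eventually_mono) (rule DERIV_diff)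
  moreover have "?g 0 = 0" unfolding sum.lessThan_Suc_shift by (simp add: co_0)
  ultimately show ?case by (rule ord_ge_integrate) (rule Suc.IH[OF smooth_germ_deriv(1)[OF Suc.prems]])
qed

lemma ord_ge_poly_zero:
  assumes "ord_ge N (\<lambda>t. \<Sum>i<N. a i * t ^ i)" "i < N" shows "a i = 0"
  using assms
proof (induction N arbitrary: i)
  case (Suc N)
  have "ord_ge N (\<lambda>t. (\<Sum>i<Suc N. a i * t ^ i) - a N * t ^ N)"
    by (intro ord_ge_diff ord_ge_mono[OF Suc.prems(1)] ord_ge_cmult ord_ge_monom) auto
  then have z: "a j = 0" if "j < N" for j using Suc.IH that by simp
  then have "ord_ge (Suc N) (\<lambda>t. a N * t ^ N)" using Suc.prems(1) by simp
  then have "a N = 0" by (rule ord_ge_monom_zero)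
  then show ?case using z Suc.prems(2) less_Suc_eq by auto
qed simp

text \<open>Coefficients are computed by exhibiting any polynomial that approximates
  \<open>f\<close> to order \<open>N\<close>. Two such polynomials differ by one of degree below
  \<open>N\<close> and order at least \<open>N\<close>, which is zero.\<close>

lemma co_unique:
  assumes "smooth_germ f" "ord_ge N (\<lambda>t. f t - (\<Sum>i<N. a i * t ^ i))" "i < N"
  shows "co f i = a i"
proof -
  have "ord_ge N (\<lambda>t. (f t - (\<Sum>i<N. a i * t ^ i)) - (f t - (\<Sum>i<N. co f i * t ^ i)))"
    by (intro ord_ge_diff assms taylor_ord_ge)
  then have "ord_ge N (\<lambda>t. \<Sum>i<N. (co f i - a i) * t ^ i)"
    by (simp add: sum_subtractf left_diff_distrib)
  from ord_ge_poly_zero[OF this assms(3)] show ?thesis by simp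
qed

lemma ord_ge_iff_co:
  assumes "smooth_germ f" shows "ord_ge N f \<longleftrightarrow> (\<forall>i<N. co f i = 0)"
proof
  assume "ord_ge N f"
  then show "\<forall>i<N. co f i = 0" using co_unique[OF assms, of N "\<lambda>_. 0"] by simp
next
  assume "\<forall>i<N. co f i = 0"
  then show "ord_ge N f" using taylor_ord_ge[OF assms, of N] by simp
qed

lemma co_lead_iff:
  assumes "smooth_germ f"
  shows "ord_ge (Suc n) (\<lambda>t. f t - c * t ^ n) \<longleftrightarrow> (\<forall>i<n. co f i = 0) \<and> co f n = c"
proof -
  have *: "(\<Sum>i<Suc n. (if i = n then c else 0) * t ^ i) = c * t ^ n" for t :: real
    by (subst sum.lessThan_Suc) simp
  show ?thesis
  proof
    assume "ord_ge (Suc n) (\<lambda>t. f t - c * t ^ n)"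
    then show "(\<forall>i<n. co f i = 0) \<and> co f n = c"
      using co_unique[OF assms, of "Suc n" "\<lambda>i. if i = n then c else 0"] unfolding * by auto
  next
    assume "(\<forall>i<n. co f i = 0) \<and> co f n = c"
    then show "ord_ge (Suc n) (\<lambda>t. f t - c * t ^ n)" using taylor_ord_ge[OF assms, of "Suc n"] by simp
  qed
qed

lemma co_add: "smooth_germ f \<Longrightarrow> smooth_germ g \<Longrightarrow> co (\<lambda>t. f t + g t) i = co f i + co g i"
  using co_unique[OF smooth_germ_add, of f g "Suc i" "\<lambda>i. co f i + co g i" i]
    ord_ge_add[OF taylor_ord_ge[of f "Suc i"] taylor_ord_ge[of g "Suc i"]]
  by (simp add: sum.distrib distrib_right algebra_simps)

lemma co_cmult: "smooth_germ f \<Longrightarrow> co (\<lambda>t. c * f t) i = c * co f i"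
  using co_unique[OF smooth_germ_mult[OF smooth_germ_const], of f "Suc i" c "\<lambda>i. c * co f i" i]
    ord_ge_cmult[OF taylor_ord_ge[of f "Suc i"], of c]
  by (simp add: sum_distrib_left algebra_simps)

lemma co_diff: "smooth_germ f \<Longrightarrow> smooth_germ g \<Longrightarrow> co (\<lambda>t. f t - g t) i = co f i - co g i"
  using co_add[of f "\<lambda>t. -1 * g t" i] co_cmult[of g "-1" i] smooth_germ_minus[of g] by simp

lemma co_sum:
  assumes "finite I" "\<And>j. j \<in> I \<Longrightarrow> smooth_germ (f j)"
  shows "co (\<lambda>t. \<Sum>j\<in>I. f j t) i = (\<Sum>j\<in>I. co (f j) i)"
  using assms
proof (induction I rule: finite_induct)
  case empty
  then show ?case using ord_ge_iff_co[OF smooth_germ_const[of 0], of "Suc i"] ord_ge_zero by simp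
next
  case (insert j J)
  then show ?case using co_add[of "f j" "\<lambda>t. \<Sum>j\<in>J. f j t" i] smooth_germ_sum[of J f] by simp
qed

lemma co_cong: 
  assumes "smooth_germ f" "\<forall>\<^sub>F t in nhds 0. f t = g t" shows "co g i = co f i"
proof -
  have "\<forall>\<^sub>F t in nhds 0. 0 = f t - g t" using assms(2) by eventually_elim simp
  then have "ord_ge (Suc i) (\<lambda>t. f t - g t)" by (rule ord_ge_cong[OF _ ord_ge_zero])
  then show ?thesis
    using ord_ge_iff_co[OF smooth_germ_diff[OF assms(1) smooth_germ_cong[OF assms(2,1)]]]
      co_diff[OF assms(1) smooth_germ_cong[OF assms(2,1)]] by simp
qed

lemma co_monom_comp:
  assumes r: "smooth_germ r" and m: "m \<ge> 1"
  shows "co (\<lambda>t. t ^ e * r (t ^ m)) i = (if e \<le> i \<and> m dvd (i - e) then co r ((i - e) div m) else 0)"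
proof -
  \<comment> \<open>An expansion of \<open>r\<close> to order \<open>K\<close> gives one of the
    composite to order \<open>e + m * K\<close>, which exceeds \<open>i\<close>.\<close>
  define K where "K = Suc i"
  let ?a = "\<lambda>i. if e \<le> i \<and> m dvd (i - e) then co r ((i - e) div m) else 0"
  have s: "smooth_germ (\<lambda>t::real. t ^ m)" by (intro smooth_germ_intros)
  have s': "smooth_germ (\<lambda>t. t ^ e * r (t ^ m))"
    by (intro smooth_germ_intros smooth_germ_compose[OF s _ r]) (use m in auto)
  have "ord_ge (m * K) (\<lambda>t. r (t ^ m) - (\<Sum>j<K. co r j * (t ^ m) ^ j))"
    by (rule ord_ge_compose[OF taylor_ord_ge[OF r] ord_ge_monom[OF order_refl] smooth_germ_isCont[OF s]])
      (use m in auto)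
  from ord_ge_mult[OF ord_ge_monom[OF order_refl, of e] this]
  have "ord_ge (e + m * K) (\<lambda>t. t ^ e * (r (t ^ m) - (\<Sum>j<K. co r j * (t ^ m) ^ j)))" .
  moreover have "t ^ e * (r (t ^ m) - (\<Sum>j<K. co r j * (t ^ m) ^ j)) = t ^ e * r (t ^ m) - (\<Sum>i<e + m * K. ?a i * t ^ i)" for t
  proof -
    have "(\<Sum>i<e + m * K. ?a i * t ^ i) = (\<Sum>i\<in>(\<lambda>j. e + m * j) ` {..<K}. ?a i * t ^ i)"
    proof (rule sum.mono_neutral_right)
      show "\<forall>i\<in>{..<e + m * K} - (\<lambda>j. e + m * j) ` {..<K}. ?a i * t ^ i = 0"
      proof
        fix i assume i: "i \<in> {..<e + m * K} - (\<lambda>j. e + m * j) ` {..<K}"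
        have False if "e \<le> i" "m dvd i - e"
        proof -
          obtain k where "i - e = m * k" using \<open>m dvd i - e\<close> by (elim dvdE)
          then have k: "i = e + m * k" using \<open>e \<le> i\<close> by simp
          then have "k < K" using i by simp
          then show False using i k by blast
        qed
        then show "?a i * t ^ i = 0" by auto
      qed
    qed (use m in auto)
    also have "\<dots> = (\<Sum>j<K. ?a (e + m * j) * t ^ (e + m * j))"
      by (rule sum.reindex_cong[OF _ refl]) (use m in \<open>auto simp: inj_on_def\<close>)
    also have "\<dots> = t ^ e * (\<Sum>j<K. co r j * (t ^ m) ^ j)"
      unfolding sum_distrib_left by (rule sum.cong) (use m in \<open>auto simp: power_add power_mult\<close>)
    finally show ?thesis by (simp add: right_diff_distrib)
  qed
  ultimately have "ord_ge (e + m * K) (\<lambda>t. t ^ e * r (t ^ m) - (\<Sum>i<e + m * K. ?a i * t ^ i))" by simp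
  moreover have "K \<le> m * K" using m by simp
  then have "i < e + m * K" by (simp add: K_def)
  ultimately show ?thesis by (rule co_unique[OF s', where a = ?a])
qed

section \<open>Borel's lemma\<close>

text \<open>Reads smoothness and all Taylor coefficients off a candidate sequence of derivatives. It
  is applied to the powers of the sine and to the Borel sum.\<close>

lemma derivative_sequence:
  fixes F :: "nat \<Rightarrow> real \<Rightarrow> real"
  assumes "\<And>n x. (F n has_real_derivative F (Suc n) x) (at x)"
  shows "smooth_on UNIV (F n)" "taylor_coeff (F 0) n = F n 0"
proof -
  have "Ck_on k UNIV (F n)" for k
  proof (induction k arbitrary: n)
    case 0
    then show ?case using DERIV_isCont[OF assms] by (simp add: continuous_at_imp_continuous_on)
  next
    case (Suc k)
    show ?case
      by (rule Ck_on_real_SucI[OF open_UNIV _ Suc[of "Suc n"]])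
        (use assms in \<open>simp add: has_real_derivative_iff_has_vector_derivative[symmetric]\<close>)
  qed
  then show "smooth_on UNIV (F n)" by (simp add: smooth_on_def)
  have "(deriv ^^ n) (F 0) = F n" for n
  proof (induction n)
    case (Suc n)
    then show ?case using DERIV_imp_deriv[OF assms] by auto
  qed simp
  then show "taylor_coeff (F 0) n = F n 0" by (simp add: taylor_coeff_def)
qed

text \<open>The \<open>n\<close>-th derivative of \<open>sin\<^sup>k\<close> has the form \<open>p (sin x) + cos x * q (sin x)\<close>.\<close>

primrec sin_power_polys :: "nat \<Rightarrow> nat \<Rightarrow> real poly \<times> real poly" where
  "sin_power_polys k 0 = (monom 1 k, 0)"
| "sin_power_polys k (Suc n) =
    ([:1, 0, -1:] * pderiv (snd (sin_power_polys k n)) - [:0, 1:] * snd (sin_power_polys k n),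
     pderiv (fst (sin_power_polys k n)))"

definition sin_power_deriv :: "nat \<Rightarrow> nat \<Rightarrow> real \<Rightarrow> real" where
  "sin_power_deriv k n x =
    poly (fst (sin_power_polys k n)) (sin x) + cos x * poly (snd (sin_power_polys k n)) (sin x)"

lemma sin_power_deriv_0: "sin_power_deriv k 0 = (\<lambda>x. sin x ^ k)"
  by (auto simp: sin_power_deriv_def poly_monom)

lemma sin_power_deriv_Suc: "(sin_power_deriv k n has_real_derivative sin_power_deriv k (Suc n) x) (at x)"
proof -
  have 1: "((\<lambda>x. poly p (sin x)) has_real_derivative poly (pderiv p) (sin x) * cos x) (at x)" for p
    by (rule DERIV_chain2[OF poly_DERIV DERIV_sin])
  have e: "cos x * (cos x * b) + sin x * (sin x * b) = b" for b
    using sin_cos_squared_add[of x] by algebra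
  show ?thesis
    unfolding sin_power_deriv_def[abs_def]
    by (rule derivative_eq_intros 1 refl)+ (simp add: algebra_simps e)
qed

text \<open>Polynomials are bounded on \<open>[-1, 1]\<close>, the range of the sine. Bounds valid
  on the whole line are what lets powers of the sine replace the cut-off monomials of the usual
  proof of Borel's lemma.\<close>

lemma sin_power_deriv_bounded: "\<exists>M. \<forall>x. \<bar>sin_power_deriv k n x\<bar> \<le> M"
proof -
  have b: "\<exists>M. \<forall>x\<in>{-1..1}. \<bar>poly p x\<bar> \<le> M" for p :: "real poly"
  proof -
    have "compact (poly p ` {-1..1})"
      by (intro compact_continuous_image continuous_intros compact_Icc)
    then show ?thesis using compact_imp_bounded bounded_iff by (metis image_eqI real_norm_def)
  qed
  obtain M N where M: "\<And>x. x \<in> {-1..1} \<Longrightarrow> \<bar>poly (fst (sin_power_polys k n)) x\<bar> \<le> M"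
    and N: "\<And>x. x \<in> {-1..1} \<Longrightarrow> \<bar>poly (snd (sin_power_polys k n)) x\<bar> \<le> N"
    using b by metis
  have "\<bar>sin_power_deriv k n x\<bar> \<le> M + 1 * N" for x
    unfolding sin_power_deriv_def
    by (rule order_trans[OF abs_triangle_ineq add_mono])
      (use M[of "sin x"] N[of "sin x"] in \<open>auto simp: abs_mult intro!: mult_le_one mult_mono[of "\<bar>cos x\<bar>" 1, simplified]\<close>)
  then show ?thesis by blast
qed

text \<open>At the origin \<open>sin x ^ k\<close> imitates \<open>x ^ k\<close>; this makes the
  system for the coefficients of the Borel sum triangular with nonzero diagonal.\<close>

lemma sin_power_deriv_at_0:
  "n < k \<Longrightarrow> sin_power_deriv k n 0 = 0" "sin_power_deriv k k 0 \<noteq> 0"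
proof -
  note D = derivative_sequence[where F = "sin_power_deriv k", OF sin_power_deriv_Suc, unfolded sin_power_deriv_0]
  have s: "smooth_germ (\<lambda>x::real. sin x ^ k)" by (intro smooth_germ_intros)
  have s1: "smooth_germ (\<lambda>x::real. sin x)" by (intro smooth_germ_intros)
  have "deriv sin (0::real) = 1" using DERIV_imp_deriv[OF DERIV_sin[of 0]] by simp
  then have l: "ord_ge 2 (\<lambda>x. sin x - x)" "ord_ge 1 sin"
    using taylor_ord_ge[OF s1, of 2] taylor_ord_ge[OF s1, of 1] by (auto simp: numeral_2_eq_2 co_0 co_1)
  have "ord_ge k (\<lambda>x. sin x ^ k)" using ord_ge_power[OF l(2), of k] by simp
  then show "n < k \<Longrightarrow> sin_power_deriv k n 0 = 0"
    using ord_ge_iff_co[OF s] D(2)[of n] by (simp add: co_def)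
  have lower: "ord_ge (Suc j) (\<lambda>x. sin x ^ j - x ^ j)" for j
  proof (induction j)
    case 0
    then show ?case by (simp add: ord_ge_zero)
  next
    case (Suc j)
    have "ord_ge (Suc (Suc j)) (\<lambda>x. sin x * (sin x ^ j - x ^ j) + (sin x - x) * x ^ j)"
      using ord_ge_add[OF ord_ge_mult[OF l(2) Suc, simplified] ord_ge_mult[OF l(1) ord_ge_monom[of j j], simplified]] .
    then show ?case by (simp add: algebra_simps)
  qed
  show "sin_power_deriv k k 0 \<noteq> 0"
    using co_lead_iff[OF s, of k 1] lower[of k] D(2)[of k] by (auto simp: co_def)
qed

text \<open>Forward substitution in the triangular system which says that the sum of
  \<open>c j * sin (B j * x) ^ j / B j ^ j\<close> has \<open>k\<close>-th derivative
  \<open>a k\<close> at 0. The scale \<open>B j\<close> is \<open>b j (c j)\<close>: it may depend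
  on its own coefficient, because only scales with \<open>j < k\<close> enter the equation for
  \<open>c k\<close>.\<close>

fun borel_coeff :: "(nat \<Rightarrow> real) \<Rightarrow> (nat \<Rightarrow> real \<Rightarrow> real) \<Rightarrow> nat \<Rightarrow> real" where
  "borel_coeff a b k =
    (a k - (\<Sum>j<k. borel_coeff a b j * b j (borel_coeff a b j) ^ k / b j (borel_coeff a b j) ^ j * sin_power_deriv j k 0))
      / sin_power_deriv k k 0"

declare borel_coeff.simps [simp del]

text \<open>The function is the sum of \<open>c k * sin (B k * x) ^ k / B k ^ k\<close>. A large
  \<open>B k\<close> makes the derivatives of order below \<open>k\<close> small, so each
  differentiated series converges uniformly, and at 0 only the terms up to \<open>k = n\<close>
  contribute to the \<open>n\<close>-th derivative.\<close>

theorem borel_lemma: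
  obtains f :: "real \<Rightarrow> real" where "smooth_germ f" "\<And>n. taylor_coeff f n = a n"
proof -
  obtain M where M: "\<And>k n x. \<bar>sin_power_deriv k n x\<bar> \<le> M k n"
    using sin_power_deriv_bounded by metis
  have M0: "M k n \<ge> 0" for k n using M[of k n 0] by linarith
  \<comment> \<open>For \<open>n < k\<close> the \<open>n\<close>-th derivative of term
    \<open>k\<close> carries the factor \<open>B k ^ n / B k ^ k\<close>, at most
    \<open>1 / B k\<close>; this choice then bounds it by \<open>(1/2) ^ k\<close>. The summand 1
    keeps \<open>B k\<close> at least 1.\<close>
  define b where "b k c = 1 + 2 ^ k * \<bar>c\<bar> * (\<Sum>n<k. M k n)" for k :: nat and c :: real
  have b1: "b k c \<ge> 1" for k c unfolding b_def using M0 by (simp add: sum_nonneg)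
  define c where "c = borel_coeff a b"
  define B where "B k = b k (c k)" for k
  have B1: "B k \<ge> 1" for k by (simp add: B_def b1)
  define T where "T n k x = c k * B k ^ n / B k ^ k * sin_power_deriv k n (B k * x)" for n k x
  have T_deriv: "(T n k has_real_derivative T (Suc n) k x) (at x)" for n k x
  proof -
    have "((\<lambda>x. sin_power_deriv k n (B k * x)) has_real_derivative sin_power_deriv k (Suc n) (B k * x) * B k) (at x)"
      by (rule DERIV_chain2[OF sin_power_deriv_Suc]) (rule derivative_eq_intros refl | simp)+
    from DERIV_cmult[OF this, of "c k * B k ^ n / B k ^ k"] show ?thesis
      unfolding T_def[abs_def] by (simp add: mult_ac)
  qed
  have T_bound: "\<bar>T n k x\<bar> \<le> (1/2) ^ k" if "n < k" for n k x
  proof -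
    have "B k ^ n * B k \<le> B k ^ k"
      using power_increasing[of "Suc n" k "B k"] that B1[of k] by (simp add: mult.commute)
    then have "B k ^ n / B k ^ k \<le> 1 / B k" using B1[of k] by (simp add: field_simps)
    moreover have "\<bar>sin_power_deriv k n (B k * x)\<bar> \<le> (\<Sum>n<k. M k n)"
      using M[of k n "B k * x"] member_le_sum[of n "{..<k}" "M k"] M0 that by fastforce
    ultimately have "B k ^ n / B k ^ k * \<bar>sin_power_deriv k n (B k * x)\<bar> \<le> 1 / B k * (\<Sum>n<k. M k n)"
      using B1[of k] by (intro mult_mono) auto
    then have "\<bar>c k\<bar> * (B k ^ n / B k ^ k * \<bar>sin_power_deriv k n (B k * x)\<bar>) \<le> \<bar>c k\<bar> * (1 / B k * (\<Sum>n<k. M k n))"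
      by (rule mult_left_mono) simp
    also have "\<dots> \<le> (1/2) ^ k"
      unfolding B_def b_def using M0 by (auto simp: field_simps sum_nonneg add_nonneg_pos add_pos_nonneg)
    finally show ?thesis using B1[of k] by (simp add: T_def abs_mult mult_ac)
  qed
  \<comment> \<open>The bound may fail for the finitely many \<open>k\<close> up to
    \<open>n\<close>, hence the eventual versions of the convergence tests.\<close>
  have ev: "\<forall>\<^sub>F k in sequentially. \<forall>x\<in>UNIV. norm (T n k x) \<le> (1/2) ^ k" for n
    using eventually_gt_at_top[of n] by eventually_elim (use T_bound in auto)
  have sm: "summable (\<lambda>k. (1/2::real) ^ k)" by (rule summable_geometric) simp
  have T_summable: "summable (\<lambda>k. T n k x)" for n x
    by (rule summable_comparison_test_ev[OF _ sm]) (use ev[of n] in \<open>auto elim: eventually_mono\<close>)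
  define F where "F n x = (\<Sum>k. T n k x)" for n x
  have F_deriv: "(F n has_real_derivative F (Suc n) x) (at x)" for n x
    unfolding F_def[abs_def]
    by (rule has_field_derivative_series'(2)[OF convex_UNIV _ Weierstrass_m_test'_ev[OF ev sm] UNIV_I T_summable])
      (use T_deriv in \<open>auto intro: has_field_derivative_at_within\<close>)
  have F0: "F n 0 = a n" for n
  proof -
    have "F n 0 = (\<Sum>k<Suc n. T n k 0)"
      unfolding F_def by (rule suminf_finite) (auto simp: T_def sin_power_deriv_at_0)
    also have "\<dots> = (\<Sum>k<n. c k * B k ^ n / B k ^ k * sin_power_deriv k n 0) + c n * sin_power_deriv n n 0"
      using B1[of n] by (simp add: T_def)
    also have "\<dots> = a n"
      unfolding B_def c_def by (subst (4) borel_coeff.simps) (simp add: sin_power_deriv_at_0)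
    finally show ?thesis .
  qed
  show ?thesis
  proof (rule that)
    show "smooth_germ (F 0)"
      using smooth_germI[OF open_UNIV UNIV_I derivative_sequence(1)[where F = F, OF F_deriv]] .
    show "taylor_coeff (F 0) n = a n" for n
      using derivative_sequence(2)[where F = F, OF F_deriv] F0 by simp
  qed
qed

section \<open>Splitting a germ by residues of exponents\<close>

definition flat :: "(real \<Rightarrow> real) \<Rightarrow> bool" where
  "flat f \<longleftrightarrow> smooth_germ f \<and> (\<forall>N. ord_ge N f)"

lemma flat_iff_co: "flat f \<longleftrightarrow> smooth_germ f \<and> (\<forall>i. co f i = 0)"
  unfolding flat_def using ord_ge_iff_co by blast

text \<open>\<open>root m\<close> is an odd function for every \<open>m\<close>, so this quotient
  form holds for both signs of \<open>x\<close> and both parities of \<open>m\<close>. The sign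
  \<open>s\<close> in the proof translates it into the separate formulas of
  \<open>DERIV_real_root_generic\<close>.\<close>

lemma real_root_derivative:
  assumes "m \<ge> 1" "x \<noteq> 0"
  shows "(root m has_real_derivative root m x / (real m * x)) (at x)"
proof (rule DERIV_real_root_generic)
  let ?r = "root m x"
  have r0: "?r \<noteq> 0" using assms by simp
  have p: "?r ^ (m - Suc 0) * ?r = ?r ^ m" using power_minus_mult[of m ?r] assms(1) by simp
  have sg: "sgn ?r * \<bar>?r\<bar> ^ m = x" using sgn_power_root[of m x] assms(1) by simp
  have *: "?r / (real m * x) = s * inverse (real m * ?r ^ (m - Suc 0))" if "?r ^ m = s * x" "s * s = 1" for s
  proof -
    have "?r / (real m * x) = s * s * ?r / (real m * x)" using that by simp
    also have "\<dots> = s * ?r / (real m * (s * x))"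
    proof -
      have "s \<noteq> 0" using that(2) by auto
      then show ?thesis using that(2) by simp
    qed
    also have "\<dots> = s * ?r / (real m * (?r ^ (m - Suc 0) * ?r))" using that p by simp
    also have "\<dots> = s * inverse (real m * ?r ^ (m - Suc 0))" using r0 by (simp add: field_simps)
    finally show ?thesis .
  qed
  show "?r / (real m * x) = inverse (real m * ?r ^ (m - Suc 0))" if "even m" "0 < x"
    using *[of 1] that assms by simp
  show "?r / (real m * x) = - inverse (real m * ?r ^ (m - Suc 0))" if "even m" "x < 0"
  proof -
    have "?r < 0" using that assms by simp
    then have "- (\<bar>?r\<bar> ^ m) = x" using sg by simp
    then have "?r ^ m = - 1 * x" using that by (simp add: power_even_abs)
    then show ?thesis using *[of "-1"] by simp
  qed
  show "?r / (real m * x) = inverse (real m * ?r ^ (m - Suc 0))" if "odd m"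
    using *[of 1] odd_real_root_pow[OF that] by simp
qed (use assms in auto)

lemma abs_root_power: "m \<ge> 1 \<Longrightarrow> \<bar>root m x\<bar> ^ m = \<bar>x\<bar>"
  using real_root_pow_pos2[of m "\<bar>x\<bar>"] real_root_abs[of m x] by simp

text \<open>A root is not smooth at 0, but a flat \<open>f\<close> beats every negative power of
  \<open>x\<close>. The derivative of \<open>f (root m x) / x ^ d\<close> has the same shape with
  another flat numerator and \<open>d + 1\<close>, so the induction on the differentiability order
  runs over all flat \<open>f\<close> and all \<open>d\<close> together.\<close>

lemma flat_comp_root:
  assumes "flat f" "m \<ge> 1"
  shows "flat (\<lambda>x. f (root m x) / x ^ d)"
proof -
  obtain U where U: "open U" "0 \<in> U" "smooth_on U f" using assms(1) flat_def smooth_germ_def by metis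
  define V where "V = root m -` U"
  have oV: "open V" unfolding V_def
    by (rule open_vimage[OF U(1)]) (intro continuous_intros)
  have V0: "0 \<in> V" using U by (simp add: V_def)
  let ?F = "\<lambda>f d x. f (root m x) / x ^ d"
  have c0: "isCont (root m) 0" by (rule isCont_real_root)
  have small: "ord_ge N (?F f d)" if fl: "\<forall>N. ord_ge N f" for f d N
  proof -
    obtain C where C: "C > 0" "\<forall>\<^sub>F t in nhds 0. \<bar>f t\<bar> \<le> C * \<bar>t\<bar> ^ (m * (N + d))"
      by (rule ord_geE[OF fl[rule_format]])
    have "\<forall>\<^sub>F x in nhds 0. \<bar>f (root m x)\<bar> \<le> C * \<bar>root m x\<bar> ^ (m * (N + d))"
      by (rule eventually_nhds_compose[OF c0]) (use C(2) in \<open>simp only: real_root_zero\<close>)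
    then have "\<forall>\<^sub>F x in nhds 0. \<bar>?F f d x\<bar> \<le> C * \<bar>x\<bar> ^ N"
    proof eventually_elim
      case (elim x)
      have "\<bar>root m x\<bar> ^ (m * (N + d)) = \<bar>x\<bar> ^ (N + d)"
        by (simp only: power_mult abs_root_power[OF assms(2)])
      then have *: "\<bar>f (root m x)\<bar> \<le> (C * \<bar>x\<bar> ^ N) * \<bar>x\<bar> ^ d"
        using elim by (simp only: power_add mult.assoc)
      show ?case
      proof (cases "\<bar>x\<bar> ^ d = 0")
        case True
        then have "x ^ d = 0" by simp
        then show ?thesis using C(1) by (simp only: division_ring_divide_zero abs_zero) simp
      next
        case False
        then show ?thesis using * by (simp add: abs_divide power_abs pos_divide_le_eq)
      qed
    qed
    then show ?thesis by (rule ord_geI)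
  qed
  have "smooth_on U f \<Longrightarrow> \<forall>N. ord_ge N f \<Longrightarrow> Ck_on n V (?F f d)" for n
  proof (induction n arbitrary: f d)
    case (Suc n)
    have sg: "smooth_germ f" using smooth_germI U Suc.prems by blast
    \<comment> \<open>The numerator obtained by the quotient rule from
      \<open>real_root_derivative\<close>, after one factor \<open>x\<close> is moved to the
      denominator. It is flat because \<open>t * deriv f t\<close> and \<open>f\<close> are.\<close>
    define g where "g t = t * deriv f t / real m - real d * f t" for t
    have sU: "smooth_on U g"
    proof -
      have "smooth_on U (\<lambda>t. (1 / real m) * (t * deriv f t) + - (real d * f t))"
        by (rule smooth_on_add[OF U(1)] smooth_on_mult[OF U(1)] smooth_on_const smooth_on_id[OF U(1)]
            smooth_on_deriv(1)[OF Suc.prems(1) U(1)] smooth_on_linear[OF U(1) bounded_linear_minus[OF bounded_linear_ident]] Suc.prems(1))+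
      then show ?thesis by (simp add: g_def[abs_def])
    qed
    have "ord_ge N (deriv f)" for N
      using Suc.prems(2) ord_ge_iff_co[OF sg] ord_ge_iff_co[OF smooth_germ_deriv(1)[OF sg]]
      by (metis co_deriv lessI mult_zero_right Suc_less_eq)
    then have "ord_ge N (\<lambda>t. (1 / real m) * (t * deriv f t) - real d * f t)" for N
      using Suc.prems(2)
      by (intro ord_ge_diff ord_ge_cmult ord_ge_mult[of 0 _ N, simplified] ord_ge_mono[OF ord_ge_id]) auto
    then have og: "\<forall>N. ord_ge N g" by (simp add: g_def[abs_def])
    have f0: "f 0 = 0" using Suc.prems(2) ord_ge_iff_co[OF sg, of 1] by (auto simp: co_0)
    have "(?F f d has_real_derivative ?F g (Suc d) x) (at x)" if "x \<in> V" for x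
    proof (cases "x = 0")
      case True
      \<comment> \<open>Division by zero makes \<open>?F g (Suc d) 0\<close> equal to 0. The
        estimate of order 2 shows that the difference quotient at the origin does tend to 0.\<close>
      obtain C where "C > 0" "\<forall>\<^sub>F t in nhds 0. \<bar>?F f d t\<bar> \<le> C * \<bar>t\<bar> ^ 2" using small[OF Suc.prems(2)] by (rule ord_geE)
      then have "\<forall>\<^sub>F t in nhds 0. t \<noteq> 0 \<longrightarrow> norm (?F f d t / t) \<le> C * \<bar>t\<bar>"
      proof eventually_elim
        case (elim t)
        have "norm (?F f d t / t) \<le> C * \<bar>t\<bar>" if "t \<noteq> 0"
        proof -
          have "\<bar>?F f d t\<bar> / \<bar>t\<bar> \<le> C * \<bar>t\<bar> ^ 2 / \<bar>t\<bar>" using elim by (intro divide_right_mono) auto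
          moreover have "C * \<bar>t\<bar> ^ 2 / \<bar>t\<bar> = C * \<bar>t\<bar>" using that by (simp add: power2_eq_square abs_if)
          ultimately show ?thesis by (simp only: real_norm_def abs_divide)
        qed
        then show ?case using elim by blast
      qed
      then have ev: "\<forall>\<^sub>F t in at 0. norm (?F f d t / t) \<le> C * \<bar>t\<bar>"
        unfolding eventually_at_filter by (rule eventually_mono) blast
      have "((\<lambda>t. C * \<bar>t\<bar>) \<longlongrightarrow> 0) (at (0::real))"
        by (rule tendsto_eq_intros refl | simp)+
      from Lim_null_comparison[OF ev this] have "((\<lambda>t. ?F f d t / t) \<longlongrightarrow> 0) (at 0)" .
      then show ?thesis unfolding True DERIV_def using f0 by simp
    next
      case False
      have "(f has_real_derivative deriv f (root m x)) (at (root m x))"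
        using smooth_on_deriv(2)[OF Suc.prems(1) U(1)] that by (simp add: V_def)
      from DERIV_chain2[OF this real_root_derivative[OF assms(2) False]]
      have "((\<lambda>x. f (root m x)) has_real_derivative deriv f (root m x) * (root m x / (real m * x))) (at x)" .
      from DERIV_divide[OF this DERIV_pow[of d x]] False
      have "(?F f d has_real_derivative
          (deriv f (root m x) * (root m x / (real m * x)) * x ^ d - f (root m x) * (real d * x ^ (d - Suc 0))) / (x ^ d * x ^ d)) (at x)"
        by simp
      moreover have "(deriv f (root m x) * (root m x / (real m * x)) * x ^ d - f (root m x) * (real d * x ^ (d - Suc 0))) / (x ^ d * x ^ d)
         = ?F g (Suc d) x"
      proof (cases d)
        case 0
        then show ?thesis using False assms(2) by (simp add: g_def field_simps)
      next
        case (Suc e)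
        then show ?thesis using False assms(2) by (simp add: g_def field_simps)
      qed
      ultimately show ?thesis by metis
    qed
    then show ?case
      by (intro Ck_on_real_SucI[OF oV _ Suc.IH[OF sU og, of "Suc d"]])
        (auto simp: has_real_derivative_iff_has_vector_derivative[symmetric])
  next
    case 0
    have "isCont (?F f d) x" if "x \<in> V" for x
    proof (cases "x = 0")
      case True
      have sg: "smooth_germ f" using smooth_germI U 0 by blast
      have f0: "f 0 = 0" using 0(2) ord_ge_iff_co[OF sg, of 1] by (auto simp: co_0)
      obtain C where "C > 0" "\<forall>\<^sub>F t in nhds 0. \<bar>?F f d t\<bar> \<le> C * \<bar>t\<bar> ^ 1" using small[OF 0(2)] by (rule ord_geE)
      then have ev: "\<forall>\<^sub>F t in at 0. norm (?F f d t) \<le> C * \<bar>t\<bar>"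
        unfolding eventually_at_filter by (auto elim: eventually_mono)
      have "((\<lambda>t. C * \<bar>t\<bar>) \<longlongrightarrow> 0) (at (0::real))"
        by (rule tendsto_eq_intros refl | simp)+
      from Lim_null_comparison[OF ev this] show ?thesis using True f0 by (simp add: isCont_def)
    next
      case False
      have "isCont f (root m x)"
        using smooth_on_continuous[OF 0(1)] U(1) that continuous_on_eq_continuous_at by (auto simp: V_def)
      then show ?thesis using False isCont_o2[OF isCont_real_root] by (intro continuous_intros) auto
    qed
    then show ?case by (simp add: continuous_at_imp_continuous_on)
  qed
  then have "smooth_on V (?F f d)" using U(3) assms(1) by (simp add: smooth_on_def[of V] flat_def)
  then show ?thesis unfolding flat_def using smooth_germI[OF oV V0] small assms(1) flat_def by blast
qed

lemma isCont_comp_0: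
  fixes g :: "real \<Rightarrow> real"
  assumes "isCont g 0" "g 0 = 0" "\<forall>\<^sub>F t in nhds 0. P t"
  shows "\<forall>\<^sub>F t in nhds 0. P (g t)"
  by (rule eventually_nhds_compose[OF assms(1)]) (use assms in simp)

lemma flat_reflect:
  assumes "flat f" shows "flat (\<lambda>t. f (- t))"
proof -
  have s: "smooth_germ (\<lambda>t::real. - t)" by (intro smooth_germ_intros)
  have "smooth_germ (\<lambda>t. f (- t))"
    by (rule smooth_germ_compose[OF s]) (use assms flat_def in auto)
  moreover have "ord_ge (1 * N) (\<lambda>t. f (- t))" for N
    by (rule ord_ge_compose[OF _ ord_ge_minus[OF ord_ge_id] smooth_germ_isCont[OF s]]) (use assms flat_def in auto)
  ultimately show ?thesis by (simp add: flat_def)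
qed

text \<open>For odd \<open>m\<close> the power \<open>t ^ m\<close> determines \<open>t\<close> and
  everything goes into index 0. For even \<open>m\<close> it determines only the absolute value of
  \<open>t\<close>: the even part goes into index 0 and the odd part, divided by \<open>t\<close>,
  into index 1, which exists because then \<open>m\<close> is at least 2.\<close>

lemma flat_decomposition:
  assumes f: "flat f" and m: "m \<ge> 1"
  obtains r where "\<And>j. flat (r j)" "\<And>t. f t = (\<Sum>j<m. t ^ j * r j (t ^ m))"
proof (cases "odd m")
  case True
  define r where "r j x = (if j = 0 then f (root m x) else 0)" for j :: nat and x
  have "flat (r j)" for j
    using flat_comp_root[OF f m, of 0] flat_def ord_ge_zero smooth_germ_const[of 0]
    by (cases "j = 0") (auto simp: r_def[abs_def])
  moreover have "f t = (\<Sum>j<m. t ^ j * r j (t ^ m))" for t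
  proof -
    have "(\<Sum>j<m. t ^ j * r j (t ^ m)) = (\<Sum>j<m. if j = 0 then f t else 0)"
      by (rule sum.cong) (auto simp: r_def odd_real_root_power_cancel[OF True])
    then show ?thesis using m by simp
  qed
  ultimately show ?thesis using that by blast
next
  case False
  then have m2: "m \<ge> 2" using m by presburger
  define a where "a t = (1/2) * (f t + f (- t))" for t
  define b where "b t = (1/2) * (f t - f (- t))" for t
  have f': "smooth_germ f" "smooth_germ (\<lambda>t. f (- t))" "ord_ge N f" "ord_ge N (\<lambda>t. f (- t))" for N
    using f flat_reflect[OF f] unfolding flat_def by auto
  have ab: "flat a" "flat b" unfolding a_def[abs_def] b_def[abs_def] flat_def
    by (intro conjI allI smooth_germ_intros ord_ge_cmult ord_ge_add ord_ge_diff f')+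
  define G where "G t = b t / t" for t
  have G: "flat G" using flat_comp_root[OF ab(2), of 1 1] by (simp add: G_def[abs_def])
  define r where "r j x = (if j = 0 then a (root m x) else if j = 1 then G (root m x) else 0)" for j :: nat and x
  have "flat (r j)" for j
    using flat_comp_root[OF ab(1) m, of 0] flat_comp_root[OF G m, of 0] flat_def ord_ge_zero smooth_germ_const[of 0]
    by (cases "j = 0"; cases "j = 1") (auto simp: r_def[abs_def])
  moreover have "f t = (\<Sum>j<m. t ^ j * r j (t ^ m))" for t
  proof -
    have ro: "root m (t ^ m) = \<bar>t\<bar>"
      using real_root_power_cancel[of m "\<bar>t\<bar>"] m False by (simp add: power_even_abs)
    have e: "a \<bar>t\<bar> = a t" "G \<bar>t\<bar> = G t" by (auto simp: abs_if a_def G_def b_def field_simps)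
    have b0: "b 0 = 0" by (simp add: b_def)
    have "(\<Sum>j<m. t ^ j * r j (t ^ m)) = (\<Sum>j\<in>{0,1}. t ^ j * r j (t ^ m))"
      by (rule sum.mono_neutral_right) (use m2 in \<open>auto simp: r_def\<close>)
    also have "\<dots> = a t + t * G t" by (simp add: r_def ro e)
    also have "t * G t = b t" using b0 by (simp add: G_def)
    finally show ?thesis by (simp add: a_def b_def field_simps)
  qed
  ultimately show ?thesis using that by blast
qed

lemma residue_decomposition_aux:
  assumes f: "smooth_germ f" and m: "m \<ge> 1"
  obtains r where "\<And>j. smooth_germ (r j)" "\<And>i j. co (r j) i = co f (m * i + j)"
    "\<forall>\<^sub>F t in nhds 0. f t = (\<Sum>j<m. t ^ j * r j (t ^ m))"
proof -
  have "\<exists>B. smooth_germ B \<and> (\<forall>i. co B i = co f (m * i + j))" for j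
  proof -
    obtain B where B: "smooth_germ B" "\<And>n. taylor_coeff B n = fact n * co f (m * n + j)"
      using borel_lemma[of "\<lambda>n. fact n * co f (m * n + j)"] by blast
    then show ?thesis by (intro exI[of _ B]) (simp add: co_def[of B])
  qed
  then obtain B where B: "\<And>j. smooth_germ (B j)" "\<And>i j. co (B j) i = co f (m * i + j)" by metis
  have sB: "smooth_germ (\<lambda>t. t ^ j * B j (t ^ m))" for j
    by (intro smooth_germ_intros smooth_germ_compose[OF _ _ B(1)]) (use m in auto)
  have sS: "smooth_germ (\<lambda>t. \<Sum>j<m. t ^ j * B j (t ^ m))" by (rule smooth_germ_sum) (use sB in auto)
  define F where "F t = f t - (\<Sum>j<m. t ^ j * B j (t ^ m))" for t
  have "co F i = 0" for i
  proof -
    have "co F i = co f i - (\<Sum>j<m. co (\<lambda>t. t ^ j * B j (t ^ m)) i)"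
      unfolding F_def[abs_def] co_diff[OF f sS] by (subst co_sum) (use sB in auto)
    also have "(\<Sum>j<m. co (\<lambda>t. t ^ j * B j (t ^ m)) i) = (\<Sum>j<m. if j = i mod m then co f i else 0)"
    proof (rule sum.cong[OF refl])
      fix j assume j: "j \<in> {..<m}"
      show "co (\<lambda>t. t ^ j * B j (t ^ m)) i = (if j = i mod m then co f i else 0)"
      proof (cases "j = i mod m")
        case True
        then have "i - j = m * (i div m)" "j \<le> i" using minus_mod_eq_mult_div[of i m] by auto
        then show ?thesis using True m unfolding co_monom_comp[OF B(1) m] by (simp add: B(2))
      next
        case False
        have "\<not> (j \<le> i \<and> m dvd (i - j))"
        proof
          assume a: "j \<le> i \<and> m dvd (i - j)"
          then have "i mod m = j mod m" by (metis mod_eq_dvd_iff_nat)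
          then show False using j False by simp
        qed
        then show ?thesis using False unfolding co_monom_comp[OF B(1) m] by auto
      qed
    qed
    also have "\<dots> = co f i" using m by simp
    finally show ?thesis by simp
  qed
  then have "flat F" unfolding flat_iff_co using smooth_germ_diff[OF f sS] by (simp add: F_def[abs_def])
  then obtain E where E: "\<And>j. flat (E j)" "\<And>t. F t = (\<Sum>j<m. t ^ j * E j (t ^ m))"
    using flat_decomposition m by blast
  show ?thesis
  proof (rule that)
    show "smooth_germ (\<lambda>x. B j x + E j x)" for j
      using E(1)[of j] by (intro smooth_germ_add B(1)) (simp add: flat_def)
    show "co (\<lambda>x. B j x + E j x) i = co f (m * i + j)" for i j
      using B E[of j] by (subst co_add) (auto simp: flat_iff_co)
    have "f t = F t + (\<Sum>j<m. t ^ j * B j (t ^ m))" for t by (simp add: F_def)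
    then show "\<forall>\<^sub>F t in nhds 0. f t = (\<Sum>j<m. t ^ j * (B j (t ^ m) + E j (t ^ m)))"
      unfolding E(2) by (simp add: distrib_left sum.distrib)
  qed
qed

text \<open>Borel's lemma provides the quotient up to a flat error, and
  \<open>flat_comp_root\<close> with \<open>m = 1\<close> divides that error by
  \<open>t ^ n\<close>. Besides the factorisation this yields the Taylor coefficients of the
  quotient.\<close>

lemma hadamard:
  assumes f: "smooth_germ f" and z: "\<And>i. i < n \<Longrightarrow> co f i = 0"
  obtains r where "smooth_germ r" "\<And>i. co r i = co f (n + i)" "\<forall>\<^sub>F t in nhds 0. f t = t ^ n * r t"
proof -
  obtain B where B: "smooth_germ B" "\<And>i. taylor_coeff B i = fact i * co f (n + i)"
    using borel_lemma[of "\<lambda>i. fact i * co f (n + i)"] by blast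
  then have coB: "co B i = co f (n + i)" for i by (simp add: co_def[of B])
  have s: "smooth_germ (\<lambda>t. t ^ n * B t)" by (intro smooth_germ_intros B)
  define F where "F t = f t - t ^ n * B t" for t
  have "co F i = 0" for i
    unfolding F_def[abs_def] co_diff[OF f s] using co_monom_comp[OF B(1), of 1 n i] z[of i] by (auto simp: coB)
  then have "flat F" unfolding flat_iff_co using smooth_germ_diff[OF f s] by (simp add: F_def[abs_def])
  then have G: "flat (\<lambda>t. F t / t ^ n)" using flat_comp_root[of F 1 n] by simp
  have F0: "F 0 = 0" using \<open>flat F\<close> by (metis co_0 flat_iff_co)
  show ?thesis
  proof (rule that)
    show "smooth_germ (\<lambda>t. B t + F t / t ^ n)" using B(1) G flat_def by (intro smooth_germ_add) auto
    show "co (\<lambda>t. B t + F t / t ^ n) i = co f (n + i)" for i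
      using B G by (subst co_add) (auto simp: flat_iff_co coB)
    have "f t = t ^ n * (B t + F t / t ^ n)" for t
      using F0 by (cases "t = 0") (auto simp: distrib_left F_def)
    then show "\<forall>\<^sub>F t in nhds 0. f t = t ^ n * (B t + F t / t ^ n)" by simp
  qed
qed

text \<open>\<open>residue_decomposition_aux\<close> writes the class of \<open>e\<close> as
  \<open>t ^ (e mod m)\<close> times a function of \<open>t ^ m\<close>. Since the coefficients
  below \<open>e\<close> in that class vanish, \<open>hadamard\<close> extracts
  \<open>e div m\<close> further powers of \<open>t ^ m\<close>. The free choice of the
  representatives \<open>E\<close> adapts the splitting to each type.\<close>

theorem residue_decomposition:
  assumes f: "smooth_germ f" and m: "m \<ge> 1"
    and E: "bij_betw (\<lambda>e. e mod m) E {..<m}"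
    and z: "\<forall>e\<in>E. \<forall>i<e. i mod m = e mod m \<longrightarrow> co f i = 0"
  obtains r where "\<forall>e\<in>E. smooth_germ (r e) \<and> r e 0 = co f e"
    "\<forall>\<^sub>F t in nhds 0. f t = (\<Sum>e\<in>E. t ^ e * r e (t ^ m))"
proof -
  obtain s where s: "\<And>j. smooth_germ (s j)" "\<And>i j. co (s j) i = co f (m * i + j)"
    "\<forall>\<^sub>F t in nhds 0. f t = (\<Sum>j<m. t ^ j * s j (t ^ m))"
    using residue_decomposition_aux[OF f m] by blast
  have "\<exists>r. smooth_germ r \<and> r 0 = co f e \<and> (\<forall>\<^sub>F t in nhds 0. s (e mod m) t = t ^ (e div m) * r t)" if "e \<in> E" for e
  proof -
    have "co (s (e mod m)) i = 0" if i: "i < e div m" for i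
    proof -
      have "m * i < m * (e div m)" using m i by simp
      then have "m * i + e mod m < e" using mult_div_mod_eq[of m e] by linarith
      then show ?thesis using z[rule_format, OF \<open>e \<in> E\<close>, of "m * i + e mod m"] m by (simp add: s(2))
    qed
    then obtain r where r: "smooth_germ r" "\<And>i. co r i = co (s (e mod m)) (e div m + i)" "\<forall>\<^sub>F t in nhds 0. s (e mod m) t = t ^ (e div m) * r t"
      using hadamard[OF s(1)] by blast
    then show ?thesis using co_0[of r] by (intro exI[of _ r]) (simp add: s(2))
  qed
  then obtain r where r: "\<And>e. e \<in> E \<Longrightarrow> smooth_germ (r e)" "\<And>e. e \<in> E \<Longrightarrow> r e 0 = co f e"
    "\<And>e. e \<in> E \<Longrightarrow> \<forall>\<^sub>F t in nhds 0. s (e mod m) t = t ^ (e div m) * r e t" by metis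
  have fin: "finite E" using E bij_betw_finite by blast
  have c: "isCont (\<lambda>t::real. t ^ m) 0" by simp
  have "\<forall>\<^sub>F t in nhds 0. s (e mod m) (t ^ m) = (t ^ m) ^ (e div m) * r e (t ^ m)" if "e \<in> E" for e
    by (rule isCont_comp_0[OF c _ r(3)[OF that]]) (use m in simp)
  then have "\<forall>\<^sub>F t in nhds 0. \<forall>e\<in>E. s (e mod m) (t ^ m) = (t ^ m) ^ (e div m) * r e (t ^ m)"
    using fin by (simp add: eventually_ball_finite)
  with s(3) have "\<forall>\<^sub>F t in nhds 0. f t = (\<Sum>e\<in>E. t ^ e * r e (t ^ m))"
  proof eventually_elim
    case (elim t)
    have "f t = (\<Sum>e\<in>E. t ^ (e mod m) * s (e mod m) (t ^ m))"
      using elim(1) sum.reindex_bij_betw[OF E, of "\<lambda>j. t ^ j * s j (t ^ m)"] by simp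
    also have "\<dots> = (\<Sum>e\<in>E. t ^ e * r e (t ^ m))"
    proof (rule sum.cong[OF refl])
      fix e assume "e \<in> E"
      then have "t ^ (e mod m) * s (e mod m) (t ^ m) = t ^ (e mod m) * (t ^ m) ^ (e div m) * r e (t ^ m)"
        using elim(2) by simp
      also have "t ^ (e mod m) * (t ^ m) ^ (e div m) = t ^ e"
        by (metis mod_mult_div_eq power_add power_mult)
      finally show "t ^ (e mod m) * s (e mod m) (t ^ m) = t ^ e * r e (t ^ m)" .
    qed
    finally show ?case .
  qed
  then show ?thesis by (rule that[rotated]) (use r(1,2) in simp)
qed

section \<open>Changes of coordinates\<close>

text \<open>A smooth germ is Lipschitz near 0, by the mean value inequality and a local bound on
  \<open>deriv f\<close>.\<close>

lemma smooth_diff_ord_ge: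
  assumes f: "smooth_germ f" and a: "isCont a 0" "a 0 = 0" and b: "isCont b 0" "b 0 = 0"
    and d: "ord_ge k (\<lambda>t. a t - b t)"
  shows "ord_ge k (\<lambda>t. f (a t) - f (b t))"
proof -
  obtain K where K: "K > 0" "\<forall>\<^sub>F t in nhds 0. \<bar>deriv f t\<bar> \<le> K * \<bar>t\<bar> ^ 0"
    using smooth_ord_ge_0[OF smooth_germ_deriv(1)[OF f]] by (rule ord_geE)
  from eventually_conj[OF smooth_germ_deriv(2)[OF f] K(2)] obtain e where e: "e > 0"
    "\<And>t. \<bar>t\<bar> < e \<Longrightarrow> (f has_real_derivative deriv f t) (at t) \<and> \<bar>deriv f t\<bar> \<le> K"
    by (auto simp: eventually_nhds_metric dist_real_def)
  have L: "\<bar>f x - f y\<bar> \<le> K * \<bar>x - y\<bar>" if "\<bar>x\<bar> < e" "\<bar>y\<bar> < e" for x y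
  proof -
    have "norm (f x - f y) \<le> K * norm (x - y)"
      by (rule field_differentiable_bound[of "ball 0 e" f "deriv f"])
        (use e(2) that in \<open>auto simp: dist_real_def intro: has_field_derivative_at_within\<close>)
    then show ?thesis by simp
  qed
  have ev: "\<forall>\<^sub>F t in nhds (0::real). \<bar>t\<bar> < e" using e(1) by (auto simp: eventually_nhds_metric dist_real_def)
  have "\<forall>\<^sub>F t in nhds 0. \<bar>a t\<bar> < e" "\<forall>\<^sub>F t in nhds 0. \<bar>b t\<bar> < e"
    using eventually_nhds_compose[OF a(1), of "\<lambda>t. \<bar>t\<bar> < e"] eventually_nhds_compose[OF b(1), of "\<lambda>t. \<bar>t\<bar> < e"] ev a b by auto
  note ab = this
  obtain C where C: "C > 0" "\<forall>\<^sub>F t in nhds 0. \<bar>a t - b t\<bar> \<le> C * \<bar>t\<bar> ^ k" using d by (rule ord_geE)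
  from ab C(2) have "\<forall>\<^sub>F t in nhds 0. \<bar>f (a t) - f (b t)\<bar> \<le> (K * C) * \<bar>t\<bar> ^ k"
  proof eventually_elim
    case (elim t)
    have "\<bar>f (a t) - f (b t)\<bar> \<le> K * \<bar>a t - b t\<bar>" using L elim by simp
    also have "\<dots> \<le> K * (C * \<bar>t\<bar> ^ k)" using elim K(1) by (intro mult_left_mono) auto
    finally show ?case by (simp add: mult_ac)
  qed
  then show ?thesis by (rule ord_geI)
qed

lemma power_diff_ord_ge:
  assumes "ord_ge 1 a" "ord_ge 1 b" "ord_ge k (\<lambda>t. a t - b t)"
  shows "ord_ge (k + n) (\<lambda>t. a t ^ Suc n - b t ^ Suc n)"
proof (induction n)
  case 0
  then show ?case using assms by simp
next
  case (Suc n)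
  have "ord_ge (k + Suc n) (\<lambda>t. a t * (a t ^ Suc n - b t ^ Suc n) + (a t - b t) * b t ^ Suc n)"
  proof (rule ord_ge_add)
    show "ord_ge (k + Suc n) (\<lambda>t. a t * (a t ^ Suc n - b t ^ Suc n))"
      using ord_ge_mult[OF assms(1) Suc] by simp
    show "ord_ge (k + Suc n) (\<lambda>t. (a t - b t) * b t ^ Suc n)"
      using ord_ge_mult[OF assms(3) ord_ge_power[OF assms(2), of "Suc n"]] by simp
  qed
  then show ?case by (simp add: algebra_simps)
qed

text \<open>Improves the Lipschitz estimate by \<open>n\<close>. In
  \<open>y t = t ^ Suc n * U t\<close> the difference of the powers gains \<open>n\<close> orders,
  and the difference of the values of \<open>U\<close> is multiplied by a power of order
  \<open>n + 1\<close>.\<close>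

lemma smooth_order_diff_ord_ge:
  assumes y: "smooth_germ y" "\<And>i. i < Suc n \<Longrightarrow> co y i = 0"
    and a: "isCont a 0" "ord_ge 1 a" "a 0 = 0" and b: "isCont b 0" "ord_ge 1 b" "b 0 = 0"
    and d: "ord_ge k (\<lambda>t. a t - b t)"
  shows "ord_ge (k + n) (\<lambda>t. y (a t) - y (b t))"
proof -
  obtain U where U: "smooth_germ U" "\<forall>\<^sub>F t in nhds 0. y t = t ^ Suc n * U t" using hadamard[OF y] by blast
  have "\<forall>\<^sub>F t in nhds 0. (a t ^ Suc n - b t ^ Suc n) * U (a t) + b t ^ Suc n * (U (a t) - U (b t)) = y (a t) - y (b t)"
    using isCont_comp_0[OF a(1,3) U(2)] isCont_comp_0[OF b(1,3) U(2)] by eventually_elim (simp add: algebra_simps)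
  moreover have "ord_ge (k + n) (\<lambda>t. (a t ^ Suc n - b t ^ Suc n) * U (a t) + b t ^ Suc n * (U (a t) - U (b t)))"
  proof (rule ord_ge_add)
    have "ord_ge 0 (\<lambda>t. U (a t))"
      by (rule isCont_ord_ge_0, rule isCont_o2[OF a(1)]) (use smooth_germ_isCont[OF U(1)] a in simp)
    from ord_ge_mult[OF power_diff_ord_ge[OF a(2) b(2) d, of n] this]
    show "ord_ge (k + n) (\<lambda>t. (a t ^ Suc n - b t ^ Suc n) * U (a t))" by simp
    have "ord_ge (1 * Suc n + k) (\<lambda>t. b t ^ Suc n * (U (a t) - U (b t)))"
      by (rule ord_ge_mult[OF ord_ge_power[OF b(2)] smooth_diff_ord_ge[OF U(1) a(1,3) b(1,3) d]])
    then show "ord_ge (k + n) (\<lambda>t. b t ^ Suc n * (U (a t) - U (b t)))" by (rule ord_ge_mono) simp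
  qed
  ultimately show ?thesis by (rule ord_ge_cong)
qed

lemma power_shift_ord_ge:
  assumes g: "ord_ge 1 g" "ord_ge (d + 2) (\<lambda>t. g t - t - e * t ^ (d + 1))" and "d \<ge> 1"
  shows "ord_ge (n + d + 1) (\<lambda>t. g t ^ n - t ^ n - real n * e * t ^ (n + d))"
proof (induction n)
  case 0
  then show ?case by (simp add: ord_ge_zero)
next
  case (Suc n)
  let ?p = "\<lambda>n t. g t ^ n - t ^ n - real n * e * t ^ (n + d)"
  have "ord_ge (Suc n + d + 1) (\<lambda>t. g t * ?p n t + ((g t - t - e * t ^ (d + 1)) * t ^ n + real n * e * (t ^ (n + d) * (g t - t))))"
  proof (intro ord_ge_add ord_ge_cmult)
    show "ord_ge (Suc n + d + 1) (\<lambda>t. g t * ?p n t)" using ord_ge_mult[OF g(1) Suc] by simp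
    show "ord_ge (Suc n + d + 1) (\<lambda>t. (g t - t - e * t ^ (d + 1)) * t ^ n)"
      using ord_ge_mult[OF g(2) ord_ge_monom[of n n]] by (simp add: add_ac)
    have gt: "ord_ge (d + 1) (\<lambda>t. (g t - t - e * t ^ (d + 1)) + e * t ^ (d + 1))"
      by (intro ord_ge_add ord_ge_cmult ord_ge_monom ord_ge_mono[OF g(2)]) auto
    have "ord_ge (n + d + (d + 1)) (\<lambda>t. t ^ (n + d) * (g t - t))"
      using ord_ge_mult[OF ord_ge_monom[OF order_refl, of "n + d"] gt] by simp
    \<comment> \<open>Here \<open>d\<close> must be at least 1: the product has order
      \<open>n + 2 d + 1\<close>, and \<open>n + d + 2\<close> is wanted.\<close>
    then show "ord_ge (Suc n + d + 1) (\<lambda>t. t ^ (n + d) * (g t - t))"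
      by (rule ord_ge_mono) (use assms(3) in simp)
  qed
  then show ?case by (simp add: algebra_simps power_add)
qed

text \<open>With \<open>y t = t ^ n * U t\<close> the shift comes from the power alone: replacing
  \<open>U (g t)\<close> by \<open>U t\<close>, and \<open>U t\<close> by \<open>c\<close> in the
  shift term, costs only orders above \<open>n + d\<close>.\<close>

lemma smooth_shift_ord_ge:
  assumes y: "smooth_germ y" "ord_ge (Suc n) (\<lambda>t. y t - c * t ^ n)"
    and g: "smooth_germ g" "g 0 = 0" "ord_ge (d + 2) (\<lambda>t. g t - t - e * t ^ (d + 1))" and "d \<ge> 1"
  shows "ord_ge (n + d + 1) (\<lambda>t. y (g t) - y t - real n * c * e * t ^ (n + d))"
proof -
  have co: "co y i = 0" if "i < n" for i using co_lead_iff[OF y(1)] y(2) that by blast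
  have cn: "co y n = c" using co_lead_iff[OF y(1)] y(2) by blast
  obtain U where U: "smooth_germ U" "\<And>i. co U i = co y (n + i)" "\<forall>\<^sub>F t in nhds 0. y t = t ^ n * U t"
    using hadamard[OF y(1) co] by blast
  have U0: "U 0 = c" using U(2)[of 0] cn by (simp add: co_0)
  have gc: "isCont g 0" using smooth_germ_isCont g by blast
  have g1: "ord_ge 1 g" using ord_ge_iff_co[OF g(1), of 1] g(2) by (simp add: co_0)
  have "ord_ge (d + 1) (\<lambda>t. (g t - t - e * t ^ (d + 1)) + e * t ^ (d + 1))"
    by (intro ord_ge_add ord_ge_cmult ord_ge_monom ord_ge_mono[OF g(3)]) auto
  then have gt: "ord_ge (d + 1) (\<lambda>t. g t - t)" by simp
  have Ug: "ord_ge (d + 1) (\<lambda>t. U (g t) - U t)"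
    by (rule smooth_diff_ord_ge[OF U(1) gc g(2) _ _ gt]) auto
  have "ord_ge (Suc 0) (\<lambda>t. U t - U 0 * t ^ 0)" using co_lead_iff[OF U(1), of 0 "U 0"] by (simp add: co_0)
  then have Uc: "ord_ge 1 (\<lambda>t. U t - c)" using U0 by simp
  define p where "p t = g t ^ n - t ^ n - real n * e * t ^ (n + d)" for t
  have p: "ord_ge (n + d + 1) p" unfolding p_def by (rule power_shift_ord_ge[OF g1 g(3) assms(6)])
  have "ord_ge (n + d + 1) (\<lambda>t. p t * U t + (real n * e * (t ^ (n + d) * (U t - c)) + g t ^ n * (U (g t) - U t)))"
  proof (intro ord_ge_add ord_ge_cmult)
    show "ord_ge (n + d + 1) (\<lambda>t. p t * U t)" using ord_ge_mult[OF p smooth_ord_ge_0[OF U(1)]] by simp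
    show "ord_ge (n + d + 1) (\<lambda>t. t ^ (n + d) * (U t - c))" using ord_ge_mult[OF ord_ge_monom[OF order_refl] Uc] by simp
    show "ord_ge (n + d + 1) (\<lambda>t. g t ^ n * (U (g t) - U t))" using ord_ge_mult[OF ord_ge_power[OF g1, of n] Ug] by simp
  qed
  moreover have "\<forall>\<^sub>F t in nhds 0. p t * U t + (real n * e * (t ^ (n + d) * (U t - c)) + g t ^ n * (U (g t) - U t))
      = y (g t) - y t - real n * c * e * t ^ (n + d)"
    using U(3) isCont_comp_0[OF gc g(2) U(3)] by eventually_elim (simp add: p_def algebra_simps)
  ultimately show ?thesis by (rule ord_ge_cong[rotated])
qed

lemma powr_expand:
  "smooth_germ (\<lambda>u::real. (1 + u) powr a)" "ord_ge 2 (\<lambda>u. (1 + u) powr a - 1 - a * u)"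
proof -
  show s: "smooth_germ (\<lambda>u::real. (1 + u) powr a)"
    by (rule smooth_germ_powr) (auto intro!: smooth_germ_intros)
  have "((\<lambda>u::real. (1 + u) powr a) has_real_derivative a) (at 0)"
    by (rule derivative_eq_intros refl | simp)+
  then have "deriv (\<lambda>u::real. (1 + u) powr a) 0 = a" by (rule DERIV_imp_deriv)
  then show "ord_ge 2 (\<lambda>u. (1 + u) powr a - 1 - a * u)"
    using taylor_ord_ge[OF s, of 2] by (simp add: numeral_2_eq_2 co_0 co_1 diff_diff_eq)
qed

lemma ord_ge_cancel_monom:
  assumes w: "smooth_germ w" and o: "ord_ge (m + k) (\<lambda>t. t ^ m * w t)"
  shows "ord_ge k w"
proof -
  have s: "smooth_germ (\<lambda>t. t ^ m * w t)" by (intro smooth_germ_intros w)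
  have "co w i = co (\<lambda>t. t ^ m * w t) (m + i)" for i using co_monom_comp[OF w, of 1 m "m + i"] by simp
  then show ?thesis using o ord_ge_iff_co[OF w] ord_ge_iff_co[OF s] by simp
qed

text \<open>Write \<open>x = t^m (1 + u)\<close> with \<open>u = D t^d + ...\<close> and take
  \<open>h = t (1 + u)^(1/m)\<close>. The base is positive near 0, so the real power is smooth for
  both parities of \<open>m\<close>, and its linear term produces \<open>D / m\<close>.\<close>

lemma root_parameter:
  assumes x: "smooth_germ x" "ord_ge (m + d + 1) (\<lambda>t. x t - t ^ m - D * t ^ (m + d))" and m: "m \<ge> 1" and d: "d \<ge> 1"
  obtains h where "diffeo_germ h" "\<forall>\<^sub>F t in nhds 0. x t = h t ^ m"
    "ord_ge (d + 2) (\<lambda>t. h t - t - D / real m * t ^ (d + 1))"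
proof -
  have "ord_ge (Suc m) (\<lambda>t. (x t - t ^ m - D * t ^ (m + d)) + D * t ^ (m + d))"
    using d by (intro ord_ge_add ord_ge_cmult ord_ge_monom ord_ge_mono[OF x(2)]) auto
  then have "ord_ge (Suc m) (\<lambda>t. x t - 1 * t ^ m)" by simp
  then have co: "\<And>i. i < m \<Longrightarrow> co x i = 0" "co x m = 1" using co_lead_iff[OF x(1)] by blast+
  obtain C where C: "smooth_germ C" "\<And>i. co C i = co x (m + i)" "\<forall>\<^sub>F t in nhds 0. x t = t ^ m * C t"
    using hadamard[OF x(1) co(1)] by blast
  have C0: "C 0 = 1" using C(2)[of 0] co(2) by (simp add: co_0)
  define u where "u t = C t - 1" for t
  have su: "smooth_germ u" unfolding u_def by (intro smooth_germ_intros C)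
  have u0: "u 0 = 0" by (simp add: u_def C0)
  have uD: "ord_ge (d + 1) (\<lambda>t. u t - D * t ^ d)"
  proof (rule ord_ge_cancel_monom[where m = m])
    show "smooth_germ (\<lambda>t. u t - D * t ^ d)" by (intro smooth_germ_intros su)
    have "\<forall>\<^sub>F t in nhds 0. x t - t ^ m - D * t ^ (m + d) = t ^ m * (u t - D * t ^ d)"
      using C(3) by eventually_elim (simp add: u_def algebra_simps power_add)
    then show "ord_ge (m + (d + 1)) (\<lambda>t. t ^ m * (u t - D * t ^ d))"
      by (rule ord_ge_cong) (use x(2) in simp)
  qed
  have "ord_ge d (\<lambda>t. (u t - D * t ^ d) + D * t ^ d)"
    by (intro ord_ge_add ord_ge_cmult ord_ge_monom ord_ge_mono[OF uD]) auto
  then have ud: "ord_ge d u" by simp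
  define P where "P t = (1 + u t) powr (1 / real m)" for t
  have sP: "smooth_germ P" unfolding P_def by (rule smooth_germ_compose[OF su u0 powr_expand(1)])
  have uc: "isCont u 0" using su smooth_germ_isCont by blast
  have "ord_ge (d * 2) (\<lambda>t. P t - 1 - 1 / real m * u t)"
    unfolding P_def by (rule ord_ge_compose[OF powr_expand(2) ud uc u0])
  then have "ord_ge (d + 1) (\<lambda>t. P t - 1 - 1 / real m * u t)" by (rule ord_ge_mono) (use d in simp)
  then have "ord_ge (d + 1) (\<lambda>t. (P t - 1 - 1 / real m * u t) + 1 / real m * (u t - D * t ^ d))"
    by (intro ord_ge_add ord_ge_cmult uD)
  then have Pexp: "ord_ge (d + 1) (\<lambda>t. P t - 1 - D / real m * t ^ d)" by (simp add: algebra_simps)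
  define h where "h t = t * P t" for t
  have hexp: "ord_ge (d + 2) (\<lambda>t. h t - t - D / real m * t ^ (d + 1))"
    using ord_ge_mult[OF ord_ge_id Pexp] by (simp add: h_def algebra_simps)
  have sh: "smooth_germ h" unfolding h_def by (intro smooth_germ_intros sP)
  have "ord_ge 2 (\<lambda>t. (h t - t - D / real m * t ^ (d + 1)) + D / real m * t ^ (d + 1))"
    using d by (intro ord_ge_add ord_ge_cmult ord_ge_monom ord_ge_mono[OF hexp]) auto
  then have "ord_ge (Suc 1) (\<lambda>t. h t - 1 * t ^ 1)" by (simp add: numeral_2_eq_2)
  then have "deriv h 0 = 1" using co_lead_iff[OF sh] by (metis One_nat_def co_1)
  then have "diffeo_germ h" by (intro diffeo_germ_real sh) (auto simp: h_def)
  moreover have "\<forall>\<^sub>F t in nhds 0. x t = h t ^ m"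
  proof -
    have "\<forall>\<^sub>F t in nhds 0. u t > - 1"
    proof (rule eventually_nhds_compose[OF uc])
      show "\<forall>\<^sub>F y in nhds (u 0). - 1 < y" using eventually_nhds_in_open[of "{-1<..}" "0::real"] by (simp add: u0)
    qed
    with C(3) show ?thesis
    proof eventually_elim
      case (elim t)
      have "P t ^ m = 1 + u t" using elim(2) m by (simp add: P_def powr_power)
      then show ?case using elim(1) by (simp add: h_def power_mult_distrib u_def)
    qed
  qed
  ultimately show ?thesis using hexp that by blast
qed

text \<open>Evaluate the expansion of \<open>h\<close> at \<open>g t\<close>, where
  \<open>h (g t) = t\<close>. Since \<open>g t - t\<close> has order 2, \<open>g t ^ (d + 1)\<close>
  may be replaced by \<open>t ^ (d + 1)\<close> at the available precision.\<close>

lemma inverse_expansion: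
  assumes h: "diffeo_germ h" "ord_ge (d + 2) (\<lambda>t. h t - t - e * t ^ (d + 1))" and d: "d \<ge> 1"
    and g: "diffeo_germ g" "\<forall>\<^sub>F t in nhds 0. h (g t) = t"
  shows "ord_ge (d + 2) (\<lambda>t. g t - t - (- e) * t ^ (d + 1))"
proof -
  note sg = diffeo_germ_smooth[OF g(1)]
  have gc: "isCont g 0" using smooth_germ_isCont sg by blast
  have g1: "ord_ge 1 g" using ord_ge_iff_co[OF sg(1), of 1] sg(2) by (simp add: co_0)
  have "ord_ge (1 * (d + 2)) (\<lambda>t. h (g t) - g t - e * g t ^ (d + 1))"
    by (rule ord_ge_compose[OF h(2) g1 gc sg(2)])
  then have 1: "ord_ge (d + 2) (\<lambda>t. h (g t) - g t - e * g t ^ (d + 1))" by simp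
  have "\<forall>\<^sub>F t in nhds 0. h (g t) - g t - e * g t ^ (d + 1) = t - g t - e * g t ^ (d + 1)"
    using g(2) by eventually_elim simp
  from ord_ge_cong[OF this 1] have 2: "ord_ge (d + 2) (\<lambda>t. t - g t - e * g t ^ (d + 1))" .
  have "ord_ge 2 (\<lambda>t. - ((t - g t - e * g t ^ (d + 1)) + e * g t ^ (d + 1)))"
    using d by (intro ord_ge_minus ord_ge_add ord_ge_cmult ord_ge_mono[OF 2] ord_ge_mono[OF ord_ge_power[OF g1]]) auto
  then have "ord_ge 2 (\<lambda>t. g t - t)" by simp
  from power_diff_ord_ge[OF g1 ord_ge_id this, of d]
  have p: "ord_ge (d + 2) (\<lambda>t. g t ^ (d + 1) - t ^ (d + 1))" by (simp add: add.commute)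
  have "ord_ge (d + 2) (\<lambda>t. - (t - g t - e * g t ^ (d + 1)) - e * (g t ^ (d + 1) - t ^ (d + 1)))"
    by (rule ord_ge_diff[OF ord_ge_minus[OF 2] ord_ge_cmult[OF p]])
  then show ?thesis by (simp add: algebra_simps)
qed

lemma A_equivalent_cong_right:
  assumes "A_equivalent f g" "\<forall>\<^sub>F t in nhds 0. g t = g' t"
  shows "A_equivalent f g'"
proof -
  have "smooth_germ g" "g 0 = 0" using assms(1) by (auto simp: A_equivalent_def plane_curve_germ_def)
  from A_equivalent_right[OF this diffeo_germ_id assms(2)] show ?thesis using A_equivalent_trans assms(1) by blast
qed

text \<open>Restores \<open>t ^ m\<close> as first component after a perturbation of order
  \<open>m + d\<close> and records the price in the second one, a definite change of the coefficient
  of \<open>t ^ (n + d)\<close>. That change is the means of elimination in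
  \<open>eliminate_term\<close> and \<open>W_sharp_eliminate\<close>.\<close>

lemma straighten:
  assumes x: "smooth_germ x" "ord_ge (m + d + 1) (\<lambda>t. x t - t ^ m - D * t ^ (m + d))"
    and y: "smooth_germ y" "y 0 = 0" "ord_ge (Suc n) (\<lambda>t. y t - c * t ^ n)" and m: "m \<ge> 1" and d: "d \<ge> 1"
  obtains Y where "smooth_germ Y" "Y 0 = 0" "A_equivalent (\<lambda>t. (x t, y t)) (\<lambda>t. (t ^ m, Y t))"
    "ord_ge (n + d + 1) (\<lambda>t. Y t - y t + real n * c * (D / real m) * t ^ (n + d))"
proof -
  obtain h where h: "diffeo_germ h" "\<forall>\<^sub>F t in nhds 0. x t = h t ^ m"
    "ord_ge (d + 2) (\<lambda>t. h t - t - D / real m * t ^ (d + 1))"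
    using root_parameter[OF x m d] by blast
  obtain g where g: "diffeo_germ g" "\<forall>\<^sub>F t in nhds 0. h (g t) = t" using diffeo_germ_inverse[OF h(1)] by blast
  note sg = diffeo_germ_smooth[OF g(1)]
  have gc: "isCont g 0" using smooth_germ_isCont sg by blast
  have "ord_ge (n + d + 1) (\<lambda>t. y (g t) - y t - real n * c * - (D / real m) * t ^ (n + d))"
    by (rule smooth_shift_ord_ge[OF y(1,3) sg inverse_expansion[OF h(1,3) d g] d])
  then have o: "ord_ge (n + d + 1) (\<lambda>t. y (g t) - y t + real n * c * (D / real m) * t ^ (n + d))" by simp
  have x0: "x 0 = 0" using eventually_nhds_x_imp_x[OF h(2)] diffeo_germ_smooth[OF h(1)] m by simp
  have "\<forall>\<^sub>F t in nhds 0. (x (g t), y (g t)) = (t ^ m, y (g t))"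
    using g(2) isCont_comp_0[OF gc sg(2) h(2)] by eventually_elim simp
  then have "A_equivalent (\<lambda>t. (x t, y t)) (\<lambda>t. (t ^ m, y (g t)))"
    by (intro A_equivalent_right[OF smooth_germ_Pair[OF x(1) y(1)] _ g(1)]) (auto simp: x0 y(2) zero_prod_def)
  moreover have "smooth_germ (\<lambda>t. y (g t))" using smooth_germ_compose[OF sg y(1)] .
  ultimately show ?thesis using that o sg(2) y(2) by simp
qed

lemma power_lead_ord_ge:
  assumes "ord_ge p a" "ord_ge p b" "ord_ge (p + 1) (\<lambda>t. a t - b t)"
  shows "ord_ge (p * j + 1) (\<lambda>t. a t ^ j - b t ^ j)"
proof (induction j)
  case 0
  then show ?case by (simp add: ord_ge_zero)
next
  case (Suc j)
  have "ord_ge (p * Suc j + 1) (\<lambda>t. a t * (a t ^ j - b t ^ j) + (a t - b t) * b t ^ j)"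
  proof (rule ord_ge_add)
    show "ord_ge (p * Suc j + 1) (\<lambda>t. a t * (a t ^ j - b t ^ j))"
      using ord_ge_mult[OF assms(1) Suc] by (simp add: add_ac)
    show "ord_ge (p * Suc j + 1) (\<lambda>t. (a t - b t) * b t ^ j)"
      using ord_ge_mult[OF assms(3) ord_ge_power[OF assms(2), of j]] by (simp add: add_ac)
  qed
  then show ?case by (simp add: algebra_simps)
qed

text \<open>Adding \<open>\<mu> y\<^sup>j\<close> to the first component and restoring it to \<open>t\<^sup>m\<close> changes the coefficient of
  \<open>t\<^bsup>n(j+1)-m\<^esup>\<close> in \<open>y\<close> by a nonzero multiple of \<open>\<mu>\<close>.\<close>

lemma eliminate_term:
  assumes y: "smooth_germ y" "ord_ge (Suc n) (\<lambda>t. y t - t ^ n)" and m: "m \<ge> 1" and n: "n \<ge> 1" and j: "j \<ge> 1" and nj: "m < n * j"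
  obtains Y where "smooth_germ Y" "A_equivalent (\<lambda>t. (t ^ m, y t)) (\<lambda>t. (t ^ m, Y t))"
    "\<And>i. i < n * (j + 1) - m \<Longrightarrow> co Y i = co y i" "co Y (n * (j + 1) - m) = 0"
proof -
  define N where "N = n * (j + 1) - m"
  \<comment> \<open>Straightening subtracts \<open>n * \<mu> / m\<close> from the coefficient of
    \<open>t ^ N\<close>, and this \<mu> makes the difference zero. The perturbed first component is
    \<open>t ^ m + \<mu> t ^ (n j) + ...\<close>, whence the shift \<open>d = n j - m\<close>, for
    which \<open>n + d = N\<close>.\<close>
  define \<mu> where "\<mu> = co y N * real m / real n"
  define d where "d = n * j - m"
  have d: "d \<ge> 1" "m + d = n * j" "n + d = N" using nj by (auto simp: d_def N_def)
  have y1: "ord_ge (Suc n) (\<lambda>t. y t - 1 * t ^ n)" using y(2) by simp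
  have y0: "y 0 = 0" using co_lead_iff[OF y(1), of n 1] y1 n co_0[of y] by fastforce
  have "ord_ge n (\<lambda>t. (y t - t ^ n) + t ^ n)"
    by (intro ord_ge_add ord_ge_monom ord_ge_mono[OF y(2)]) auto
  then have yn: "ord_ge n y" by simp
  have "ord_ge (n * j + 1) (\<lambda>t. y t ^ j - (t ^ n) ^ j)"
    by (rule power_lead_ord_ge[OF yn ord_ge_monom]) (use y(2) in auto)
  then have "ord_ge (n * j + 1) (\<lambda>t. \<mu> * (y t ^ j - (t ^ n) ^ j))" by (rule ord_ge_cmult)
  then have x: "ord_ge (m + d + 1) (\<lambda>t. (t ^ m + \<mu> * y t ^ j) - t ^ m - \<mu> * t ^ (m + d))"
    unfolding d(2) power_mult by (simp add: algebra_simps)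
  have sx: "smooth_germ (\<lambda>t. t ^ m + \<mu> * y t ^ j)" by (intro smooth_germ_intros y)
  obtain Y where Y: "smooth_germ Y" "Y 0 = 0" "A_equivalent (\<lambda>t. (t ^ m + \<mu> * y t ^ j, y t)) (\<lambda>t. (t ^ m, Y t))"
    "ord_ge (n + d + 1) (\<lambda>t. Y t - y t + real n * 1 * (\<mu> / real m) * t ^ (n + d))"
    using straighten[OF sx x y(1) y0 y1 m d(1)] by blast
  define p where "p z = (fst z + \<mu> * snd z ^ j, snd z)" for z :: "real \<times> real"
  have "diffeo_germ p"
  proof (rule diffeo_germ_plane)
    show "smooth_germ p" unfolding p_def by (intro smooth_germ_intros)
    show "p 0 = 0" using j by (simp add: p_def zero_prod_def)
    have "((\<lambda>z :: real \<times> real. (fst z + \<mu> * snd z ^ j, snd z)) has_derivative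
        (\<lambda>v. (1 * fst v + (if j = 1 then \<mu> else 0) * snd v, 0 * fst v + 1 * snd v))) (at 0)"
    proof (intro has_derivative_Pair)
      have "((\<lambda>z :: real \<times> real. fst z + \<mu> * snd z ^ j) has_derivative
          (\<lambda>v. fst v + \<mu> * (real j * snd v * snd (0 :: real \<times> real) ^ (j - 1)))) (at 0)"
        by (rule derivative_eq_intros refl | simp)+
      moreover have "(\<lambda>v. fst v + \<mu> * (real j * snd v * snd (0 :: real \<times> real) ^ (j - 1))) =
         (\<lambda>v. 1 * fst v + (if j = 1 then \<mu> else 0) * snd v)"
        using j by (auto simp: fun_eq_iff power_0_left)
      ultimately show "((\<lambda>z :: real \<times> real. fst z + \<mu> * snd z ^ j) has_derivative
          (\<lambda>v. 1 * fst v + (if j = 1 then \<mu> else 0) * snd v)) (at 0)" by simp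
      show "((\<lambda>z :: real \<times> real. snd z) has_derivative (\<lambda>v. 0 * fst v + 1 * snd v)) (at 0)"
        by (rule derivative_eq_intros refl | simp)+
    qed
    then show "(p has_derivative (\<lambda>v. (1 * fst v + (if j = 1 then \<mu> else 0) * snd v, 0 * fst v + 1 * snd v))) (at 0)"
      by (simp add: p_def[abs_def])
  qed auto
  then have "A_equivalent (\<lambda>t. (t ^ m + \<mu> * y t ^ j, y t)) (\<lambda>t. (t ^ m, y t))"
    by (rule A_equivalent_left[rotated 2])
      (use m y0 in \<open>auto simp: p_def zero_prod_def intro!: smooth_germ_intros y\<close>)
  from A_equivalent_trans[OF A_equivalent_sym[OF this] Y(3)]
  have eq: "A_equivalent (\<lambda>t. (t ^ m, y t)) (\<lambda>t. (t ^ m, Y t))" .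
  have "real n * 1 * (\<mu> / real m) = co y N" using m n by (simp add: \<mu>_def)
  then have "ord_ge (Suc N) (\<lambda>t. Y t - y t - (- co y N) * t ^ N)" using Y(4) by (simp add: d)
  then have c: "(\<forall>i<N. co (\<lambda>t. Y t - y t) i = 0) \<and> co (\<lambda>t. Y t - y t) N = - co y N"
    using co_lead_iff[OF smooth_germ_diff[OF Y(1) y(1)]] by blast
  show ?thesis
    by (rule that[OF Y(1) eq]) (use c in \<open>auto simp: co_diff[OF Y(1) y(1)] N_def\<close>)
qed

text \<open>The Jacobian matrix at 0 is lower triangular with diagonal \<open>deriv s 0\<close>,
  \<open>b 0\<close>. This one shape covers shears, rescalings and changes of the first coordinate,
  with \<open>r\<close> holding terms that have no linear part.\<close>

lemma fst_snd_smooth_diffeo: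
  assumes s: "smooth_germ s" "s 0 = 0" "deriv s 0 \<noteq> 0" and a: "smooth_germ a" "a 0 = 0" and b: "smooth_germ b" "b 0 \<noteq> 0"
    and r: "smooth_germ r" "(r has_derivative (\<lambda>v. 0)) (at 0)" "r 0 = 0"
  shows "diffeo_germ (\<lambda>z :: real \<times> real. (s (fst z), a (fst z) + b (fst z) * snd z + r z))"
proof (rule diffeo_germ_plane)
  show "smooth_germ (\<lambda>z :: real \<times> real. (s (fst z), a (fst z) + b (fst z) * snd z + r z))"
    by (intro smooth_germ_intros smooth_germ_of_fst s a b r)
  show "(s (fst 0), a (fst 0) + b (fst 0) * snd 0 + r 0) = (0 :: real \<times> real)" using s a r by (simp add: zero_prod_def)
  have bs: "((\<lambda>z :: real \<times> real. b (fst z) * snd z) has_derivative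
    (\<lambda>v. b 0 * snd v + deriv b 0 * fst v * 0)) (at 0)"
    using has_derivative_mult[where f = "\<lambda>z. b (fst z)" and g = snd and x = "0 :: real \<times> real",
        OF smooth_germ_fst_deriv[OF b(1)] bounded_linear_imp_has_derivative[OF bounded_linear_snd]] by simp
  have "((\<lambda>z :: real \<times> real. (s (fst z), a (fst z) + b (fst z) * snd z + r z)) has_derivative
    (\<lambda>v. (deriv s 0 * fst v, deriv a 0 * fst v + (b 0 * snd v + deriv b 0 * fst v * 0) + 0))) (at 0)"
    by (intro has_derivative_Pair has_derivative_add smooth_germ_fst_deriv s a bs r)
  then show "((\<lambda>z :: real \<times> real. (s (fst z), a (fst z) + b (fst z) * snd z + r z)) has_derivative
    (\<lambda>v. (deriv s 0 * fst v + 0 * snd v, deriv a 0 * fst v + b 0 * snd v))) (at 0)" by simp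
  show "deriv s 0 * b 0 - 0 * deriv a 0 \<noteq> 0" using s b by simp
qed

lemma deriv_inverse_germ:
  assumes "diffeo_germ s" "diffeo_germ r" "\<forall>\<^sub>F t in nhds (0::real). s (r t) = t"
  shows "deriv s 0 * deriv r 0 = 1"
proof -
  note d = diffeo_germ_smooth[OF assms(1)] diffeo_germ_smooth[OF assms(2)]
  have "(s has_real_derivative deriv s 0) (at (r 0))" using smooth_germ_deriv(3)[OF d(1)] d(4) by simp
  from DERIV_chain2[OF this smooth_germ_deriv(3)[OF d(3)]]
  have "((\<lambda>t. s (r t)) has_real_derivative deriv s 0 * deriv r 0) (at 0)" .
  moreover have "((\<lambda>t. s (r t)) has_real_derivative 1) (at 0)"
    using DERIV_cong_ev[OF refl assms(3) refl] DERIV_ident by simp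
  ultimately show ?thesis by (rule DERIV_unique)
qed

text \<open>A reparametrisation \<open>T = t g(T\<^sup>m)\<close> preserves the splitting of exponents by residue modulo \<open>m\<close>.\<close>

lemma residue_reparametrisation:
  assumes s: "smooth_germ a" "a 0 = 0" "smooth_germ u" "u 0 \<noteq> 0" "smooth_germ v" "smooth_germ z" "smooth_germ g" "g 0 \<noteq> 0"
    and m: "m \<ge> 1" and n: "n \<ge> 1" "n \<le> e" "n \<le> p"
    and y: "\<forall>\<^sub>F t in nhds 0. y t = a (t ^ m) + u (t ^ m) * (t ^ n + t ^ e * v (t ^ m) + t ^ p * z (t ^ m))"
  obtains \<sigma> where "smooth_germ \<sigma>" "\<sigma> 0 = 0" "deriv \<sigma> 0 = g 0 ^ m"
    "A_equivalent (\<lambda>t. (t ^ m, y t)) (\<lambda>t. (t ^ m, t ^ n + t ^ e * (g (\<sigma> (t ^ m)) ^ (e - n) * v (\<sigma> (t ^ m)))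
       + t ^ p * (g (\<sigma> (t ^ m)) ^ (p - n) * z (\<sigma> (t ^ m)))))"
proof -
  \<comment> \<open>For \<open>h T = T / g (T ^ m)\<close> one has
    \<open>h T ^ m = \<rho> (T ^ m)\<close>; the inverse \<sigma> of \<rho> recovers the old
    \<open>T ^ m\<close> from the new one.\<close>
  define \<rho> where "\<rho> X = X / g X ^ m" for X
  have sr: "smooth_germ \<rho>" unfolding \<rho>_def by (intro smooth_germ_intros s) (use s in auto)
  have dg: "(g has_real_derivative deriv g 0) (at 0)" by (rule smooth_germ_deriv(3)[OF s(7)])
  have gm: "smooth_germ (\<lambda>X. inverse (g X ^ m))" by (intro smooth_germ_inverse smooth_germ_power s) (use s in auto)
  have dr: "deriv (\<lambda>X. X * w X) 0 = w 0" if "smooth_germ w" for w :: "real \<Rightarrow> real"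
  proof -
    have "((\<lambda>X. X * w X) has_real_derivative 1 * w 0 + deriv w 0 * 0) (at 0)"
      by (rule DERIV_mult[OF DERIV_ident smooth_germ_deriv(3)[OF that]])
    then show ?thesis using DERIV_imp_deriv by fastforce
  qed
  have d\<rho>: "deriv \<rho> 0 = inverse (g 0 ^ m)" using dr[OF gm] by (simp add: \<rho>_def[abs_def] divide_inverse)
  have \<rho>: "diffeo_germ \<rho>" by (rule diffeo_germ_real[OF sr]) (use d\<rho> s in \<open>auto simp: \<rho>_def\<close>)
  obtain \<sigma> where \<sigma>: "diffeo_germ \<sigma>" "\<forall>\<^sub>F x in nhds 0. \<sigma> (\<rho> x) = x" using diffeo_germ_inverse[OF \<rho>] by blast
  note s\<sigma> = diffeo_germ_smooth[OF \<sigma>(1)]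
  have d\<sigma>: "deriv \<sigma> 0 = g 0 ^ m" using deriv_inverse_germ[OF \<sigma>(1) \<rho> \<sigma>(2)] d\<rho> s(8) by (simp add: field_simps)
  define h where "h T = T * inverse (g (T ^ m))" for T
  have tm: "smooth_germ (\<lambda>t::real. t ^ m)" "(0::real) ^ m = 0" using m by (auto intro!: smooth_germ_intros)
  have gT: "smooth_germ (\<lambda>T. inverse (g (T ^ m)))"
    by (intro smooth_germ_inverse smooth_germ_compose[OF tm]) (use s tm in auto)
  have h: "diffeo_germ h"
    by (rule diffeo_germ_real) (use dr[OF gT] s tm gT in \<open>auto simp: h_def[abs_def] intro!: smooth_germ_intros\<close>)
  define G where "G t = (t ^ m, t ^ n + t ^ e * (g (\<sigma> (t ^ m)) ^ (e - n) * v (\<sigma> (t ^ m)))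
       + t ^ p * (g (\<sigma> (t ^ m)) ^ (p - n) * z (\<sigma> (t ^ m))))" for t
  have st: "smooth_germ (\<lambda>t. \<sigma> (t ^ m))" "\<sigma> (0 ^ m) = 0"
    using smooth_germ_compose[OF tm s\<sigma>(1)] by (simp, simp only: tm(2) s\<sigma>(2))
  have sG: "smooth_germ G" unfolding G_def
    by (intro smooth_germ_intros smooth_germ_compose[OF st] s)
  have G0: "G 0 = 0" 
  proof -
    have "n \<noteq> 0" "e \<noteq> 0" "p \<noteq> 0" "m \<noteq> 0" using m n by auto
    then show ?thesis by (simp add: G_def zero_prod_def zero_power)
  qed
  \<comment> \<open>At \<open>G (h T)\<close> this returns \<open>(T ^ m, y T)\<close>: \<sigma>
    restores the first component, and \<open>g ^ n\<close> together with the powers of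
    \<open>g\<close> stored in \<open>G\<close> cancels the denominators of \<open>h ^ n\<close>,
    \<open>h ^ e\<close> and \<open>h ^ p\<close>.\<close>
  define P where "P = (\<lambda>w :: real \<times> real. (\<sigma> (fst w), a (\<sigma> (fst w)) + u (\<sigma> (fst w)) * g (\<sigma> (fst w)) ^ n * snd w + 0))"
  have P: "diffeo_germ P" unfolding P_def
    by (rule fst_snd_smooth_diffeo[OF s\<sigma> _ _ _ _ _ smooth_germ_const has_derivative_const])
      (use s s\<sigma> d\<sigma> in \<open>auto intro!: smooth_germ_intros smooth_germ_compose[OF s\<sigma>]\<close>)
  have hc: "isCont h 0" "h 0 = 0" using diffeo_germ_smooth[OF h] smooth_germ_isCont by auto
  have Gh: "A_equivalent G (\<lambda>T. G (h T))" by (rule A_equivalent_right[OF sG G0 h]) auto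
  have sGh: "smooth_germ (\<lambda>T. G (h T))" "G (h 0) = 0" using Gh by (auto simp: A_equivalent_def plane_curve_germ_def)
  have cm: "isCont (\<lambda>t::real. t ^ m) 0" by simp
  have cg: "isCont g 0" using s smooth_germ_isCont by blast
  have "\<forall>\<^sub>F x in nhds 0. g x \<noteq> 0"
    by (rule eventually_nhds_compose[OF cg]) (use s(8) t1_space_nhds[of "g 0" 0] in blast)
  from isCont_comp_0[OF cm tm(2) this] isCont_comp_0[OF cm tm(2) \<sigma>(2)] y
  have "\<forall>\<^sub>F T in nhds 0. (T ^ m, y T) = P (G (h T))"
  proof eventually_elim
    case (elim T)
    have hm: "h T ^ m = \<rho> (T ^ m)" by (simp add: h_def \<rho>_def power_mult_distrib power_inverse divide_inverse)
    have sh: "\<sigma> (h T ^ m) = T ^ m" unfolding hm by (rule elim(2))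
    have c: "g (T ^ m) ^ k * h T ^ l = g (T ^ m) ^ (k - l) * T ^ l" if "l \<le> k" for k l
      using elim(1) that by (simp add: h_def power_mult_distrib power_inverse power_diff field_simps)
    have E: "g (T ^ m) ^ n * (h T ^ k * (g (T ^ m) ^ (k - n) * w)) = T ^ k * w" if "n \<le> k" for k w
    proof -
      have "g (T ^ m) ^ n * (h T ^ k * (g (T ^ m) ^ (k - n) * w)) = (g (T ^ m) ^ (n + (k - n)) * h T ^ k) * w"
        by (simp add: power_add mult_ac)
      then show ?thesis using c[of k k] that by simp
    qed
    have E0: "g (T ^ m) ^ n * h T ^ n = T ^ n" using c[of n n] by simp
    have "snd (P (G (h T))) = a (T ^ m) + u (T ^ m) * (g (T ^ m) ^ n * h T ^ n
        + g (T ^ m) ^ n * (h T ^ e * (g (T ^ m) ^ (e - n) * v (T ^ m)))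
        + g (T ^ m) ^ n * (h T ^ p * (g (T ^ m) ^ (p - n) * z (T ^ m))))"
      by (simp add: P_def G_def sh distrib_left mult.assoc)
    also have "\<dots> = y T" unfolding E0 E[OF n(2)] E[OF n(3)] elim(3) ..
    finally show ?case by (simp add: prod_eq_iff) (simp add: P_def G_def sh)
  qed
  from A_equivalent_left[OF sGh P this] have "A_equivalent (\<lambda>T. (T ^ m, y T)) (\<lambda>T. G (h T))" .
  from A_equivalent_trans[OF this A_equivalent_sym[OF Gh]] show ?thesis
    using that s\<sigma> d\<sigma> by (simp add: G_def[abs_def])
qed

text \<open>With \<open>v = w / u\<close> and \<open>k = e - n\<close>, reparametrising by
  \<open>g\<close> turns the coefficient of \<open>t ^ e\<close> into \<open>g ^ k * v\<close>, so
  \<open>g\<close> is taken as a \<open>k\<close>-th root of \<open>c / v\<close>. For odd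
  \<open>k\<close> a negative \<open>g\<close> absorbs the sign of \<open>v\<close>; for even
  \<open>k\<close> the sign survives in \<open>c\<close>. The term with exponent \<open>p\<close> is
  carried along, and it stays zero if it was zero.\<close>

lemma normalise_two_terms:
  assumes s: "smooth_germ a" "a 0 = 0" "smooth_germ u" "u 0 \<noteq> 0" "smooth_germ w" "w 0 \<noteq> 0" "smooth_germ z"
    and m: "m \<ge> 1" and n: "n \<ge> 1" "n < e" "n \<le> p"
    and y: "\<forall>\<^sub>F t in nhds 0. y t = a (t ^ m) + t ^ n * u (t ^ m) + t ^ e * w (t ^ m) + t ^ p * z (t ^ m)"
  obtains c Z where "c \<in> {1, -1}" "odd (e - n) \<longrightarrow> c = 1" "smooth_germ Z" "(\<forall>x. z x = 0) \<longrightarrow> (\<forall>x. Z x = 0)"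
    "A_equivalent (\<lambda>t. (t ^ m, y t)) (\<lambda>t. (t ^ m, t ^ n + c * t ^ e + t ^ p * Z (t ^ m)))"
proof -
  define k where "k = e - n"
  have k: "k \<ge> 1" using n by (simp add: k_def)
  define v where "v x = w x / u x" for x
  have sv: "smooth_germ v" "v 0 \<noteq> 0" unfolding v_def using s by (auto intro!: smooth_germ_intros)
  have szu: "smooth_germ (\<lambda>x. z x / u x)" using s by (auto intro!: smooth_germ_intros)
  \<comment> \<open>\<open>s1\<close> is the sign of \<open>v\<close> near 0 and \<open>s2\<close>
    the sign given to \<open>g\<close>. For odd \<open>k\<close> they agree, and
    \<open>c = s1 ^ (k + 1)\<close> is 1.\<close>
  define s1 where "s1 = sgn (v 0)"
  define s2 where "s2 = (if odd k then s1 else 1)"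
  have s12: "s1 \<in> {1, -1}" "s2 \<in> {1, -1}" "s1 * v 0 > 0" using sv(2) by (auto simp: s1_def s2_def sgn_if)
  define c where "c = s2 ^ k * s1"
  have c: "c \<in> {1, -1}" "odd k \<Longrightarrow> c = 1" using s12 by (auto simp: c_def s2_def)
  define g where "g x = s2 * (s1 * v x) powr (- 1 / real k)" for x
  have sg: "smooth_germ g" unfolding g_def
    by (intro smooth_germ_intros smooth_germ_powr sv) (use s12 in auto)
  have g0: "g 0 \<noteq> 0" using s12 sv by (auto simp: g_def)
  have gk: "g x ^ k * v x = c" if "s1 * v x > 0" for x
  proof -
    have "((s1 * v x) powr (- 1 / real k)) ^ k = (s1 * v x) powr (- 1 / real k * real k)"
    proof -
      have "s1 * v x \<noteq> 0" by (rule less_imp_neq[OF that, symmetric])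
      from powr_power[OF this, of "- 1 / real k" k] show ?thesis by (simp only: mult.commute)
    qed
    also have "\<dots> = (s1 * v x) powr - 1" using k by simp
    also have "\<dots> = inverse (s1 * v x)" using that by (simp only: powr_minus powr_one less_imp_le)
    finally have "((s1 * v x) powr (- 1 / real k)) ^ k = inverse (s1 * v x)" .
    then have "g x ^ k * v x = s2 ^ k * (v x / (s1 * v x))" by (simp add: g_def power_mult_distrib divide_inverse)
    also have "v x / (s1 * v x) = s1" using that s12 by auto
    finally show ?thesis by (simp add: c_def)
  qed
  have cu: "isCont u 0" using s smooth_germ_isCont by blast
  have cm: "isCont (\<lambda>t::real. t ^ m) 0" "(0::real) ^ m = 0" using m by auto
  have "\<forall>\<^sub>F x in nhds 0. u x \<noteq> 0"
    by (rule eventually_nhds_compose[OF cu]) (use s(4) t1_space_nhds[of "u 0" 0] in blast)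
  from isCont_comp_0[OF cm this] y
  have "\<forall>\<^sub>F t in nhds 0. y t = a (t ^ m) + u (t ^ m) * (t ^ n + t ^ e * v (t ^ m) + t ^ p * (z (t ^ m) / u (t ^ m)))"
    by eventually_elim (simp add: v_def algebra_simps)
  from residue_reparametrisation[OF s(1-4) sv(1) szu sg g0 m n(1) _ n(3) this] n(2)
  obtain \<sigma> where \<sigma>: "smooth_germ \<sigma>" "\<sigma> 0 = 0"
    "A_equivalent (\<lambda>t. (t ^ m, y t)) (\<lambda>t. (t ^ m, t ^ n + t ^ e * (g (\<sigma> (t ^ m)) ^ (e - n) * v (\<sigma> (t ^ m)))
       + t ^ p * (g (\<sigma> (t ^ m)) ^ (p - n) * (z (\<sigma> (t ^ m)) / u (\<sigma> (t ^ m))))))" by auto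
  define Z where "Z x = g (\<sigma> x) ^ (p - n) * (z (\<sigma> x) / u (\<sigma> x))" for x
  have sZ: "smooth_germ Z" unfolding Z_def
    by (intro smooth_germ_intros smooth_germ_compose[OF \<sigma>(1,2)] sg s) (use \<sigma> s in auto)
  have "isCont (\<lambda>x. s1 * v (\<sigma> x)) 0"
    by (rule smooth_germ_isCont) (intro smooth_germ_intros smooth_germ_compose[OF \<sigma>(1,2)] sv)
  then have "\<forall>\<^sub>F x in nhds 0. s1 * v (\<sigma> x) > 0"
    by (rule eventually_nhds_compose) (use s12 \<sigma> eventually_nhds_in_open[of "{0<..}" "s1 * v 0"] in simp)
  from isCont_comp_0[OF cm this]
  have "\<forall>\<^sub>F t in nhds 0. (t ^ m, t ^ n + t ^ e * (g (\<sigma> (t ^ m)) ^ (e - n) * v (\<sigma> (t ^ m)))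
       + t ^ p * (g (\<sigma> (t ^ m)) ^ (p - n) * (z (\<sigma> (t ^ m)) / u (\<sigma> (t ^ m))))) = (t ^ m, t ^ n + c * t ^ e + t ^ p * Z (t ^ m))"
    by eventually_elim (use gk in \<open>simp add: k_def Z_def mult.commute\<close>)
  from A_equivalent_cong_right[OF \<sigma>(3) this] show ?thesis
    using that[OF c(1) _ sZ] c(2) by (simp add: k_def Z_def)
qed

section \<open>Obstructions to equivalence\<close>

text \<open>Continuity bounds both partial derivatives near 0, and the sum of the two bounds
  dominates the operator norm of the derivative.\<close>

lemma smooth_germ_Lipschitz:
  fixes f :: "real \<times> real \<Rightarrow> 'a::real_normed_vector"
  assumes "smooth_germ f"
  obtains L e where "L > 0" "e > 0" "\<And>x y. norm x < e \<Longrightarrow> norm y < e \<Longrightarrow> norm (f x - f y) \<le> L * norm (x - y)"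
proof -
  obtain U where U: "open U" "0 \<in> U" "smooth_on U f" using assms smooth_germ_def by blast
  let ?D = "\<lambda>x. frechet_derivative f (at x)"
  have bd: "\<exists>K. \<forall>\<^sub>F x in nhds 0. norm (?D x v) \<le> K" for v
  proof -
    have "isCont (\<lambda>x. ?D x v) 0"
      using smooth_on_continuous[OF smooth_on_frechet[OF U(3)]] U continuous_on_eq_continuous_at by blast
    then have "\<forall>\<^sub>F x in nhds 0. ?D x v \<in> ball (?D 0 v) 1"
      by (rule eventually_nhds_compose) (use eventually_nhds_in_open[of "ball (?D 0 v) 1" "?D 0 v"] in simp)
    then have "\<forall>\<^sub>F x in nhds 0. norm (?D x v) \<le> norm (?D 0 v) + 1"
    proof eventually_elim
      case (elim x)
      then show ?case using norm_triangle_ineq2[of "?D x v" "?D 0 v"] by (simp add: dist_norm norm_minus_commute)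
    qed
    then show ?thesis by blast
  qed
  obtain K1 K2 where K: "\<forall>\<^sub>F x in nhds 0. norm (?D x (1,0)) \<le> K1" "\<forall>\<^sub>F x in nhds 0. norm (?D x (0,1)) \<le> K2"
    using bd by metis
  have "\<forall>\<^sub>F x in nhds 0. x \<in> U" using U eventually_nhds_in_open by blast
  with K have "\<forall>\<^sub>F x in nhds 0. x \<in> U \<and> norm (?D x (1,0)) \<le> K1 \<and> norm (?D x (0,1)) \<le> K2"
    by eventually_elim simp
  then obtain e where e: "e > 0" "\<And>x. norm x < e \<Longrightarrow> x \<in> U \<and> norm (?D x (1,0)) \<le> K1 \<and> norm (?D x (0,1)) \<le> K2"
    by (auto simp: eventually_nhds_metric)
  have L: "onorm (?D x) \<le> K1 + K2" if "norm x < e" for x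
  proof (rule onorm_bound)
    have "norm (?D x (1,0)) \<le> K1" "norm (?D x (0,1)) \<le> K2" using e(2)[OF that] by auto
    then have K0: "0 \<le> K1" "0 \<le> K2" using norm_ge_zero order_trans by blast+
    then show "0 \<le> K1 + K2" by simp
    fix v
    have l: "linear (?D x)"
      using has_derivative_linear[OF smooth_on_has_derivative[OF U(3)]] e(2)[OF that] by blast
    have "v = fst v *\<^sub>R (1,0) + snd v *\<^sub>R (0,1)" by (cases v) auto
    then have "?D x v = fst v *\<^sub>R ?D x (1,0) + snd v *\<^sub>R ?D x (0,1)"
      using linear_add[OF l] linear_scale[OF l] by metis
    then have "norm (?D x v) \<le> \<bar>fst v\<bar> * norm (?D x (1,0)) + \<bar>snd v\<bar> * norm (?D x (0,1))"
      using norm_triangle_ineq[of "fst v *\<^sub>R ?D x (1,0)" "snd v *\<^sub>R ?D x (0,1)"] by simp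
    also have "\<dots> \<le> norm v * K1 + norm v * K2"
      using e(2)[OF that] norm_fst_le[of "fst v" "snd v"] norm_snd_le[of "snd v" "fst v"]
      by (intro add_mono mult_mono) auto
    finally show "norm (?D x v) \<le> (K1 + K2) * norm v" by (simp add: algebra_simps)
  qed
  have "norm (f x - f y) \<le> (K1 + K2) * norm (x - y)" if "norm x < e" "norm y < e" for x y
  proof (rule differentiable_bound[of "ball 0 e" f ?D])
    show "(f has_derivative ?D z) (at z within ball 0 e)" if "z \<in> ball 0 e" for z
      by (rule has_derivative_at_withinI[OF smooth_on_has_derivative[OF U(3)]]) (use e(2)[of z] that in simp)
    show "onorm (?D z) \<le> K1 + K2" if "z \<in> ball 0 e" for z using L that by simp
  qed (use that in auto)
  moreover have "(K1 + K2) * norm (x - y) \<le> (\<bar>K1 + K2\<bar> + 1) * norm (x - y)" for x y :: "real \<times> real"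
    by (intro mult_right_mono) auto
  ultimately show ?thesis
    using that[of "\<bar>K1 + K2\<bar> + 1" e] e(1) by (meson abs_ge_zero add_nonneg_pos order_trans zero_less_one)
qed

lemma ord_ge_dominated:
  assumes "\<forall>\<^sub>F t in nhds 0. \<bar>f t\<bar> \<le> K * \<bar>g t\<bar>" "ord_ge N g" shows "ord_ge N f"
proof -
  obtain C where C: "C > 0" "\<forall>\<^sub>F t in nhds 0. \<bar>g t\<bar> \<le> C * \<bar>t\<bar> ^ N" using assms(2) by (rule ord_geE)
  have "\<forall>\<^sub>F t in nhds 0. \<bar>f t\<bar> \<le> (\<bar>K\<bar> * C) * \<bar>t\<bar> ^ N"
    using assms(1) C(2)
  proof eventually_elim
    case (elim t)
    have "K * \<bar>g t\<bar> \<le> \<bar>K\<bar> * \<bar>g t\<bar>" by (intro mult_right_mono) auto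
    also have "\<dots> \<le> \<bar>K\<bar> * (C * \<bar>t\<bar> ^ N)" using elim by (intro mult_left_mono) auto
    finally show ?case using elim by (simp add: mult.assoc)
  qed
  then show ?thesis by (rule ord_geI)
qed

text \<open>Let \<open>q\<close> be the second component of the target map \<open>p\<close>. Along
  the curve it equals \<open>y2 (h t)\<close>, so its coefficients up to \<open>t ^ n\<close>
  vanish. To that order it is \<open>q (t ^ m, 0)\<close>, a series in \<open>t ^ m\<close>, plus
  \<open>b 0 * y1 t\<close>. The coefficient of \<open>t ^ n\<close> kills the partial derivative
  \<open>b 0\<close>, the coefficient of \<open>t ^ m\<close> kills the other one, and a map whose
  second component has zero differential is not invertible.\<close>

lemma not_A_equivalent_order:
  assumes m: "m \<ge> 1" "m < n" "\<not> m dvd n"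
    and y1: "smooth_germ y1" "ord_ge (Suc n) (\<lambda>t. y1 t - c * t ^ n)" "c \<noteq> 0"
    and y2: "ord_ge (Suc n) y2"
  shows "\<not> A_equivalent (\<lambda>t. (t ^ m, y2 t)) (\<lambda>t. (t ^ m, y1 t))"
proof
  assume "A_equivalent (\<lambda>t. (t ^ m, y2 t)) (\<lambda>t. (t ^ m, y1 t))"
  then obtain h p where h: "diffeo_germ h" and p: "diffeo_germ p"
    and eq: "\<forall>\<^sub>F t in nhds 0. (h t ^ m, y2 (h t)) = p (t ^ m, y1 t)"
    unfolding A_equivalent_def by auto
  note sh = diffeo_germ_smooth[OF h] and sp = diffeo_germ_smooth[OF p]
  define q where "q z = snd (p z)" for z
  have sq: "smooth_germ q" unfolding q_def by (rule smooth_germ_snd_comp[OF sp(1)])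
  obtain U where U: "open U" "0 \<in> U" "smooth_on U q" using sq smooth_germ_def by blast
  define b where "b z = frechet_derivative q (at z) (0, 1)" for z
  have sb: "smooth_on U b" unfolding b_def by (rule smooth_on_frechet[OF U(3)])
  obtain e where e: "e > 0" "\<And>z. norm z < e \<Longrightarrow> z \<in> U"
    using eventually_nhds_in_open[OF U(1,2)] by (auto simp: eventually_nhds_metric)
  have pb: "((\<lambda>y. q (x, y)) has_real_derivative b (x, y)) (at y)" if "(x, y) \<in> U" for x y
  proof -
    have 1: "((\<lambda>y. (x, y)) has_derivative (\<lambda>v. (0, v))) (at y)"
      by (intro has_derivative_Pair has_derivative_const has_derivative_ident)
    have d: "(q has_derivative frechet_derivative q (at (x, y))) (at (x, y))"
      by (rule smooth_on_has_derivative[OF U(3) that])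
    have "((\<lambda>y. q (x, y)) has_derivative (\<lambda>v. frechet_derivative q (at (x, y)) (0, v))) (at y)"
      by (rule has_derivative_compose[OF 1 d])
    moreover have "frechet_derivative q (at (x, y)) (0, v) = b (x, y) * v" for v
      using linear_scale[OF has_derivative_linear[OF d], of v "(0,1)"] by (simp add: b_def)
    ultimately show ?thesis by (simp add: has_field_derivative_def)
  qed
  obtain L d where L: "L > 0" "d > 0" "\<And>x y. norm x < d \<Longrightarrow> norm y < d \<Longrightarrow> norm (b x - b y) \<le> L * norm (x - y)"
    using smooth_germ_Lipschitz[OF smooth_germI[OF U(1,2) sb]] by blast
  have cy: "isCont y1 0" using y1(1) smooth_germ_isCont by blast
  have co1: "\<And>i. i < n \<Longrightarrow> co y1 i = 0" "co y1 n = c" using co_lead_iff[OF y1(1)] y1(2) by blast+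
  have on: "ord_ge n y1" using ord_ge_iff_co[OF y1(1)] co1 by blast
  have y10: "y1 0 = 0" using co1(1)[of 0] m by (simp add: co_0)
  \<comment> \<open>Mean value inequality in the second variable: \<open>b\<close> deviates from
    \<open>b 0\<close> by at most \<open>L\<close> times the norm of the point, and this extra
    factor vanishing at 0 raises the order \<open>n\<close> of \<open>y1\<close> by one.\<close>
  have dom: "ord_ge (Suc n) (\<lambda>t. q (t ^ m, y1 t) - q (t ^ m, 0) - b 0 * y1 t)"
  proof (rule ord_ge_dominated)
    have "isCont (\<lambda>t. \<bar>t ^ m\<bar> + \<bar>y1 t\<bar>) 0" by (intro continuous_intros cy)
    then have "\<forall>\<^sub>F t in nhds 0. \<bar>t ^ m\<bar> + \<bar>y1 t\<bar> < min e d"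
      by (rule eventually_nhds_compose)
        (use m y10 e(1) L(2) eventually_nhds_in_open[of "{..<min e d}" "0::real"] in \<open>simp add: zero_power\<close>)
    then show "\<forall>\<^sub>F t in nhds 0. \<bar>q (t ^ m, y1 t) - q (t ^ m, 0) - b 0 * y1 t\<bar> \<le> L * \<bar>(\<bar>t ^ m\<bar> + \<bar>y1 t\<bar>) * y1 t\<bar>"
    proof eventually_elim
      case (elim t)
      let ?S = "{-\<bar>y1 t\<bar>..\<bar>y1 t\<bar>}"
      have nm: "norm (t ^ m, s) \<le> \<bar>t ^ m\<bar> + \<bar>y1 t\<bar>" if "s \<in> ?S" for s
        using norm_Pair_le[of "t ^ m" s] that by auto
      have "norm ((q (t ^ m, y1 t) - b 0 * y1 t) - (q (t ^ m, 0) - b 0 * 0)) \<le> (L * (\<bar>t ^ m\<bar> + \<bar>y1 t\<bar>)) * norm (y1 t - 0)"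
      proof (rule field_differentiable_bound[of ?S "\<lambda>s. q (t ^ m, s) - b 0 * s" "\<lambda>s. b (t ^ m, s) - b 0"])
        fix s assume s: "s \<in> ?S"
        have ns: "norm (t ^ m, s) < min e d" using nm[OF s] elim by linarith
        have "((\<lambda>s. q (t ^ m, s) - b 0 * s) has_real_derivative b (t ^ m, s) - b 0 * 1) (at s)"
          by (intro DERIV_diff pb DERIV_cmult DERIV_ident e(2)) (use ns in simp)
        then show "((\<lambda>s. q (t ^ m, s) - b 0 * s) has_real_derivative b (t ^ m, s) - b 0) (at s within ?S)"
          using has_field_derivative_at_within by simp
        have "norm (b (t ^ m, s) - b 0) \<le> L * norm ((t ^ m, s) - 0)" by (rule L(3)) (use ns L(2) in auto)
        also have "\<dots> \<le> L * (\<bar>t ^ m\<bar> + \<bar>y1 t\<bar>)" using nm[OF s] L(1) by (intro mult_left_mono) auto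
        finally show "norm (b (t ^ m, s) - b 0) \<le> L * (\<bar>t ^ m\<bar> + \<bar>y1 t\<bar>)" .
      qed auto
      then show ?case by (simp add: abs_mult mult.assoc)
    qed
    have a: "ord_ge N (\<lambda>t. \<bar>f t\<bar>)" if "ord_ge N f" for N f using that by (simp add: ord_ge_def)
    have "ord_ge (1 + n) (\<lambda>t. (\<bar>t ^ m\<bar> + \<bar>y1 t\<bar>) * y1 t)"
      by (intro ord_ge_mult ord_ge_add a on ord_ge_monom ord_ge_mono[OF on]) (use m in auto)
    then show "ord_ge (Suc n) (\<lambda>t. (\<bar>t ^ m\<bar> + \<bar>y1 t\<bar>) * y1 t)" by simp
  qed
  have hc: "isCont h 0" using sh smooth_germ_isCont by blast
  have h1: "ord_ge 1 h" using ord_ge_iff_co[OF sh(1), of 1] sh(2) by (simp add: co_0)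
  have "ord_ge (1 * Suc n) (\<lambda>t. y2 (h t))" by (rule ord_ge_compose[OF y2 h1 hc sh(2)])
  then have y2h: "ord_ge (Suc n) (\<lambda>t. y2 (h t))" by simp
  have "\<forall>\<^sub>F t in nhds 0. y2 (h t) = q (t ^ m, y1 t)"
    using eq by eventually_elim (metis q_def snd_conv)
  from ord_ge_cong[OF this y2h] have qo: "ord_ge (Suc n) (\<lambda>t. q (t ^ m, y1 t))" .
  define P where "P x = q (x, 0)" for x :: real
  have sx0: "smooth_germ (\<lambda>x::real. (x, 0::real))" by (intro smooth_germ_intros)
  have sP: "smooth_germ P" unfolding P_def
    by (rule smooth_germ_compose[OF sx0 _ sq]) (simp add: zero_prod_def)
  have sPt: "smooth_germ (\<lambda>t. P (t ^ m))"
    by (rule smooth_germ_compose[OF _ _ sP]) (use m in \<open>auto intro!: smooth_germ_intros simp: zero_power\<close>)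
  have sb0: "smooth_germ (\<lambda>t. b 0 * y1 t)" by (intro smooth_germ_intros y1)
  have "ord_ge (Suc n) (\<lambda>t. q (t ^ m, y1 t) - (q (t ^ m, y1 t) - q (t ^ m, 0) - b 0 * y1 t))"
    by (rule ord_ge_diff[OF qo dom])
  then have "ord_ge (Suc n) (\<lambda>t. P (t ^ m) + b 0 * y1 t)" by (simp add: P_def)
  then have z: "co (\<lambda>t. P (t ^ m)) i + b 0 * co y1 i = 0" if "i \<le> n" for i
    using ord_ge_iff_co[OF smooth_germ_add[OF sPt sb0]] that
    by (simp add: co_add[OF sPt sb0] co_cmult[OF y1(1)])
  have cP: "co (\<lambda>t. P (t ^ m)) i = (if m dvd i then co P (i div m) else 0)" for i
    using co_monom_comp[OF sP m(1), of 0 i] by simp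
  \<comment> \<open>The series in \<open>t ^ m\<close> has no term \<open>t ^ n\<close>, since
    \<open>m\<close> does not divide \<open>n\<close>; what remains is
    \<open>b 0 * c = 0\<close>.\<close>
  have b0: "b 0 = 0" using z[of n] m cP[of n] co1(2) y1(3) by simp
  have dP: "deriv P 0 = 0" using z[of m] cP[of m] b0 m co_1[of P] by simp
  have D: "(q has_derivative frechet_derivative q (at 0)) (at 0)" by (rule smooth_on_has_derivative[OF U(3,2)])
  have "((\<lambda>x::real. (x, 0::real)) has_derivative (\<lambda>v. (v, 0))) (at 0)"
    by (intro has_derivative_Pair has_derivative_const has_derivative_ident)
  from has_derivative_compose[OF this, of q "frechet_derivative q (at 0)"] D
  have "(P has_derivative (\<lambda>v. frechet_derivative q (at 0) (v, 0))) (at 0)" by (simp add: P_def[abs_def] zero_prod_def)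
  moreover have "(P has_derivative (\<lambda>v. 0)) (at 0)"
    using smooth_germ_deriv(3)[OF sP] unfolding dP has_field_derivative_def mult_zero_left .
  ultimately have "(\<lambda>v. frechet_derivative q (at 0) (v, 0)) = (\<lambda>v. 0)" by (rule has_derivative_unique)
  then have D1: "frechet_derivative q (at 0) (1, 0) = 0" by (rule fun_cong)
  have D2: "frechet_derivative q (at 0) (0, 1) = 0" using b0 by (simp add: b_def)
  have D0: "frechet_derivative q (at 0) v = 0" for v
  proof -
    have l: "linear (frechet_derivative q (at 0))" using has_derivative_linear[OF D] .
    have "v = fst v *\<^sub>R (1,0) + snd v *\<^sub>R (0,1)" by (cases v) auto
    then have "frechet_derivative q (at 0) v = fst v *\<^sub>R frechet_derivative q (at 0) (1,0) + snd v *\<^sub>R frechet_derivative q (at 0) (0,1)"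
      using linear_add[OF l] linear_scale[OF l] by metis
    then show ?thesis by (simp add: D1 D2)
  qed
  obtain r where r: "diffeo_germ r" "\<forall>\<^sub>F z in nhds 0. p (r z) = z" using diffeo_germ_inverse[OF p] by blast
  obtain V where V: "open V" "0 \<in> V" "smooth_on V r" using diffeo_germ_smooth(1)[OF r(1)] smooth_germ_def by blast
  have "(q has_derivative (\<lambda>v. 0)) (at (r 0))" 
  proof -
    have "frechet_derivative q (at 0) = (\<lambda>v. 0)" using D0 by (rule ext)
    then show ?thesis using D diffeo_germ_smooth(2)[OF r(1)] by simp
  qed
  from has_derivative_compose[OF smooth_on_has_derivative[OF V(3,2)] this]
  have 1: "((\<lambda>z. q (r z)) has_derivative (\<lambda>v. 0)) (at 0)" .
  obtain W where W: "open W" "0 \<in> W" "\<And>z. z \<in> W \<Longrightarrow> p (r z) = z" using r(2) by (auto simp: eventually_nhds)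
  \<comment> \<open>Near 0 the projection \<open>snd\<close> is \<open>q\<close> composed with the
    inverse germ \<open>r\<close>, so it would inherit the zero derivative.\<close>
  have "(snd has_derivative (\<lambda>v. 0)) (at (0 :: real \<times> real))"
    by (rule has_derivative_transform_within_open[OF 1 W(1,2)]) (simp add: q_def W(3))
  moreover have "(snd has_derivative snd) (at (0 :: real \<times> real))"
    by (rule bounded_linear_imp_has_derivative[OF bounded_linear_snd])
  ultimately have "(\<lambda>v :: real \<times> real. 0) = (snd :: real \<times> real \<Rightarrow> real)" by (rule has_derivative_unique)
  then have "(0::real) = snd (0::real, 1::real)" by (rule fun_cong)
  then show False by simp
qed

lemma co_reflect:
  assumes "smooth_germ f" shows "co (\<lambda>t. f (- t)) i = (- 1) ^ i * co f i"
proof (rule co_unique[where N = "Suc i" and a = "\<lambda>i. (- 1) ^ i * co f i"])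
  have s: "smooth_germ (\<lambda>t::real. - t)" by (intro smooth_germ_intros)
  show "smooth_germ (\<lambda>t. f (- t))" by (rule smooth_germ_compose[OF s _ assms]) simp
  have "ord_ge (1 * Suc i) (\<lambda>t. f (- t) - (\<Sum>i<Suc i. co f i * (- t) ^ i))"
    by (rule ord_ge_compose[OF taylor_ord_ge[OF assms] ord_ge_minus[OF ord_ge_id] smooth_germ_isCont[OF s]]) simp
  moreover have "co f i * (- t) ^ i = (- 1) ^ i * co f i * t ^ i" for t i by (simp add: power_minus[of t] mult_ac)
  ultimately show "ord_ge (Suc i) (\<lambda>t. f (- t) - (\<Sum>i<Suc i. (- 1) ^ i * co f i * t ^ i))" by (simp only: mult_1)
qed simp

text \<open>Factor \<open>a^4 - b^4 = (a - b) (a^3 + a^2 b + a b^2 + b^3)\<close>. After division by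
  powers of \<open>t\<close> the second factor is \<open>4 B(0)^3\<close> at 0, so it costs exactly
  three orders. Equal derivatives at 0 exclude the other real branch \<open>a = - b\<close>.\<close>

lemma fourth_power_cancel:
  assumes a: "smooth_germ a" "a 0 = 0" and b: "smooth_germ b" "b 0 = 0"
    and l: "deriv a 0 = deriv b 0" "deriv b 0 \<noteq> 0" and N: "N \<ge> 3"
    and o: "ord_ge (Suc N) (\<lambda>t. a t ^ 4 - b t ^ 4)"
  shows "ord_ge (N - 2) (\<lambda>t. a t - b t)"
proof -
  have c0: "co a i = 0" "co b i = 0" if "i < 1" for i using that a b by (simp_all add: co_0)
  obtain A where A: "smooth_germ A" "\<And>i. co A i = co a (1 + i)" "\<forall>\<^sub>F t in nhds 0. a t = t ^ 1 * A t"
    using hadamard[OF a(1) c0(1)] by blast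
  obtain B where B: "smooth_germ B" "\<And>i. co B i = co b (1 + i)" "\<forall>\<^sub>F t in nhds 0. b t = t ^ 1 * B t"
    using hadamard[OF b(1) c0(2)] by blast
  have AB: "A 0 = B 0" "B 0 \<noteq> 0" using A(2)[of 0] B(2)[of 0] l by (simp_all add: co_0 co_1)
  define S where "S t = A t ^ 3 + A t ^ 2 * B t + A t * B t ^ 2 + B t ^ 3" for t
  have sS: "smooth_germ S" unfolding S_def by (intro smooth_germ_intros A B)
  have "S 0 = 4 * B 0 ^ 3" using AB(1) by (simp add: S_def power2_eq_square power3_eq_cube)
  then have S0: "S 0 \<noteq> 0" using AB(2) by simp
  have sAB: "smooth_germ (\<lambda>t. A t - B t)" by (intro smooth_germ_diff A B)
  have "\<forall>\<^sub>F t in nhds 0. a t ^ 4 - b t ^ 4 = t ^ 4 * ((A t - B t) * S t)"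
    using A(3) B(3) by eventually_elim
      (simp add: S_def power_mult_distrib algebra_simps power2_eq_square power3_eq_cube power4_eq_xxxx)
  from ord_ge_cong[OF this o] have "ord_ge (4 + (N - 3)) (\<lambda>t. t ^ 4 * ((A t - B t) * S t))" using N by simp
  from ord_ge_cancel_monom[OF smooth_germ_mult[OF sAB sS] this]
  have "ord_ge (N - 3) (\<lambda>t. (A t - B t) * S t)" .
  from ord_ge_mult[OF this smooth_ord_ge_0[OF smooth_germ_divide[OF smooth_germ_const[of 1] sS S0]]]
  have "ord_ge (N - 3) (\<lambda>t. ((A t - B t) * S t) * (1 / S t))" by simp
  from ord_ge_mult[OF ord_ge_id this] have o1: "ord_ge (N - 2) (\<lambda>t. t * (((A t - B t) * S t) * (1 / S t)))"
    using N by (simp add: numeral_eq_Suc Suc_diff_Suc)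
  have "\<forall>\<^sub>F t in nhds 0. S t \<noteq> 0"
    by (rule eventually_nhds_compose[OF smooth_germ_isCont[OF sS]]) (use S0 t1_space_nhds[of "S 0" 0] in blast)
  with A(3) B(3) have "\<forall>\<^sub>F t in nhds 0. t * (((A t - B t) * S t) * (1 / S t)) = a t - b t"
    by eventually_elim (simp add: algebra_simps)
  then show ?thesis by (rule ord_ge_cong[OF _ o1])
qed

text \<open>The order of \<open>f(\<sigma> t) - f(t)\<close> for an orientation-reversing reparametrisation \<open>\<sigma>\<close>
  is compared with the parity of the normal form.\<close>

lemma not_A_equivalent_parity:
  assumes N: "N \<ge> 3"
    and y1: "smooth_germ y1" "ord_ge 4 y1" "ord_ge (Suc N) (\<lambda>t. y1 (- t) - y1 t - c * t ^ N)" "c \<noteq> 0"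
    and y2: "ord_ge (Suc N) (\<lambda>t. y2 (- t) - y2 t)"
  shows "\<not> A_equivalent (\<lambda>t. (t ^ 4, y1 t)) (\<lambda>t. (t ^ 4, y2 t))"
proof
  assume "A_equivalent (\<lambda>t. (t ^ 4, y1 t)) (\<lambda>t. (t ^ 4, y2 t))"
  then obtain h p where h: "diffeo_germ h" and p: "diffeo_germ p"
    and eq: "\<forall>\<^sub>F t in nhds 0. (h t ^ 4, y1 (h t)) = p (t ^ 4, y2 t)"
    and s2: "smooth_germ (\<lambda>t. (t ^ 4, y2 t))" "y2 0 = 0"
    unfolding A_equivalent_def plane_curve_germ_def by (auto simp: zero_prod_def)
  note sh = diffeo_germ_smooth[OF h]
  have sy2: "smooth_germ y2" "y2 0 = 0" using smooth_germ_snd_comp[OF s2(1)] s2(2) by auto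
  obtain L d where L: "L > 0" "d > 0" "\<And>x y. norm x < d \<Longrightarrow> norm y < d \<Longrightarrow> norm (p x - p y) \<le> L * norm (x - y)"
    using smooth_germ_Lipschitz[OF diffeo_germ_smooth(1)[OF p]] by blast
  have neg: "isCont (\<lambda>t::real. - t) 0" "- (0::real) = 0" by auto
  have cg: "isCont (\<lambda>t. norm (t ^ 4, y2 t)) 0" by (intro continuous_norm smooth_germ_isCont[OF s2(1)])
  have small: "\<forall>\<^sub>F t in nhds 0. norm (t ^ 4, y2 t) < d"
    by (rule eventually_nhds_compose[OF cg]) (use s2(2) L(2) eventually_nhds_in_open[of "{..<d}" "0::real"] in \<open>simp add: zero_prod_def\<close>)
  \<comment> \<open>\<open>t ^ 4\<close> is even, so the arguments of \<open>p\<close> at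
    \<open>t\<close> and \<open>- t\<close> differ only in the second component; the Lipschitz
    estimate passes this smallness to both components of the image.\<close>
  have bound: "\<forall>\<^sub>F t in nhds 0. norm ((h (- t) ^ 4, y1 (h (- t))) - (h t ^ 4, y1 (h t))) \<le> L * \<bar>y2 (- t) - y2 t\<bar>"
    using eq isCont_comp_0[OF neg eq] small isCont_comp_0[OF neg small]
  proof eventually_elim
    case (elim t)
    have "norm (p ((- t) ^ 4, y2 (- t)) - p (t ^ 4, y2 t)) \<le> L * norm (((- t) ^ 4, y2 (- t)) - (t ^ 4, y2 t))"
      by (rule L(3)[OF elim(4,3)])
    also have "((- t) ^ 4, y2 (- t)) - (t ^ 4, y2 t) = (0, y2 (- t) - y2 t)" by simp
    finally show ?case unfolding elim(1,2) by (simp add: norm_Pair)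
  qed
  have "\<forall>\<^sub>F t in nhds 0. \<bar>h (- t) ^ 4 - h t ^ 4\<bar> \<le> L * \<bar>y2 (- t) - y2 t\<bar>"
    using bound
  proof eventually_elim
    case (elim t)
    show ?case
      using order_trans[OF norm_fst_le elim[unfolded diff_Pair]] by simp
  qed
  from ord_ge_dominated[OF this y2] have o1: "ord_ge (Suc N) (\<lambda>t. h (- t) ^ 4 - h t ^ 4)" .
  have "\<forall>\<^sub>F t in nhds 0. \<bar>y1 (h (- t)) - y1 (h t)\<bar> \<le> L * \<bar>y2 (- t) - y2 t\<bar>"
    using bound
  proof eventually_elim
    case (elim t)
    show ?case
      using order_trans[OF norm_snd_le elim[unfolded diff_Pair]] by simp
  qed
  from ord_ge_dominated[OF this y2] have o2: "ord_ge (Suc N) (\<lambda>t. y1 (h (- t)) - y1 (h t))" .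
  have s: "smooth_germ (\<lambda>t. h (- t))" "smooth_germ (\<lambda>t. - h t)"
    by (rule smooth_germ_compose[OF _ _ sh(1)]) (auto intro!: smooth_germ_intros sh)
  have "deriv h 0 \<noteq> 0"
  proof -
    obtain g where g: "diffeo_germ g" "\<forall>\<^sub>F t in nhds 0. g (h t) = t" using diffeo_germ_inverse[OF h] by blast
    then show ?thesis using deriv_inverse_germ[OF g(1) h g(2)] by auto
  qed
  moreover have "deriv (\<lambda>t. - h t) 0 = - deriv h 0" by (rule DERIV_imp_deriv[OF DERIV_minus[OF smooth_germ_deriv(3)[OF sh(1)]]])
  moreover have "deriv (\<lambda>t. h (- t)) 0 = - deriv h 0" using co_reflect[OF sh(1), of 1] by (simp add: co_1)
  \<comment> \<open>\<open>h (- t)\<close> and \<open>- h t\<close> have equal derivatives at 0 and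
    nearly equal fourth powers: the source change almost commutes with the reflection.\<close>
  ultimately have ab: "ord_ge (N - 2) (\<lambda>t. h (- t) - (- h t))"
    by (intro fourth_power_cancel s N) (use o1 sh(2) in simp_all)
  have o: "ord_ge 1 (\<lambda>t. h (- t))" "ord_ge 1 (\<lambda>t. - h t)"
    using ord_ge_iff_co[OF s(1), of 1] ord_ge_iff_co[OF s(2), of 1] sh(2) by (auto simp: co_0)
  \<comment> \<open>The order 4 of \<open>y1\<close> contributes three orders, which makes up for
    the three lost in taking the fourth root.\<close>
  have "ord_ge ((N - 2) + 3) (\<lambda>t. y1 (h (- t)) - y1 (- h t))"
    by (rule smooth_order_diff_ord_ge[OF y1(1) _ smooth_germ_isCont[OF s(1)] o(1) _ smooth_germ_isCont[OF s(2)] o(2) _ ab])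
      (use y1(2) ord_ge_iff_co[OF y1(1)] sh(2) in auto)
  then have "ord_ge (Suc N) (\<lambda>t. y1 (h (- t)) - y1 (- h t))" by (rule ord_ge_mono) (use N in simp)
  from ord_ge_diff[OF o2 this] have "ord_ge (Suc N) (\<lambda>t. y1 (- h t) - y1 (h t))" by simp
  moreover obtain g where g: "diffeo_germ g" "\<forall>\<^sub>F t in nhds 0. h (g t) = t" using diffeo_germ_inverse[OF h] by blast
  moreover note sg = diffeo_germ_smooth[OF g(1)]
  ultimately have "ord_ge (1 * Suc N) (\<lambda>t. y1 (- h (g t)) - y1 (h (g t)))"
    using ord_ge_iff_co[OF sg(1), of 1] by (intro ord_ge_compose[of "Suc N" "\<lambda>t. y1 (- h t) - y1 (h t)" 1 g] smooth_germ_isCont) (auto simp: co_0)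
  moreover have "\<forall>\<^sub>F t in nhds 0. y1 (- h (g t)) - y1 (h (g t)) = y1 (- t) - y1 t"
    using g(2) by eventually_elim simp
  ultimately have "ord_ge (Suc N) (\<lambda>t. y1 (- t) - y1 t)" by (simp add: ord_ge_cong)
  from ord_ge_diff[OF this y1(3)] have "ord_ge (Suc N) (\<lambda>t. c * t ^ N)" by simp
  then show False using ord_ge_monom_zero y1(4) by blast
qed

section \<open>Normal forms\<close>

text \<open>The square of the maximal ideal: such a term can be added to a component of a coordinate
  change without touching its linear part.\<close>

definition critical_germ :: "(real \<times> real \<Rightarrow> real) \<Rightarrow> bool" where
  "critical_germ r \<longleftrightarrow> smooth_germ r \<and> r 0 = 0 \<and> (r has_derivative (\<lambda>v. 0)) (at 0)"

lemma smooth_germ_has_derivative: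
  "smooth_germ f \<Longrightarrow> (f has_derivative frechet_derivative f (at 0)) (at 0)"
  unfolding smooth_germ_def using smooth_on_has_derivative by blast

lemma critical_germ_mult:
  assumes "smooth_germ p" "smooth_germ r" "p 0 = 0" "r 0 = 0"
  shows "critical_germ (\<lambda>z. p z * r z)"
  unfolding critical_germ_def
  using has_derivative_mult[OF smooth_germ_has_derivative[OF assms(1)] smooth_germ_has_derivative[OF assms(2)]]
    smooth_germ_mult[OF assms(1,2)] assms by simp

lemma critical_germ_add: "critical_germ p \<Longrightarrow> critical_germ r \<Longrightarrow> critical_germ (\<lambda>z. p z + r z)"
  unfolding critical_germ_def using has_derivative_add[of p "\<lambda>v. 0" _ r "\<lambda>v. 0"] smooth_germ_add by fastforce

lemma critical_germ_smooth_mult: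
  assumes "smooth_germ k" "critical_germ r"
  shows "critical_germ (\<lambda>z. k z * r z)"
  using has_derivative_mult[OF smooth_germ_has_derivative[OF assms(1)], of r "\<lambda>v. 0"]
    smooth_germ_mult[OF assms(1), of r] assms by (simp add: critical_germ_def)

lemma critical_germ_power:
  assumes "smooth_germ p" "p 0 = 0" "k \<ge> 2"
  shows "critical_germ (\<lambda>z. p z ^ k)"
proof -
  have "critical_germ (\<lambda>z. p z * p z ^ (k - 1))"
    using assms by (intro critical_germ_mult smooth_germ_power) (auto simp: zero_power)
  moreover have "p z * p z ^ (k - 1) = p z ^ k" for z using assms(3) power_eq_if[of "p z" k] by simp
  ultimately show ?thesis by simp
qed

text \<open>The target map sends \<open>(x, y)\<close> to
  \<open>(x, a x + u x * y + r (x, y))\<close>, so every contribution to the second component that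
  is expressible through \<open>t ^ m\<close> and \<open>y0\<close> is removed at one
  stroke.\<close>

lemma A_equivalent_graph:
  assumes m: "m \<ge> 1" and y0: "smooth_germ y0" "y0 0 = 0" and a: "smooth_germ a" "a 0 = 0" and u: "smooth_germ u" "u 0 \<noteq> 0"
    and r: "critical_germ r"
    and y: "\<forall>\<^sub>F t in nhds 0. y t = a (t ^ m) + u (t ^ m) * y0 t + r (t ^ m, y0 t)"
  shows "A_equivalent (\<lambda>t. (t ^ m, y t)) (\<lambda>t. (t ^ m, y0 t))"
proof (rule A_equivalent_left)
  show "smooth_germ (\<lambda>t. (t ^ m, y0 t))" by (intro smooth_germ_intros y0)
  show "((0 :: real) ^ m, y0 0) = 0" using m y0 by (simp add: zero_prod_def zero_power)
  have "deriv (\<lambda>x::real. x) 0 \<noteq> 0" by simp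
  from fst_snd_smooth_diffeo[OF smooth_germ_id refl this a u, of r]
  show "diffeo_germ (\<lambda>z :: real \<times> real. (fst z, a (fst z) + u (fst z) * snd z + r z))"
    using r by (simp add: critical_germ_def)
  show "\<forall>\<^sub>F t in nhds 0. (t ^ m, y t) = (fst (t ^ m, y0 t), a (fst (t ^ m, y0 t)) + u (fst (t ^ m, y0 t)) * snd (t ^ m, y0 t) + r (t ^ m, y0 t))"
    using y by eventually_elim simp
qed

lemma critical_germ_0: "critical_germ (\<lambda>z. 0)"
  by (simp add: critical_germ_def smooth_germ_const)

lemma bij_betw_modI:
  assumes "finite E" "card E = m" "inj_on (\<lambda>e. e mod m) E" "m \<ge> 1"
  shows "bij_betw (\<lambda>e. e mod m) E {..<m}"
  unfolding bij_betw_def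
proof
  show "(\<lambda>e. e mod m) ` E = {..<m}"
    by (rule card_subset_eq) (use assms in \<open>auto simp: card_image\<close>)
qed fact

lemma one_le_234: "1 \<le> (2 :: nat)" "1 \<le> (3 :: nat)" "1 \<le> (4 :: nat)" by simp_all

text \<open>The exponents 0 and \<open>n\<close> represent both residues modulo 2 and there is no
  gap: \<open>y\<close> is exactly \<open>r 0 (x) + r n (x) * t ^ n\<close>.\<close>

lemma classify_mult_2:
  assumes y: "smooth_germ y" "ord_ge (Suc n) (\<lambda>t. y t - t ^ n)" and n: "odd n"
  shows "A_equivalent (\<lambda>t. (t ^ 2, y t)) (\<lambda>t. (t ^ 2, t ^ n))"
proof -
  have co: "\<And>i. i < n \<Longrightarrow> co y i = 0" "co y n = 1" using co_lead_iff[OF y(1), of n 1] y(2) by auto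
  have n0: "n > 0" using n odd_pos by blast
  have E: "bij_betw (\<lambda>e. e mod 2) {0, n} {..<2}"
    by (rule bij_betw_modI) (use n n0 in \<open>auto simp: inj_on_def mod2_eq_if\<close>)
  have z: "\<forall>k\<in>{0, n}. \<forall>i<k. i mod 2 = k mod 2 \<longrightarrow> co y i = 0" using co by auto
  obtain r where r0: "\<forall>e\<in>{0, n}. smooth_germ (r e) \<and> r e 0 = co y e"
    and r3: "\<forall>\<^sub>F t in nhds 0. y t = (\<Sum>e\<in>{0, n}. t ^ e * r e (t ^ 2))"
    by (rule residue_decomposition[OF y(1) one_le_234(1) E z])
  note r = r0[THEN bspec, THEN conjunct1] r0[THEN bspec, THEN conjunct2] r3
  show ?thesis
  proof (rule A_equivalent_graph[of 2 _ "r 0" "r n" "\<lambda>z. 0"])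
    show "\<forall>\<^sub>F t in nhds 0. y t = r 0 (t ^ 2) + r n (t ^ 2) * t ^ n + 0"
      using r(3) by eventually_elim (use n0 in \<open>simp add: mult.commute\<close>)
  qed (use r co n0 in \<open>auto intro!: smooth_germ_intros critical_germ_0 simp: zero_power\<close>)
qed

text \<open>The third class modulo 3 is that of \<open>2 n\<close>. If its coefficients below
  \<open>2 n\<close> vanish, the representatives \<open>0, n, 2 n\<close> make \<open>y\<close> a
  function of \<open>t ^ 3\<close> and \<open>t ^ n\<close>. Otherwise the least gap exponent
  \<open>e\<close> takes the place of \<open>2 n\<close>, and rescaling makes its coefficient
  \<open>c\<close>. The bound \<open>e + 6 \<le> 2 * n\<close> leaves out the gap
  \<open>2 n - 3\<close>, which can always be removed.\<close>

lemma classify_mult_3: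
  assumes y: "smooth_germ y" "ord_ge (Suc n) (\<lambda>t. y t - t ^ n)" and n: "n > 3" "\<not> 3 dvd n"
  shows "A_equivalent (\<lambda>t. (t ^ 3, y t)) (\<lambda>t. (t ^ 3, t ^ n)) \<or>
    (\<exists>e c. n < e \<and> e + 6 \<le> 2 * n \<and> e mod 3 = (2 * n) mod 3 \<and> c \<in> {1, -1} \<and> (odd (e - n) \<longrightarrow> c = 1) \<and>
      A_equivalent (\<lambda>t. (t ^ 3, y t)) (\<lambda>t. (t ^ 3, t ^ n + c * t ^ e)))"
proof -
  have co: "\<And>i. i < n \<Longrightarrow> co y i = 0" "co y n = 1" using co_lead_iff[OF y(1), of n 1] y(2) by auto
  have n3: "n mod 3 = 1 \<or> n mod 3 = 2" using n(2) by presburger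
  show ?thesis
  proof (cases "\<exists>e. n < e \<and> e + 6 \<le> 2 * n \<and> e mod 3 = (2 * n) mod 3 \<and> co y e \<noteq> 0")
    case True
    define P where "P e \<longleftrightarrow> n < e \<and> e + 6 \<le> 2 * n \<and> e mod 3 = (2 * n) mod 3 \<and> co y e \<noteq> 0" for e
    define e where "e = (LEAST e. P e)"
    have "P e" unfolding e_def by (rule LeastI_ex) (use True in \<open>simp add: P_def\<close>)
    then have e: "n < e" "e + 6 \<le> 2 * n" "e mod 3 = (2 * n) mod 3" "co y e \<noteq> 0" by (auto simp: P_def)
    have least: "co y i = 0" if "n < i" "i < e" "i mod 3 = (2 * n) mod 3" for i
      using not_less_Least[of i P] that e(2) unfolding e_def[symmetric] by (auto simp: P_def)
    have m: "n mod 3 = 1 \<and> e mod 3 = 2 \<or> n mod 3 = 2 \<and> e mod 3 = 1" using n3 e(3) by presburger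
    have E: "bij_betw (\<lambda>e. e mod 3) {0, n, e} {..<3}"
    proof (rule bij_betw_modI)
      show "card {0, n, e} = 3" using n e by auto
      show "inj_on (\<lambda>e. e mod 3) {0, n, e}" using m by (auto simp: inj_on_def)
    qed auto
    have z: "co y i = 0" if "k \<in> {0, n, e}" "i < k" "i mod 3 = k mod 3" for k i
    proof -
      have "i \<noteq> n \<or> k \<noteq> e" using m that(3) by auto
      then show ?thesis using that co(1)[of i] least[of i] e(3) by (cases "i < n"; cases "i = n") auto
    qed
    have z': "\<forall>k\<in>{0, n, e}. \<forall>i<k. i mod 3 = k mod 3 \<longrightarrow> co y i = 0" using z by blast
    obtain r where r0: "\<forall>k\<in>{0, n, e}. smooth_germ (r k) \<and> r k 0 = co y k"
      and r3: "\<forall>\<^sub>F t in nhds 0. y t = (\<Sum>k\<in>{0, n, e}. t ^ k * r k (t ^ 3))"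
      by (rule residue_decomposition[OF y(1) one_le_234(2) E z'])
    note r = r0[THEN bspec, THEN conjunct1] r0[THEN bspec, THEN conjunct2] r3
    have "\<forall>\<^sub>F t in nhds 0. y t = r 0 (t ^ 3) + t ^ n * r n (t ^ 3) + t ^ e * r e (t ^ 3) + t ^ n * 0"
      using r(3) by eventually_elim (use n e in simp)
    note y_eq = this
    have pr: "smooth_germ (r 0)" "r 0 0 = 0" "smooth_germ (r n)" "r n 0 \<noteq> 0" "smooth_germ (r e)" "r e 0 \<noteq> 0"
      "1 \<le> (3::nat)" "1 \<le> n" "n < e" "n \<le> n" using r(1,2) co n e by auto
    obtain c Z where c: "c \<in> {1, -1}" "odd (e - n) \<longrightarrow> c = 1" "smooth_germ Z" "(\<forall>x::real. (0::real) = 0) \<longrightarrow> (\<forall>x. Z x = 0)"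
      "A_equivalent (\<lambda>t. (t ^ 3, y t)) (\<lambda>t. (t ^ 3, t ^ n + c * t ^ e + t ^ n * Z (t ^ 3)))"
      by (rule normalise_two_terms[OF pr(1-6) smooth_germ_const[of 0] pr(7-10) y_eq])
    then show ?thesis using e by auto
  next
    case False
    then have none: "co y e = 0" if "n < e" "e + 6 \<le> 2 * n" "e mod 3 = (2 * n) mod 3" for e
      using that by blast
    \<comment> \<open>With \<open>j = 1\<close> the exponent removed by
      \<open>eliminate_term\<close> is \<open>2 n - 3\<close>.\<close>
    have pre: "1 \<le> (3 :: nat)" "1 \<le> n" "1 \<le> (1 :: nat)" "3 < n * 1" using n by auto
    obtain Y where Y: "smooth_germ Y" "A_equivalent (\<lambda>t. (t ^ 3, y t)) (\<lambda>t. (t ^ 3, Y t))"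
      "\<And>i. i < n * 2 - 3 \<Longrightarrow> co Y i = co y i" "co Y (n * 2 - 3) = 0"
      using eliminate_term[OF y pre, unfolded one_add_one] by blast
    have coY: "\<And>i. i < n \<Longrightarrow> co Y i = 0" "co Y n = 1" using Y(3) co n by auto
    have m: "n mod 3 = 1 \<and> (2 * n) mod 3 = 2 \<or> n mod 3 = 2 \<and> (2 * n) mod 3 = 1" using n3 by presburger
    have E: "bij_betw (\<lambda>e. e mod 3) {0, n, 2 * n} {..<3}"
    proof (rule bij_betw_modI)
      show "card {0, n, 2 * n} = 3" using n by auto
      show "inj_on (\<lambda>e. e mod 3) {0, n, 2 * n}" using m by (auto simp: inj_on_def)
    qed auto
    have z: "co Y i = 0" if "k \<in> {0, n, 2 * n}" "i < k" "i mod 3 = k mod 3" for k i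
    proof (cases "i < n")
      case False
      then have k: "k = 2 * n" "i < 2 * n" "i mod 3 = (2 * n) mod 3" using that by auto
      have i: "i \<noteq> n" using k m by auto
      have "3 dvd 2 * n - i" using k(2,3) mod_eq_dvd_iff_nat[of i "2 * n" 3] by simp
      then obtain d where d: "2 * n - i = 3 * d" by (elim dvdE)
      then have "d \<ge> 1" using k(2) by (cases d) auto
      \<comment> \<open>Gaps of this class are \<open>2 n - 3 d\<close>: the case
        \<open>d = 1\<close> has just been eliminated, and larger \<open>d\<close> are covered by
        \<open>none\<close>.\<close>
      then have "i = n * 2 - 3 \<or> i + 6 \<le> 2 * n" using d by (cases "d = 1") auto
      then show ?thesis
      proof
        assume "i + 6 \<le> 2 * n"
        then show ?thesis using none[of i] Y(3)[of i] False i k by simp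
      qed (use Y(4) in simp)
    qed (use coY in auto)
    have z': "\<forall>k\<in>{0, n, 2 * n}. \<forall>i<k. i mod 3 = k mod 3 \<longrightarrow> co Y i = 0" using z by blast
    obtain r where r0: "\<forall>k\<in>{0, n, 2 * n}. smooth_germ (r k) \<and> r k 0 = co Y k"
      and r3: "\<forall>\<^sub>F t in nhds 0. Y t = (\<Sum>k\<in>{0, n, 2 * n}. t ^ k * r k (t ^ 3))"
      by (rule residue_decomposition[OF Y(1) one_le_234(2) E z'])
    note r = r0[THEN bspec, THEN conjunct1] r0[THEN bspec, THEN conjunct2] r3
    have "A_equivalent (\<lambda>t. (t ^ 3, Y t)) (\<lambda>t. (t ^ 3, t ^ n))"
    proof (rule A_equivalent_graph[of 3 _ "r 0" "r n" "\<lambda>z. r (2 * n) (fst z) * snd z ^ 2"])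
      show "\<forall>\<^sub>F t in nhds 0. Y t = r 0 (t ^ 3) + r n (t ^ 3) * t ^ n + r (2 * n) (fst (t ^ 3, t ^ n)) * snd (t ^ 3, t ^ n) ^ 2"
        using r(3) by eventually_elim (use n in \<open>simp add: mult.commute power_mult[symmetric]\<close>)
    qed (use r coY n in \<open>auto intro!: smooth_germ_intros critical_germ_smooth_mult critical_germ_power smooth_germ_of_fst simp: zero_power\<close>)
    then show ?thesis using A_equivalent_trans[OF Y(2)] by blast
  qed
qed

text \<open>The classes modulo 4 are those of \<open>0, n, 2 n, 3 n\<close>. The only gap of
  \<open>2 n\<close> above \<open>n\<close> is \<open>2 n - 4\<close>, removed first. In the class
  of \<open>3 n\<close> the gap \<open>3 n - 4\<close> is removable, which leaves
  \<open>e = 7\<close> for \<open>n = 5\<close> and \<open>e = 9\<close> or \<open>13\<close> for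
  \<open>n = 7\<close>; there \<open>e - n\<close> is even, so both signs occur.\<close>

lemma classify_mult_4:
  assumes y: "smooth_germ y" "ord_ge (Suc n) (\<lambda>t. y t - t ^ n)" and n: "4 < n" "n < 8" "odd n"
  shows "A_equivalent (\<lambda>t. (t ^ 4, y t)) (\<lambda>t. (t ^ 4, t ^ n)) \<or>
    (\<exists>e c. n < e \<and> e + 8 \<le> 3 * n \<and> e mod 4 = (3 * n) mod 4 \<and> c \<in> {1, -1} \<and>
      A_equivalent (\<lambda>t. (t ^ 4, y t)) (\<lambda>t. (t ^ 4, t ^ n + c * t ^ e)))"
proof -
  have co: "\<And>i. i < n \<Longrightarrow> co y i = 0" "co y n = 1" using co_lead_iff[OF y(1), of n 1] y(2) by auto
  have pre: "1 \<le> (4 :: nat)" "1 \<le> n" "1 \<le> (1 :: nat)" "4 < n * 1" "1 \<le> (2 :: nat)" "4 < n * 2" using n by auto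
  obtain Y where Y: "smooth_germ Y" "A_equivalent (\<lambda>t. (t ^ 4, y t)) (\<lambda>t. (t ^ 4, Y t))"
    "\<And>i. i < n * 2 - 4 \<Longrightarrow> co Y i = co y i" "co Y (n * 2 - 4) = 0"
    using eliminate_term[OF y pre(1-4), unfolded one_add_one] by blast
  have coY: "\<And>i. i < n \<Longrightarrow> co Y i = 0" "co Y n = 1" using Y(3) co n by auto
  have coY2: "co Y i = 0" if "i < 2 * n" "i mod 4 = (2 * n) mod 4" for i
  proof -
    have "n = 5 \<or> n = 7" using n by presburger
    then consider "n = 5" | "n = 7" by blast
    then have "i = n * 2 - 4 \<or> i < n" using that by cases (simp, presburger)+
    then show ?thesis using Y(4) coY by auto
  qed
  show ?thesis
  proof (cases "\<exists>e. n < e \<and> e + 8 \<le> 3 * n \<and> e mod 4 = (3 * n) mod 4 \<and> co Y e \<noteq> 0")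
    case True
    define P where "P e \<longleftrightarrow> n < e \<and> e + 8 \<le> 3 * n \<and> e mod 4 = (3 * n) mod 4 \<and> co Y e \<noteq> 0" for e
    define e where "e = (LEAST e. P e)"
    have "P e" unfolding e_def by (rule LeastI_ex) (use True in \<open>simp add: P_def\<close>)
    then have e: "n < e" "e + 8 \<le> 3 * n" "e mod 4 = (3 * n) mod 4" "co Y e \<noteq> 0" by (auto simp: P_def)
    have least: "co Y i = 0" if "n < i" "i < e" "i mod 4 = (3 * n) mod 4" for i
      using not_less_Least[of i P] that e(2) unfolding e_def[symmetric] by (auto simp: P_def)
    have n57: "n = 5 \<or> n = 7" using n by presburger
    then have m: "n mod 4 = 1 \<and> e mod 4 = 3 \<or> n mod 4 = 3 \<and> e mod 4 = 1" "(2 * n) mod 4 = 2" using e(3) by auto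
    have E: "bij_betw (\<lambda>e. e mod 4) {0, n, 2 * n, e} {..<4}"
    proof (rule bij_betw_modI)
      have "e \<noteq> 2 * n" using m by auto
      then show "card {0, n, 2 * n, e} = 4" using n e by simp
      show "inj_on (\<lambda>e. e mod 4) {0, n, 2 * n, e}" using m by (auto simp: inj_on_def)
    qed auto
    have z: "co Y i = 0" if "k \<in> {0, n, 2 * n, e}" "i < k" "i mod 4 = k mod 4" for k i
    proof (cases "i < n \<or> k = 2 * n")
      case True
      then show ?thesis using coY coY2 that by auto
    next
      case False
      then have "k = e" using that by auto
      then have "i \<noteq> n" using that m by auto
      then show ?thesis using least[of i] False that e(3) \<open>k = e\<close> by simp
    qed
    have z': "\<forall>k\<in>{0, n, 2 * n, e}. \<forall>i<k. i mod 4 = k mod 4 \<longrightarrow> co Y i = 0" using z by blast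
    obtain r where r0: "\<forall>k\<in>{0, n, 2 * n, e}. smooth_germ (r k) \<and> r k 0 = co Y k"
      and r3: "\<forall>\<^sub>F t in nhds 0. Y t = (\<Sum>k\<in>{0, n, 2 * n, e}. t ^ k * r k (t ^ 4))"
      by (rule residue_decomposition[OF Y(1) one_le_234(3) E z'])
    note r = r0[THEN bspec, THEN conjunct1] r0[THEN bspec, THEN conjunct2] r3
    have d: "0 \<noteq> n" "0 \<noteq> e" "n \<noteq> 2 * n" "e \<noteq> 2 * n" "e \<noteq> n" using m n e by auto
    have "\<forall>\<^sub>F t in nhds 0. Y t = r 0 (t ^ 4) + t ^ n * r n (t ^ 4) + t ^ e * r e (t ^ 4) + t ^ (2 * n) * r (2 * n) (t ^ 4)"
      using r(3) by eventually_elim (use d d[symmetric] in simp)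
    note Y_eq = this
    have pr: "smooth_germ (r 0)" "r 0 0 = 0" "smooth_germ (r n)" "r n 0 \<noteq> 0" "smooth_germ (r e)" "r e 0 \<noteq> 0"
      "smooth_germ (r (2 * n))" "1 \<le> (4::nat)" "1 \<le> n" "n < e" "n \<le> 2 * n" using r(1,2) coY n e by auto
    obtain c Z where c: "c \<in> {1, -1}" "odd (e - n) \<longrightarrow> c = 1" "smooth_germ Z" "(\<forall>x. r (2 * n) x = 0) \<longrightarrow> (\<forall>x. Z x = 0)"
      "A_equivalent (\<lambda>t. (t ^ 4, Y t)) (\<lambda>t. (t ^ 4, t ^ n + c * t ^ e + t ^ (2 * n) * Z (t ^ 4)))"
      by (rule normalise_two_terms[OF pr Y_eq])
    \<comment> \<open>With \<open>y0 = t ^ n + c * t ^ e\<close> one gets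
      \<open>y0 ^ 2 - 2 c x ^ a = t ^ (2 n) (1 + x ^ b)\<close>, because
      \<open>t ^ (n + e) = x ^ a\<close> and \<open>t ^ (2 e) = t ^ (2 n) x ^ b\<close>. So the
      remaining series at \<open>t ^ (2 n)\<close> is again a function of \<open>x\<close> and
      \<open>y0\<close>.\<close>
    define a b where "a = (n + e) div 4" and "b = (e - n) div 2"
    have ab: "n + e = 4 * a" "2 * (e - n) = 4 * b" "a \<ge> 2" "b \<ge> 1"
    proof -
      have 1: "(n + e) mod 4 = 0" using m(1) by presburger
      then show "n + e = 4 * a" unfolding a_def by presburger
      have "(n + 2) mod 4 = e mod 4" using m(1) by presburger
      then have "4 dvd e - (n + 2)" using mod_eq_dvd_iff_nat[of "n + 2" e 4] e(1) by presburger
      moreover have "e \<ge> n + 2" using e(1) m(1) by presburger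
      ultimately obtain d where "e = n + 2 + 4 * d" by (metis dvd_def le_add_diff_inverse)
      then show "2 * (e - n) = 4 * b" "b \<ge> 1" unfolding b_def by simp_all
      show "a \<ge> 2" unfolding a_def using e(1) n(1) by simp
    qed
    have cc: "c * c = 1" using c(1) by auto
    \<comment> \<open>Division by \<open>1 + x ^ b\<close> is smooth since \<open>b\<close> is at
      least 1; that \<open>a\<close> is at least 2 makes \<open>x ^ a\<close> critical.\<close>
    define K where "K x = Z x / (1 + x ^ b)" for x
    have sK: "smooth_germ K" unfolding K_def using ab(4)
      by (intro smooth_germ_intros c(3)) (simp add: zero_power)
    define R where "R z = K (fst z) * (snd z ^ 2 + (- 2 * c) * fst z ^ a)" for z :: "real \<times> real"
    have R: "critical_germ R" unfolding R_def
      by (intro critical_germ_smooth_mult critical_germ_add critical_germ_power smooth_germ_of_fst sK smooth_germ_intros) (use ab in auto)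
    have "A_equivalent (\<lambda>t. (t ^ 4, t ^ n + c * t ^ e + t ^ (2 * n) * Z (t ^ 4))) (\<lambda>t. (t ^ 4, t ^ n + c * t ^ e))"
    proof (rule A_equivalent_graph[of 4 _ "\<lambda>x. 0" "\<lambda>x. 1" R])
      have ev: "\<forall>\<^sub>F t in nhds (0::real). \<bar>t\<bar> \<le> 1/2" by (rule eventually_abs_le) simp
      show "\<forall>\<^sub>F t in nhds 0. t ^ n + c * t ^ e + t ^ (2 * n) * Z (t ^ 4) = 0 + 1 * (t ^ n + c * t ^ e) + R (t ^ 4, t ^ n + c * t ^ e)"
        using ev
      proof eventually_elim
        case (elim t)
        have p: "1 + (t ^ 4) ^ b \<noteq> 0" 
        proof -
          have "0 \<le> (t ^ 4) ^ b" by (rule zero_le_power) simp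
          then show ?thesis by linarith
        qed
        have e2: "t ^ e * t ^ e = t ^ (2 * n) * (t ^ 4) ^ b"
        proof -
          have "e + e = 2 * n + 4 * b" using ab(2) e(1) by simp
          then show ?thesis by (metis power_add power_mult)
        qed
        have ne: "t ^ n * t ^ e = (t ^ 4) ^ a" using ab(1) by (metis power_add power_mult)
        have "(t ^ n + c * t ^ e) ^ 2 + (- 2 * c) * (t ^ 4) ^ a = t ^ n * t ^ n + (c * c) * (t ^ e * t ^ e)"
          unfolding ne[symmetric] by (simp add: power2_eq_square algebra_simps)
        also have "\<dots> = t ^ (2 * n) * (1 + (t ^ 4) ^ b)"
          unfolding cc e2 by (simp only: mult_2 power_add distrib_left mult_1_left mult_1_right)
        finally show ?case using p by (simp add: R_def K_def)
      qed
    qed (use n e R in \<open>auto intro!: smooth_germ_intros simp: zero_power\<close>)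
    from A_equivalent_trans[OF A_equivalent_trans[OF Y(2) c(5)] this]
    show ?thesis using e c(1) by blast
  next
    case False
    then have none: "co Y e = 0" if "n < e" "e + 8 \<le> 3 * n" "e mod 4 = (3 * n) mod 4" for e
      using that by blast
    have lead: "ord_ge (Suc n) (\<lambda>t. Y t - t ^ n)" using co_lead_iff[OF Y(1), of n 1] coY by simp
    have three: "2 + 1 = (3 :: nat)" by simp
    \<comment> \<open>The same elimination with \<open>j = 2\<close> clears
      \<open>t ^ (3 n - 4)\<close> and leaves lower coefficients alone, in particular those already
      cleared in the class of \<open>2 n\<close>.\<close>
    obtain V where V: "smooth_germ V" "A_equivalent (\<lambda>t. (t ^ 4, Y t)) (\<lambda>t. (t ^ 4, V t))"
      "\<And>i. i < n * 3 - 4 \<Longrightarrow> co V i = co Y i" "co V (n * 3 - 4) = 0"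
      using eliminate_term[OF Y(1) lead pre(1,2,5,6), unfolded three] by blast
    have coV: "\<And>i. i < n \<Longrightarrow> co V i = 0" "co V n = 1" using V(3) coY n by auto
    have m: "n mod 4 = 1 \<and> (3 * n) mod 4 = 3 \<or> n mod 4 = 3 \<and> (3 * n) mod 4 = 1" "(2 * n) mod 4 = 2" using n(3) by presburger+
    have E: "bij_betw (\<lambda>e. e mod 4) {0, n, 2 * n, 3 * n} {..<4}"
    proof (rule bij_betw_modI)
      show "card {0, n, 2 * n, 3 * n} = 4" using n by auto
      show "inj_on (\<lambda>e. e mod 4) {0, n, 2 * n, 3 * n}" using m by (auto simp: inj_on_def)
    qed auto
    have z: "co V i = 0" if "k \<in> {0, n, 2 * n, 3 * n}" "i < k" "i mod 4 = k mod 4" for k i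
    proof (cases "i < n")
      case True
      then show ?thesis using coV by auto
    next
      case iF: False
      then have "k = 2 * n \<or> k = 3 * n" using that by auto
      then consider "k = 2 * n" | "k = 3 * n" by blast
      then show ?thesis
      proof cases
        case 1
        then show ?thesis using coY2[of i] V(3)[of i] that n by auto
      next
        case 2
        have "4 dvd 3 * n - i" using that 2 mod_eq_dvd_iff_nat[of i "3 * n" 4] by simp
        then obtain d where d: "3 * n - i = 4 * d" by (elim dvdE)
        then have "d \<ge> 1" using that 2 by (cases d) auto
        then have "i = n * 3 - 4 \<or> i + 8 \<le> 3 * n" using d by (cases "d = 1") auto
        moreover have "i \<noteq> n" using that m 2 by auto
        ultimately show ?thesis using none[of i] V(3)[of i] V(4) iF that 2 by auto
      qed
    qed
    have z': "\<forall>k\<in>{0, n, 2 * n, 3 * n}. \<forall>i<k. i mod 4 = k mod 4 \<longrightarrow> co V i = 0" using z by blast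
    obtain r where r0: "\<forall>k\<in>{0, n, 2 * n, 3 * n}. smooth_germ (r k) \<and> r k 0 = co V k"
      and r3: "\<forall>\<^sub>F t in nhds 0. V t = (\<Sum>k\<in>{0, n, 2 * n, 3 * n}. t ^ k * r k (t ^ 4))"
      by (rule residue_decomposition[OF V(1) one_le_234(3) E z'])
    note r = r0[THEN bspec, THEN conjunct1] r0[THEN bspec, THEN conjunct2] r3
    have pr: "smooth_germ (r 0)" "r 0 0 = 0" "smooth_germ (r n)" "r n 0 \<noteq> 0" "smooth_germ (r (2 * n))" "smooth_germ (r (3 * n))"
      using r(1,2) coV n by auto
    have R: "critical_germ (\<lambda>z. r (2 * n) (fst z) * snd z ^ 2 + r (3 * n) (fst z) * snd z ^ 3)"
      by (intro critical_germ_add critical_germ_smooth_mult critical_germ_power smooth_germ_of_fst pr smooth_germ_snd) auto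
    have sn: "smooth_germ (\<lambda>t::real. t ^ n)" "(0::real) ^ n = 0" using n by (auto intro!: smooth_germ_intros)
    have eq: "\<forall>\<^sub>F t in nhds 0. V t = r 0 (t ^ 4) + r n (t ^ 4) * t ^ n
          + (r (2 * n) (fst (t ^ 4, t ^ n)) * snd (t ^ 4, t ^ n) ^ 2 + r (3 * n) (fst (t ^ 4, t ^ n)) * snd (t ^ 4, t ^ n) ^ 3)"
      using r3
    proof eventually_elim
      case (elim t)
      have pw: "(t ^ n) ^ 2 = t ^ (2 * n)" "(t ^ n) ^ 3 = t ^ (3 * n)" by (simp_all only: power_mult[symmetric] mult.commute)
      have "V t = t ^ 0 * r 0 (t ^ 4) + (t ^ n * r n (t ^ 4) + (t ^ (2 * n) * r (2 * n) (t ^ 4) + t ^ (3 * n) * r (3 * n) (t ^ 4)))"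
        using elim n by simp
      then show ?case unfolding fst_conv snd_conv pw by (simp only: mult.commute power_0 mult_1_right add.assoc)
    qed
    have "A_equivalent (\<lambda>t. (t ^ 4, V t)) (\<lambda>t. (t ^ 4, t ^ n))"
      by (rule A_equivalent_graph[OF one_le_234(3) sn pr(1-4) R eq])
    then show ?thesis using A_equivalent_trans[OF A_equivalent_trans[OF Y(2) V(2)]] by blast
  qed
qed

section \<open>The normal form with leading exponents 4 and 6\<close>

lemma co_monom: "co (\<lambda>t. t ^ k) i = (if i = k then 1 else 0)"
proof (rule co_unique[where N = "Suc (i + k)" and a = "\<lambda>i. if i = k then 1 else 0"])
  show "smooth_germ (\<lambda>t::real. t ^ k)" by (intro smooth_germ_intros)
  have "(\<Sum>i<Suc (i + k). (if i = k then 1 else 0) * t ^ i) = (\<Sum>i<Suc (i + k). if i = k then t ^ k else 0)" for t :: real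
    by (rule sum.cong) auto
  then have "(\<Sum>i<Suc (i + k). (if i = k then 1 else 0) * t ^ i) = t ^ k" for t :: real by simp
  then show "ord_ge (Suc (i + k)) (\<lambda>t. t ^ k - (\<Sum>i<Suc (i + k). (if i = k then 1 else 0) * t ^ i))"
    by (simp add: ord_ge_zero)
qed simp

lemma co_eq_of_ord_ge:
  assumes "smooth_germ f" "smooth_germ g" "ord_ge N (\<lambda>t. f t - g t)" "i < N"
  shows "co f i = co g i"
  using ord_ge_iff_co[OF smooth_germ_diff[OF assms(1,2)]] assms(3,4) co_diff[OF assms(1,2)] by auto

text \<open>The representatives are 0, 6, the first odd exponent \<open>P\<close>, and an exponent
  \<open>p\<close> of the other odd class. Since \<open>P - 6\<close> is odd, rescaling makes the
  coefficient of \<open>t ^ P\<close> equal to 1. It is used with \<open>p = P + 2\<close> and,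
  after that coefficient is gone, with \<open>p = P + 6\<close>.\<close>

lemma W_sharp_reduce:
  assumes y: "smooth_germ y" "\<And>i. i < 6 \<Longrightarrow> co y i = 0" "co y 6 \<noteq> 0" and P: "odd P" "P \<ge> 7"
    and coP: "\<And>i. odd i \<Longrightarrow> i < P \<Longrightarrow> co y i = 0" "co y P \<noteq> 0"
    and p: "p mod 4 = (P + 2) mod 4" "p > P" "\<And>i. P < i \<Longrightarrow> i < p \<Longrightarrow> i mod 4 = p mod 4 \<Longrightarrow> co y i = 0"
  obtains Z where "smooth_germ Z"
    "A_equivalent (\<lambda>t. (t ^ 4, y t)) (\<lambda>t. (t ^ 4, t ^ 6 + t ^ P + t ^ p * Z (t ^ 4)))"
proof -
  have m: "P mod 4 = 1 \<and> p mod 4 = 3 \<or> P mod 4 = 3 \<and> p mod 4 = 1" using P(1) p(1) by presburger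
  have E: "bij_betw (\<lambda>e. e mod 4) {0, 6, P, p} {..<4}"
  proof (rule bij_betw_modI)
    have "p \<noteq> 6" using m by auto
    then show "card {0, 6, P, p} = 4" using P p(2) by auto
    show "inj_on (\<lambda>e. e mod 4) {0, 6, P, p}" using m by (auto simp: inj_on_def)
  qed auto
  have z: "\<forall>k\<in>{0, 6, P, p}. \<forall>i<k. i mod 4 = k mod 4 \<longrightarrow> co y i = 0"
  proof (intro ballI allI impI)
    fix k i assume k: "k \<in> {0, 6, P, p}" "i < k" "i mod 4 = k mod 4"
    show "co y i = 0"
    proof (cases "i < 6")
      case False
      then have "k = P \<or> k = p" using k by auto
      then have "odd i" using k(3) m by presburger
      show ?thesis
      proof (cases "i < P")
        case True
        then show ?thesis using coP \<open>odd i\<close> by blast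
      next
        case False
        then have "k = p" using \<open>k = P \<or> k = p\<close> k(2) by auto
        moreover have "i \<noteq> P" using k(3) m \<open>k = p\<close> by auto
        ultimately show ?thesis using p(3)[of i] k False by simp
      qed
    qed (use y(2) in blast)
  qed
  obtain r where r0: "\<forall>e\<in>{0, 6, P, p}. smooth_germ (r e) \<and> r e 0 = co y e"
    and r3: "\<forall>\<^sub>F t in nhds 0. y t = (\<Sum>e\<in>{0, 6, P, p}. t ^ e * r e (t ^ 4))"
    by (rule residue_decomposition[OF y(1) one_le_234(3) E z])
  have d: "p \<noteq> 6" "P \<noteq> 6" "P \<noteq> 0" "p \<noteq> 0" "p \<noteq> P" using m P p(2) by auto
  have eq: "\<forall>\<^sub>F t in nhds 0. y t = r 0 (t ^ 4) + t ^ 6 * r 6 (t ^ 4) + t ^ P * r P (t ^ 4) + t ^ p * r p (t ^ 4)"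
    using r3 by eventually_elim (use d d[symmetric] in simp)
  have pr: "smooth_germ (r 0)" "r 0 0 = 0" "smooth_germ (r 6)" "r 6 0 \<noteq> 0" "smooth_germ (r P)" "r P 0 \<noteq> 0"
    "smooth_germ (r p)" "1 \<le> (4::nat)" "1 \<le> (6::nat)" "6 < P" "6 \<le> p" using r0 y coP(2) P p(2) by auto
  obtain c Z where c: "c \<in> {1, -1}" "odd (P - 6) \<longrightarrow> c = 1" "smooth_germ Z" "(\<forall>x. r p x = 0) \<longrightarrow> (\<forall>x. Z x = 0)"
    "A_equivalent (\<lambda>t. (t ^ 4, y t)) (\<lambda>t. (t ^ 4, t ^ 6 + c * t ^ P + t ^ p * Z (t ^ 4)))"
    by (rule normalise_two_terms[OF pr eq])
  have "odd (P - 6)" using P by simp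
  then have "c = 1" using c(2) by blast
  then show ?thesis using that[OF c(3)] c(5) by simp
qed

text \<open>The map \<open>u \<mapsto> u / (1 + \<epsilon> u)\<close> of the parameter of the cusp \<open>(u\<^sup>2, u\<^sup>3)\<close>, where \<open>u = t\<^sup>2\<close>, is
  induced by a rational map of the plane; a suitable \<open>\<epsilon>\<close> eliminates the coefficient of \<open>t\<^bsup>P+2\<^esup>\<close>.\<close>

lemma W_sharp_eliminate:
  assumes w: "smooth_germ w" and P: "odd P" "P \<ge> 7"
  obtains Y where "smooth_germ Y"
    "A_equivalent (\<lambda>t. (t ^ 4, t ^ 6 + t ^ P + t ^ (P + 2) * w (t ^ 4))) (\<lambda>t. (t ^ 4, Y t))"
    "ord_ge (P + 3) (\<lambda>t. Y t - (t ^ 6 + t ^ P))"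
proof -
  \<comment> \<open>The solution of \<open>w 0 + P \<epsilon> / 2 + 3 \<epsilon> = 0\<close>:
    reparametrising contributes \<open>P \<epsilon> / 2\<close> to the coefficient of
    \<open>t ^ (P + 2)\<close>, and straightening the first component contributes
    \<open>3 \<epsilon>\<close>.\<close>
  define \<epsilon> where "\<epsilon> = - 2 * w 0 / (real P + 6)"
  have sw4: "smooth_germ (\<lambda>t. w (t ^ 4))"
    by (rule smooth_germ_compose[OF _ _ w]) (auto intro!: smooth_germ_intros)
  define ot where "ot t = t ^ P + t ^ (P + 2) * w (t ^ 4)" for t
  have so: "smooth_germ ot" unfolding ot_def by (intro smooth_germ_intros sw4)
  have w1: "ord_ge 1 (\<lambda>x. w x - w 0)" using taylor_ord_ge[OF w, of 1] by (simp add: co_0)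
  have "ord_ge (4 * 1) (\<lambda>t. w (t ^ 4) - w 0)"
    by (rule ord_ge_compose[OF w1 ord_ge_monom[OF order_refl]]) auto
  from ord_ge_mult[OF ord_ge_monom[OF order_refl, of "P + 2"] this]
  have "ord_ge (P + 3) (\<lambda>t. t ^ (P + 2) * (w (t ^ 4) - w 0))" by (rule ord_ge_mono) simp
  then have o1: "ord_ge (P + 3) (\<lambda>t. ot t - t ^ P - w 0 * t ^ (P + 2))" by (simp add: ot_def algebra_simps)
  have "ord_ge (Suc P) (\<lambda>t. (ot t - t ^ P - w 0 * t ^ (P + 2)) + w 0 * t ^ (P + 2))"
    by (intro ord_ge_add ord_ge_cmult ord_ge_monom ord_ge_mono[OF o1]) auto
  then have o2: "ord_ge (Suc P) (\<lambda>t. ot t - 1 * t ^ P)" by simp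
  \<comment> \<open>Chosen so that \<open>u = k t ^ 2\<close> satisfies
    \<open>t ^ 2 = u / (1 + \<epsilon> u)\<close>.\<close>
  define k where "k t = t * (1 + (- \<epsilon>) * t ^ 2) powr (- 1 / 2)" for t
  have su: "smooth_germ (\<lambda>t::real. (- \<epsilon>) * t ^ 2)" by (intro smooth_germ_intros)
  have sp: "smooth_germ (\<lambda>t. (1 + (- \<epsilon>) * t ^ 2) powr (- 1 / 2))"
    by (rule smooth_germ_compose[OF su _ powr_expand(1)]) simp
  have sk: "smooth_germ k" unfolding k_def by (intro smooth_germ_intros sp)
  have k0: "k 0 = 0" by (simp add: k_def)
  have "ord_ge (2 * 2) (\<lambda>t. (1 + (- \<epsilon>) * t ^ 2) powr (- 1 / 2) - 1 - (- 1 / 2) * ((- \<epsilon>) * t ^ 2))"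
    by (rule ord_ge_compose[OF powr_expand(2) ord_ge_cmult[OF ord_ge_monom[OF order_refl]] smooth_germ_isCont[OF su]]) simp
  from ord_ge_mult[OF ord_ge_id this]
  have "ord_ge (2 + 2) (\<lambda>t. t * ((1 + (- \<epsilon>) * t ^ 2) powr (- 1 / 2) - 1 - (- 1 / 2) * ((- \<epsilon>) * t ^ 2)))"
    by (rule ord_ge_mono) simp
  then have kexp: "ord_ge (2 + 2) (\<lambda>t. k t - t - (\<epsilon> / 2) * t ^ (2 + 1))"
    by (simp add: k_def algebra_simps power2_eq_square power3_eq_cube numeral_3_eq_3)
  have "ord_ge 2 (\<lambda>t. (k t - t - (\<epsilon> / 2) * t ^ (2 + 1)) + (\<epsilon> / 2) * t ^ (2 + 1))"
    by (intro ord_ge_add ord_ge_cmult ord_ge_monom ord_ge_mono[OF kexp]) auto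
  then have kt: "ord_ge (Suc 1) (\<lambda>t. k t - 1 * t ^ 1)" by (simp add: numeral_2_eq_2)
  then have "deriv k 0 = 1" using co_lead_iff[OF sk] by (metis One_nat_def co_1)
  then have dk: "diffeo_germ k" by (intro diffeo_germ_real sk k0) simp
  have kc: "isCont k 0" using sk smooth_germ_isCont by blast
  have ok: "ord_ge (P + 2 + 1) (\<lambda>t. ot (k t) - ot t - real P * 1 * (\<epsilon> / 2) * t ^ (P + 2))"
    by (rule smooth_shift_ord_ge[OF so o2 sk k0 kexp]) simp
  have "ord_ge (P + 3) (\<lambda>t. (ot (k t) - ot t - real P * 1 * (\<epsilon> / 2) * t ^ (P + 2)) + (ot t - t ^ P - w 0 * t ^ (P + 2)))"
    by (rule ord_ge_add[OF _ o1]) (use ok in \<open>simp add: numeral_3_eq_3\<close>)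
  then have ok2: "ord_ge (P + 3) (\<lambda>t. ot (k t) - t ^ P - (w 0 + real P * \<epsilon> / 2) * t ^ (P + 2))" by (simp add: algebra_simps)
  have "ord_ge (P + 1) (\<lambda>t. (ot (k t) - t ^ P - (w 0 + real P * \<epsilon> / 2) * t ^ (P + 2)) + (w 0 + real P * \<epsilon> / 2) * t ^ (P + 2))"
    by (intro ord_ge_add ord_ge_cmult ord_ge_monom ord_ge_mono[OF ok2]) auto
  then have ok1: "ord_ge (P + 1) (\<lambda>t. ot (k t) - t ^ P)" by simp
  have "ord_ge P (\<lambda>t. (ot (k t) - t ^ P) + t ^ P)"
    by (intro ord_ge_add ord_ge_monom ord_ge_mono[OF ok1]) auto
  then have ok0: "ord_ge P (\<lambda>t. ot (k t))" by simp
  \<comment> \<open>Clearing denominators on the cusp \<open>x = u ^ 2\<close>,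
    \<open>y = u ^ 3\<close>: the square of \<open>u / (1 + \<epsilon> u)\<close> is
    \<open>u ^ 2 (1 - \<epsilon> u) ^ 2 / (1 - \<epsilon>^2 x) ^ 2\<close>, whose numerator is the
    polynomial \<open>x - 2 \<epsilon> y + \<epsilon>^2 x ^ 2\<close>. The cube gives
    \<open>B\<close> in the same way, and \<open>B'\<close> is the coefficient of \<open>y\<close>
    in that second component.\<close>
  define A where "A x = 1 / (1 - \<epsilon>\<^sup>2 * x) ^ 2" for x :: real
  define B where "B x = 1 / (1 - \<epsilon>\<^sup>2 * x) ^ 3" for x :: real
  define B' where "B' x = (1 + 3 * \<epsilon>\<^sup>2 * x) * B x" for x :: real
  have sAB: "smooth_germ A" "smooth_germ B" "smooth_germ B'" unfolding B'_def A_def B_def by (intro smooth_germ_intros; simp)+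
  have AB0: "A 0 = 1" "B 0 = 1" "B' 0 = 1" by (simp_all add: A_def B_def B'_def)
  have s4: "smooth_germ (\<lambda>t. k t ^ 4)" "k 0 ^ 4 = 0" using k0 by (auto intro!: smooth_germ_intros sk)
  have k1: "ord_ge 1 k" using ord_ge_iff_co[OF sk, of 1] k0 by (simp add: co_0)
  have k4: "ord_ge 4 (\<lambda>t. k t ^ 4)" using ord_ge_power[OF k1, of 4] by simp
  have F4: "ord_ge 4 (\<lambda>t. F (k t ^ 4) - 1)" if "smooth_germ F" "F 0 = 1" for F
  proof -
    have "ord_ge 1 (\<lambda>x. F x - 1)" using taylor_ord_ge[OF that(1), of 1] that(2) by (simp add: co_0)
    then have "ord_ge (4 * 1) (\<lambda>t. F (k t ^ 4) - 1)"
      by (rule ord_ge_compose[OF _ k4 smooth_germ_isCont[OF s4(1)] s4(2)])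
    then show ?thesis by simp
  qed
  \<comment> \<open>The image of \<open>f (k t)\<close> under the plane map \<open>(p1, p2)\<close>
    below. The cusp goes to \<open>(t ^ 4, t ^ 6)\<close>, and since both components are affine in
    \<open>y\<close>, the odd perturbation enters linearly.\<close>
  define x1 where "x1 t = t ^ 4 - 2 * \<epsilon> * (ot (k t) * A (k t ^ 4))" for t
  define y1 where "y1 t = t ^ 6 + ot (k t) * B' (k t ^ 4)" for t
  have sok: "smooth_germ (\<lambda>t. ot (k t))" by (rule smooth_germ_compose[OF sk k0 so])
  have sx1: "smooth_germ x1" unfolding x1_def by (intro smooth_germ_intros sok smooth_germ_compose[OF s4 sAB(1)])
  have sy1: "smooth_germ y1" unfolding y1_def by (intro smooth_germ_intros sok smooth_germ_compose[OF s4 sAB(3)])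
  have x1: "ord_ge (P + 1) (\<lambda>t. x1 t - t ^ 4 - (- 2 * \<epsilon>) * t ^ P)"
  proof -
    have "ord_ge (P + 1) (\<lambda>t. (- 2 * \<epsilon>) * (ot (k t) * (A (k t ^ 4) - 1) + (ot (k t) - t ^ P)))"
      by (intro ord_ge_cmult ord_ge_add ok1 ord_ge_mono[OF ord_ge_mult[OF ok0 F4[OF sAB(1) AB0(1)]]]) simp
    then show ?thesis by (simp add: x1_def algebra_simps)
  qed
  have y1: "ord_ge (P + 3) (\<lambda>t. y1 t - (t ^ 6 + t ^ P + (w 0 + real P * \<epsilon> / 2) * t ^ (P + 2)))"
  proof -
    have "ord_ge (P + 3) (\<lambda>t. ot (k t) * (B' (k t ^ 4) - 1) + (ot (k t) - t ^ P - (w 0 + real P * \<epsilon> / 2) * t ^ (P + 2)))"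
      by (intro ord_ge_add ok2 ord_ge_mono[OF ord_ge_mult[OF ok0 F4[OF sAB(3) AB0(3)]]]) simp
    then show ?thesis by (simp add: y1_def algebra_simps)
  qed
  have "ord_ge 7 (\<lambda>t. (y1 t - (t ^ 6 + t ^ P + (w 0 + real P * \<epsilon> / 2) * t ^ (P + 2))) + (t ^ P + (w 0 + real P * \<epsilon> / 2) * t ^ (P + 2)))"
    using P(2) by (intro ord_ge_add ord_ge_cmult ord_ge_monom ord_ge_mono[OF y1]) auto
  then have y1l: "ord_ge (Suc 6) (\<lambda>t. y1 t - 1 * t ^ 6)" by simp
  have y10: "y1 0 = 0" using k0 P by (simp add: y1_def ot_def zero_power)
  \<comment> \<open>The first component is perturbed by \<open>- 2 \<epsilon> t ^ P\<close>, so
    \<open>d = P - 4\<close> and the affected exponent is \<open>6 + d = P + 2\<close>.\<close>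
  have P4: "4 + (P - 4) = P" "1 \<le> P - 4" "6 + (P - 4) = P + 2" using P(2) by auto
  have x1': "ord_ge (4 + (P - 4) + 1) (\<lambda>t. x1 t - t ^ 4 - (- 2 * \<epsilon>) * t ^ (4 + (P - 4)))" unfolding P4(1) by (rule x1)
  obtain Y where Y: "smooth_germ Y" "Y 0 = 0" "A_equivalent (\<lambda>t. (x1 t, y1 t)) (\<lambda>t. (t ^ 4, Y t))"
    "ord_ge (6 + (P - 4) + 1) (\<lambda>t. Y t - y1 t + real 6 * 1 * ((- 2 * \<epsilon>) / real 4) * t ^ (6 + (P - 4)))"
    by (rule straighten[OF sx1 x1' sy1 y10 y1l one_le_234(3) P4(2)])
  have Y4: "ord_ge (P + 3) (\<lambda>t. Y t - y1 t + (- 3 * \<epsilon>) * t ^ (P + 2))"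
    using Y(4) unfolding P4(3) by (simp add: numeral_3_eq_3)
  have \<epsilon>: "w 0 + real P * \<epsilon> / 2 + 3 * \<epsilon> = 0"
  proof -
    have "real P + 6 \<noteq> 0" by linarith
    then show ?thesis by (simp add: \<epsilon>_def field_simps)
  qed
  have YP: "ord_ge (P + 3) (\<lambda>t. Y t - (t ^ 6 + t ^ P))"
  proof -
    have e: "3 * \<epsilon> = - (w 0 + real P * \<epsilon> / 2)" using \<epsilon> by linarith
    have "(\<lambda>t. Y t - (t ^ 6 + t ^ P)) = (\<lambda>t. (Y t - y1 t + (- 3 * \<epsilon>) * t ^ (P + 2))
        + (y1 t - (t ^ 6 + t ^ P + (w 0 + real P * \<epsilon> / 2) * t ^ (P + 2))))"
    proof
      fix t
      have w0: "w 0 = - 3 * \<epsilon> - real P * \<epsilon> / 2" using e by linarith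
      show "Y t - (t ^ 6 + t ^ P) = (Y t - y1 t + (- 3 * \<epsilon>) * t ^ (P + 2))
          + (y1 t - (t ^ 6 + t ^ P + (w 0 + real P * \<epsilon> / 2) * t ^ (P + 2)))"
        unfolding w0 by (simp add: algebra_simps)
    qed
    then show ?thesis using ord_ge_add[OF Y4 y1] by (simp only:)
  qed
  define p1 where "p1 z = A (fst z) * (fst z + (- 2 * \<epsilon>) * snd z + \<epsilon>\<^sup>2 * fst z ^ 2)" for z :: "real \<times> real"
  define p2 where "p2 z = B (fst z) * (snd z + (- 3 * \<epsilon>) * fst z ^ 2 + 3 * \<epsilon>\<^sup>2 * fst z * snd z + (- (\<epsilon> ^ 3)) * fst z ^ 3)" for z :: "real \<times> real"
  have diffeo: "diffeo_germ (\<lambda>z. (p1 z, p2 z))"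
  proof (rule diffeo_germ_plane)
    show "smooth_germ (\<lambda>z. (p1 z, p2 z))" unfolding p1_def p2_def
      by (intro smooth_germ_intros smooth_germ_of_fst sAB)
    show "(p1 0, p2 0) = 0" by (simp add: p1_def p2_def zero_prod_def)
    have q1: "((\<lambda>z :: real \<times> real. fst z + (- 2 * \<epsilon>) * snd z + \<epsilon>\<^sup>2 * fst z ^ 2) has_derivative
        (\<lambda>v. fst v + (- 2 * \<epsilon>) * snd v)) (at 0)"
      by (rule derivative_eq_intros refl | simp)+
    have q2: "((\<lambda>z :: real \<times> real. snd z + (- 3 * \<epsilon>) * fst z ^ 2 + 3 * \<epsilon>\<^sup>2 * fst z * snd z + (- (\<epsilon> ^ 3)) * fst z ^ 3) has_derivative
        (\<lambda>v. snd v)) (at 0)"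
      by (rule derivative_eq_intros refl | simp)+
    have "(p1 has_derivative (\<lambda>v. fst v + (- 2 * \<epsilon>) * snd v)) (at 0)"
      using has_derivative_mult[OF smooth_germ_fst_deriv[OF sAB(1)] q1] AB0 by (simp add: p1_def[abs_def])
    moreover have "(p2 has_derivative (\<lambda>v. snd v)) (at 0)"
      using has_derivative_mult[OF smooth_germ_fst_deriv[OF sAB(2)] q2] AB0 by (simp add: p2_def[abs_def])
    ultimately have "((\<lambda>z. (p1 z, p2 z)) has_derivative (\<lambda>v. (fst v + (- 2 * \<epsilon>) * snd v, snd v))) (at 0)"
      by (rule has_derivative_Pair)
    then show "((\<lambda>z. (p1 z, p2 z)) has_derivative (\<lambda>v. (1 * fst v + (- 2 * \<epsilon>) * snd v, 0 * fst v + 1 * snd v))) (at 0)" by simp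
  qed simp
  define f where "f t = (t ^ 4, t ^ 6 + ot t)" for t :: real
  have sf: "smooth_germ f" unfolding f_def by (intro smooth_germ_intros so)
  have f0: "f 0 = 0" using P by (simp add: f_def ot_def zero_prod_def zero_power)
  have fk: "A_equivalent f (\<lambda>t. f (k t))" by (rule A_equivalent_right[OF sf f0 dk]) auto
  then have sfk: "smooth_germ (\<lambda>t. f (k t))" "f (k 0) = 0" by (auto simp: A_equivalent_def plane_curve_germ_def)
  \<comment> \<open>With \<open>s = 1 - \<epsilon> t ^ 2\<close> one has
    \<open>(1 + \<epsilon> u) s = 1\<close> and \<open>(1 - \<epsilon> u) s = 2 s - 1\<close>; the
    bound 1/2 keeps both factors nonzero.\<close>
  have pos: "\<forall>\<^sub>F t in nhds 0. - 1 / 2 < (- \<epsilon>) * t ^ 2 \<and> (- \<epsilon>) * t ^ 2 < 1 / 2"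
    by (rule eventually_nhds_compose[OF smooth_germ_isCont[OF su]])
      (use eventually_nhds_in_open[of "{-1/2<..<1/2}" "0::real"] in simp)
  have "\<forall>\<^sub>F t in nhds 0. (x1 t, y1 t) = (p1 (f (k t)), p2 (f (k t)))"
    using pos
  proof eventually_elim
    case (elim t)
    define s where "s = 1 + (- \<epsilon>) * t ^ 2"
    define u where "u = k t ^ 2"
    have s: "s > 0" "s < 2" using elim by (auto simp: s_def)
    have "(s powr (- 1 / 2)) ^ 2 = s powr (real 2 * (- 1 / 2))" using s by (intro powr_power) auto
    also have "\<dots> = inverse s" using s by (simp add: powr_minus powr_one)
    finally have "u = t ^ 2 * inverse s" by (simp add: u_def k_def s_def power_mult_distrib)
    then have us: "u * s = t ^ 2" using s by simp
    have s1: "(1 + \<epsilon> * u) * s = 1" using us by (simp add: s_def algebra_simps)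
    then have n1: "1 + \<epsilon> * u \<noteq> 0" by auto
    have "(1 - \<epsilon> * u) * s = 2 * s - 1" using s1 by (simp add: algebra_simps)
    moreover have "2 * s - 1 \<noteq> 0" using elim by (simp add: s_def)
    ultimately have n2: "1 - \<epsilon> * u \<noteq> 0" by auto
    have k46: "k t ^ 4 = u ^ 2" "k t ^ 6 = u ^ 3" by (simp_all add: u_def power_mult[symmetric])
    have D: "1 - \<epsilon>\<^sup>2 * u ^ 2 = (1 + \<epsilon> * u) * (1 - \<epsilon> * u)" by (simp add: algebra_simps power2_eq_square)
    have s': "s = 1 / (1 + \<epsilon> * u)" using s1 n1 by (simp add: field_simps)
    have t2: "t ^ 2 = u / (1 + \<epsilon> * u)" using us s' by simp
    have t4: "t ^ 4 = u ^ 2 / (1 + \<epsilon> * u) ^ 2"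
    proof -
      have "t ^ 4 = (t ^ 2) ^ 2" by (simp add: power_mult[symmetric])
      then show ?thesis by (simp add: t2 power_divide)
    qed
    have t6: "t ^ 6 = u ^ 3 / (1 + \<epsilon> * u) ^ 3"
    proof -
      have "t ^ 6 = (t ^ 2) ^ 3" by (simp add: power_mult[symmetric])
      then show ?thesis by (simp add: t2 power_divide)
    qed
    have A1: "A (u ^ 2) * (u ^ 2 + (- 2 * \<epsilon>) * u ^ 3 + \<epsilon>\<^sup>2 * (u ^ 2) ^ 2) = t ^ 4"
    proof -
      have "u ^ 2 + (- 2 * \<epsilon>) * u ^ 3 + \<epsilon>\<^sup>2 * (u ^ 2) ^ 2 = u ^ 2 * (1 - \<epsilon> * u) ^ 2"
        by (simp add: power2_eq_square power3_eq_cube algebra_simps)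
      then show ?thesis using n1 n2 unfolding A_def D t4 by (simp add: power_mult_distrib)
    qed
    have B1: "B (u ^ 2) * (u ^ 3 + (- 3 * \<epsilon>) * (u ^ 2) ^ 2 + 3 * \<epsilon>\<^sup>2 * u ^ 2 * u ^ 3 + (- (\<epsilon> ^ 3)) * (u ^ 2) ^ 3) = t ^ 6"
    proof -
      have "u ^ 3 + (- 3 * \<epsilon>) * (u ^ 2) ^ 2 + 3 * \<epsilon>\<^sup>2 * u ^ 2 * u ^ 3 + (- (\<epsilon> ^ 3)) * (u ^ 2) ^ 3 = u ^ 3 * (1 - \<epsilon> * u) ^ 3"
        by (simp add: power2_eq_square power3_eq_cube algebra_simps)
      then show ?thesis using n1 n2 unfolding B_def D t6 by (simp add: power_mult_distrib)
    qed
    define r where "r = ot (k t)"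
    have "p1 (f (k t)) = A (u ^ 2) * (u ^ 2 + (- 2 * \<epsilon>) * u ^ 3 + \<epsilon>\<^sup>2 * (u ^ 2) ^ 2) + A (u ^ 2) * ((- 2 * \<epsilon>) * r)"
      by (simp add: p1_def f_def k46 r_def algebra_simps)
    then have 1: "p1 (f (k t)) = x1 t" unfolding A1 by (simp add: x1_def k46 r_def mult_ac)
    have "p2 (f (k t)) = B (u ^ 2) * (u ^ 3 + (- 3 * \<epsilon>) * (u ^ 2) ^ 2 + 3 * \<epsilon>\<^sup>2 * u ^ 2 * u ^ 3 + (- (\<epsilon> ^ 3)) * (u ^ 2) ^ 3)
        + r * ((1 + 3 * \<epsilon>\<^sup>2 * u ^ 2) * B (u ^ 2))"
      by (simp add: p2_def f_def k46 r_def algebra_simps)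
    then have 2: "p2 (f (k t)) = y1 t" unfolding B1 by (simp add: y1_def k46 r_def B'_def)
    show ?case using 1 2 by simp
  qed
  from A_equivalent_left[OF sfk diffeo this] have "A_equivalent (\<lambda>t. (x1 t, y1 t)) (\<lambda>t. f (k t))" .
  from A_equivalent_trans[OF fk A_equivalent_trans[OF A_equivalent_sym[OF this] Y(3)]]
  have "A_equivalent f (\<lambda>t. (t ^ 4, Y t))" .
  then show ?thesis using that[OF Y(1) _ YP] by (simp add: f_def[abs_def] ot_def[abs_def] add.assoc)
qed

lemma critical_germ_diff: "critical_germ p \<Longrightarrow> critical_germ r \<Longrightarrow> critical_germ (\<lambda>z. p z - r z)"
  using critical_germ_add[of p "\<lambda>z. -1 * r z"] critical_germ_smooth_mult[OF smooth_germ_const[of "-1"], of r] by simp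

text \<open>With \<open>x = t\<^sup>4\<close>, \<open>y\<^sub>0 = t\<^sup>6 + P\<close>, \<open>P = t\<^bsup>2q+5\<^esup>\<close> one has
  \<open>\<zeta> = y\<^sub>0\<^sup>2 - x\<^sup>3 - x\<^bsup>q+1\<^esup>y\<^sub>0 = 2t\<^sup>6P - x\<^bsup>q+1\<^esup>P\<close>, and \<open>y\<^sub>0\<zeta>\<close> then expresses \<open>x\<^sup>3P\<close> by \<open>x\<close> and \<open>y\<^sub>0\<close>.\<close>

lemma W_sharp_final:
  assumes q: "q \<ge> 1" and V: "smooth_germ V" and W: "smooth_germ W" and U: "smooth_germ U"
    and VW: "\<forall>\<^sub>F x in nhds 0. V x - 1 + x ^ (q + 1) * W x / 2 = x ^ 3 * U x"
  shows "A_equivalent (\<lambda>t. (t ^ 4, t ^ 6 + t ^ (2 * q + 5) * V (t ^ 4) + t ^ (2 * q + 11) * W (t ^ 4)))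
    (\<lambda>t. (t ^ 4, t ^ 6 + t ^ (2 * q + 5)))"
proof -
  define \<zeta> where "\<zeta> z = snd z ^ 2 - fst z ^ 3 - fst z ^ (q + 1) * snd z" for z :: "real \<times> real"
  have c\<zeta>: "critical_germ \<zeta>" unfolding \<zeta>_def
    by (intro critical_germ_diff critical_germ_power critical_germ_mult smooth_germ_intros) auto
  \<comment> \<open>The factor in \<open>K (x, y0) = D x * x ^ 3 * P\<close>: the terms are
    \<open>2 x ^ 3 P\<close> and \<open>x ^ (2 q + 2) P / 2\<close>, and
    \<open>x ^ (2 q + 2) = x ^ 3 * x ^ (2 q - 1)\<close>.\<close>
  define D where "D x = 2 + x ^ (2 * q - 1) / 2" for x :: real
  have sD: "smooth_germ D" unfolding D_def by (intro smooth_germ_intros) auto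
  have D0: "D 0 \<noteq> 0" using q by (simp add: D_def zero_power)
  \<comment> \<open>The summands after \<open>snd z * \<zeta> z\<close> cancel, by
    \<open>P ^ 2 = x ^ (q + 1) t ^ 6\<close> and \<open>t ^ 12 = x ^ 3\<close>, every contribution
    that is not a multiple of \<open>x ^ 3 P\<close>.\<close>
  define K where "K z = snd z * \<zeta> z + fst z ^ (q + 1) * \<zeta> z / 2 + fst z ^ (2 * q + 2) * snd z - 2 * fst z ^ (q + 4)" for z :: "real \<times> real"
  have s\<zeta>: "smooth_germ \<zeta>" using c\<zeta> critical_germ_def by blast
  have cK: "critical_germ K"
  proof -
    have "critical_germ (\<lambda>z. snd z * \<zeta> z + (fst z ^ (q + 1) / 2) * \<zeta> z + fst z ^ (2 * q + 2) * snd z - 2 * fst z ^ (q + 4))"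
      by (intro critical_germ_diff critical_germ_add critical_germ_smooth_mult critical_germ_power c\<zeta> critical_germ_mult smooth_germ_intros) auto
    then show ?thesis by (simp add: K_def[abs_def])
  qed
  \<comment> \<open>The first summand produces \<open>t ^ 6 P W\<close> but also
    \<open>- x ^ (q + 1) P W / 2\<close>. The defect \<open>V - 1 + x ^ (q + 1) W / 2\<close> in the
    coefficient of \<open>P\<close> is divisible by \<open>x ^ 3\<close> by hypothesis, and
    \<open>K\<close> repairs it.\<close>
  define R where "R z = (W (fst z) / 2) * \<zeta> z + (U (fst z) / D (fst z)) * K z" for z
  have R: "critical_germ R" unfolding R_def
    by (intro critical_germ_add critical_germ_smooth_mult c\<zeta> cK smooth_germ_divide smooth_germ_of_fst W U sD smooth_germ_const) (use D0 in auto)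
  have sy: "smooth_germ (\<lambda>t::real. t ^ 6 + t ^ (2 * q + 5))" "(0::real) ^ 6 + 0 ^ (2 * q + 5) = 0"
    by (auto intro!: smooth_germ_intros)
  have c4: "isCont (\<lambda>t::real. t ^ 4) 0" "(0::real) ^ 4 = 0" by auto
  have "isCont D 0" using sD smooth_germ_isCont by blast
  then have "\<forall>\<^sub>F x in nhds 0. D x \<noteq> 0"
    by (rule eventually_nhds_compose) (use D0 t1_space_nhds[of "D 0" 0] in blast)
  from isCont_comp_0[OF c4 this] isCont_comp_0[OF c4 VW]
  have "\<forall>\<^sub>F t in nhds 0. t ^ 6 + t ^ (2 * q + 5) * V (t ^ 4) + t ^ (2 * q + 11) * W (t ^ 4)
      = 0 + 1 * (t ^ 6 + t ^ (2 * q + 5)) + R (t ^ 4, t ^ 6 + t ^ (2 * q + 5))"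
  proof eventually_elim
    case (elim t)
    define x P s where "x = t ^ 4" and "P = t ^ (2 * q + 5)" and "s = t ^ 6"
    define X where "X = x ^ (q + 1)"
    have ss: "s * s = x ^ 3" by (simp add: s_def x_def power_mult[symmetric] power_add[symmetric])
    have PP: "P * P = X * s"
    proof -
      have "(2 * q + 5) + (2 * q + 5) = 4 * (q + 1) + 6" by simp
      then show ?thesis unfolding P_def X_def x_def s_def by (metis power_add power_mult)
    qed
    have Q: "t ^ (2 * q + 11) = s * P"
    proof -
      have "2 * q + 11 = 6 + (2 * q + 5)" by simp
      then show ?thesis unfolding P_def s_def by (metis power_add)
    qed
    have X2: "x ^ (2 * q + 2) = X * X"
    proof -
      have "2 * q + 2 = (q + 1) + (q + 1)" by simp
      then show ?thesis unfolding X_def by (metis power_add)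
    qed
    have X4: "x ^ (q + 4) = X * x ^ 3"
    proof -
      have "q + 4 = (q + 1) + 3" by simp
      then show ?thesis unfolding X_def by (metis power_add)
    qed
    have XD: "x ^ 3 * x ^ (2 * q - 1) = X * X"
    proof -
      have "3 + (2 * q - 1) = (q + 1) + (q + 1)" using q by simp
      then show ?thesis unfolding X_def by (metis power_add)
    qed
    have z: "\<zeta> (x, s + P) = 2 * (s * P) - X * P"
    proof -
      have "\<zeta> (x, s + P) = (s * s) + 2 * (s * P) + P * P - x ^ 3 - X * (s + P)"
        by (simp add: \<zeta>_def X_def power2_eq_square algebra_simps)
      then show ?thesis unfolding ss PP by (simp add: algebra_simps)
    qed
    have k: "K (x, s + P) = D x * (x ^ 3 * P)"
    proof -
      have "K (x, s + P) = 2 * (s * s) * P + 2 * s * (P * P) - X * (s * P) - X * (P * P) + X * (2 * (s * P) - X * P) / 2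
          + X * X * (s + P) - 2 * (X * x ^ 3)"
        unfolding K_def fst_conv snd_conv z X2 X4 X_def[symmetric] by (simp add: algebra_simps)
      also have "\<dots> = 2 * (s * s) * P + 2 * X * (s * s) - 2 * (X * x ^ 3) + X * X * P / 2"
        unfolding PP by (simp add: field_simps)
      also have "\<dots> = D x * (x ^ 3 * P)"
        unfolding ss D_def XD[symmetric] by (simp add: algebra_simps)
      finally show ?thesis .
    qed
    have "R (x, s + P) = (W x / 2) * (2 * (s * P) - X * P) + U x * (x ^ 3 * P)"
      using elim(1) unfolding R_def fst_conv snd_conv z k x_def[symmetric] by simp
    also have "U x * (x ^ 3 * P) = (V x - 1 + X * W x / 2) * P"
      using elim(2) unfolding x_def[symmetric] X_def by simp
    finally have "s + P * V x + (s * P) * W x = 0 + 1 * (s + P) + R (x, s + P)" by (simp add: algebra_simps)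
    then show ?case unfolding Q x_def P_def s_def .
  qed
  from A_equivalent_graph[OF one_le_234(3) sy smooth_germ_const refl smooth_germ_const _ R this]
  show ?thesis by simp
qed

text \<open>After \<open>t ^ (P + 2)\<close> is eliminated the other odd class starts at
  \<open>P + 6\<close>, where \<open>t ^ 6 P\<close> is within reach of
  \<open>W_sharp_final\<close>. Its divisibility by \<open>x ^ 3\<close> holds outright when
  \<open>q + 1\<close> is at least 3; for \<open>q = 1\<close> a further reparametrisation arranges
  it.\<close>

lemma classify_W_sharp:
  assumes q: "q \<ge> 1" and y: "smooth_germ y" "\<And>i. i < 6 \<Longrightarrow> co y i = 0" "co y 6 \<noteq> 0"
    and odd: "\<And>i. odd i \<Longrightarrow> i < 2 * q + 5 \<Longrightarrow> co y i = 0" "co y (2 * q + 5) \<noteq> 0"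
  shows "A_equivalent (\<lambda>t. (t ^ 4, y t)) (\<lambda>t. (t ^ 4, t ^ 6 + t ^ (2 * q + 5)))"
proof -
  define P where "P = 2 * q + 5"
  have P: "odd P" "P \<ge> 7" using q by (auto simp: P_def)
  obtain w where w: "smooth_germ w"
    "A_equivalent (\<lambda>t. (t ^ 4, y t)) (\<lambda>t. (t ^ 4, t ^ 6 + t ^ P + t ^ (P + 2) * w (t ^ 4)))"
  proof (rule W_sharp_reduce[OF y P, of "P + 2"])
    show "co y i = 0" if "P < i" "i < P + 2" "i mod 4 = (P + 2) mod 4" for i
    proof -
      have "i = P + 1" using that(1,2) by simp
      then show ?thesis using that(3) by presburger
    qed
  qed (use odd in \<open>auto simp: P_def\<close>)
  obtain Y where Y: "smooth_germ Y"
    "A_equivalent (\<lambda>t. (t ^ 4, t ^ 6 + t ^ P + t ^ (P + 2) * w (t ^ 4))) (\<lambda>t. (t ^ 4, Y t))"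
    "ord_ge (P + 3) (\<lambda>t. Y t - (t ^ 6 + t ^ P))"
    using W_sharp_eliminate[OF w(1) P] by blast
  have s6: "smooth_germ (\<lambda>t::real. t ^ 6)" "smooth_germ (\<lambda>t::real. t ^ P)" by (intro smooth_germ_intros)+
  have coY: "co Y i = (if i = 6 then 1 else 0) + (if i = P then 1 else 0)" if "i < P + 3" for i
    using co_eq_of_ord_ge[OF Y(1) smooth_germ_add[OF s6] Y(3) that] by (simp add: co_add[OF s6] co_monom)
  have P6: "P \<noteq> 6" using P by auto
  obtain Z where Z: "smooth_germ Z"
    "A_equivalent (\<lambda>t. (t ^ 4, Y t)) (\<lambda>t. (t ^ 4, t ^ 6 + t ^ P + t ^ (P + 6) * Z (t ^ 4)))"
  proof (rule W_sharp_reduce[OF Y(1) _ _ P, of "P + 6"])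
    show "co Y i = 0" if "P < i" "i < P + 6" "i mod 4 = (P + 6) mod 4" for i
    proof -
      have "4 dvd P + 6 - i" using that mod_eq_dvd_iff_nat[of i "P + 6" 4] by simp
      then obtain d where d: "P + 6 - i = 4 * d" by (elim dvdE)
      then have "d = 1" using that by linarith
      then have "i = P + 2" using d by simp
      then show ?thesis using coY[of i] P by simp
    qed
    show "co Y i = 0" if "odd i" "i < P" for i using coY[of i] that by auto
    show "(P + 6) mod 4 = (P + 2) mod 4" by presburger
  qed (use coY P P6 in auto)
  \<comment> \<open>For \<open>q = 1\<close> the exponent \<open>P - 6\<close> is 1, so
    \<open>V = 1 - \<beta> x ^ 2 + ...\<close>, while \<open>x ^ 2 W / 2\<close> starts with
    \<open>Z 0 / 2 * x ^ 2\<close>; this value makes the quadratic terms cancel. Otherwise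
    \<open>g\<close> is constantly 1.\<close>
  define \<beta> where "\<beta> = (if q = 1 then Z 0 / 2 else 0)"
  define g where "g x = 1 - \<beta> * x ^ 2" for x :: real
  have sg: "smooth_germ g" "g 0 \<noteq> 0" "g 0 = 1" unfolding g_def by (auto intro!: smooth_germ_intros)
  have eq: "\<forall>\<^sub>F t in nhds 0. t ^ 6 + t ^ P + t ^ (P + 6) * Z (t ^ 4) = 0 + 1 * (t ^ 6 + t ^ P * 1 + t ^ (P + 6) * Z (t ^ 4))" by simp
  have le: "1 \<le> (6::nat)" "6 \<le> P" "6 \<le> P + 6" "(1::real) \<noteq> 0" using P by auto
  obtain \<sigma> where \<sigma>: "smooth_germ \<sigma>" "\<sigma> 0 = 0" "deriv \<sigma> 0 = g 0 ^ 4"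
    "A_equivalent (\<lambda>t. (t ^ 4, t ^ 6 + t ^ P + t ^ (P + 6) * Z (t ^ 4)))
      (\<lambda>t. (t ^ 4, t ^ 6 + t ^ P * (g (\<sigma> (t ^ 4)) ^ (P - 6) * 1) + t ^ (P + 6) * (g (\<sigma> (t ^ 4)) ^ (P + 6 - 6) * Z (\<sigma> (t ^ 4)))))"
    by (rule residue_reparametrisation[OF smooth_germ_const refl smooth_germ_const le(4) smooth_germ_const Z(1) sg(1,2) one_le_234(3) le(1-3) eq])
  define V where "V x = g (\<sigma> x) ^ (P - 6)" for x
  define W where "W x = g (\<sigma> x) ^ P * Z (\<sigma> x)" for x
  have sV: "smooth_germ V" and sW: "smooth_germ W" unfolding V_def W_def
    by (intro smooth_germ_intros smooth_germ_compose[OF \<sigma>(1,2)] sg Z)+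
  have "ord_ge 3 (\<lambda>x. V x - 1 + x ^ (q + 1) * W x / 2)"
  proof (cases "q = 1")
    case True
    have "ord_ge (Suc 1) (\<lambda>x. \<sigma> x - 1 * x ^ 1)"
      using co_lead_iff[OF \<sigma>(1), of 1 1] \<sigma>(2,3) sg(3) by (simp add: co_0 co_1)
    then have "ord_ge 2 (\<lambda>x. \<sigma> x - x)" by (simp add: numeral_2_eq_2)
    moreover have "ord_ge 1 \<sigma>" using ord_ge_iff_co[OF \<sigma>(1), of 1] \<sigma>(2) by (simp add: co_0)
    ultimately have s2: "ord_ge (2 + 1) (\<lambda>x. \<sigma> x ^ Suc 1 - x ^ Suc 1)" using power_diff_ord_ge[OF _ ord_ge_id] by blast
    have "ord_ge 1 (\<lambda>x. W x - W 0)" using taylor_ord_ge[OF sW, of 1] by (simp add: co_0)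
    from ord_ge_mult[OF ord_ge_monom[OF order_refl, of 2] this]
    have "ord_ge (2 + 1) (\<lambda>x. (- \<beta>) * (\<sigma> x ^ Suc 1 - x ^ Suc 1) + (1 / 2) * (x ^ 2 * (W x - W 0)))"
      by (intro ord_ge_add ord_ge_cmult s2)
    moreover have "(- \<beta>) * (\<sigma> x ^ Suc 1 - x ^ Suc 1) + (1 / 2) * (x ^ 2 * (W x - W 0)) = V x - 1 + x ^ (q + 1) * W x / 2" for x
      using True \<sigma>(2) sg(3) by (simp add: V_def W_def P_def g_def \<beta>_def algebra_simps power2_eq_square)
    ultimately show ?thesis by (simp add: numeral_3_eq_3)
  next
    case False
    then have "V x = 1" for x by (simp add: V_def g_def \<beta>_def)
    moreover have "ord_ge 3 (\<lambda>x. (1 / 2) * (x ^ (q + 1) * W x))"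
      using ord_ge_mono[OF ord_ge_mult[OF ord_ge_monom[OF order_refl, of "q + 1"] smooth_ord_ge_0[OF sW]], of 3] False q
      by (intro ord_ge_cmult) simp
    ultimately show ?thesis by simp
  qed
  moreover have sVW: "smooth_germ (\<lambda>x. V x - 1 + x ^ (q + 1) * W x / 2)" by (intro smooth_germ_intros sV sW) simp
  ultimately have cz: "\<And>i. i < 3 \<Longrightarrow> co (\<lambda>x. V x - 1 + x ^ (q + 1) * W x / 2) i = 0" using ord_ge_iff_co by blast
  obtain U where U: "smooth_germ U" "\<forall>\<^sub>F x in nhds 0. V x - 1 + x ^ (q + 1) * W x / 2 = x ^ 3 * U x"
    using hadamard[OF sVW cz] by blast
  have "A_equivalent (\<lambda>t. (t ^ 4, t ^ 6 + t ^ P * V (t ^ 4) + t ^ (P + 6) * W (t ^ 4))) (\<lambda>t. (t ^ 4, t ^ 6 + t ^ P))"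
    using W_sharp_final[OF q sV sW U] by (simp add: P_def add.assoc)
  then have "A_equivalent (\<lambda>t. (t ^ 4, t ^ 6 + t ^ P + t ^ (P + 6) * Z (t ^ 4))) (\<lambda>t. (t ^ 4, t ^ 6 + t ^ P))"
    using A_equivalent_trans[OF \<sigma>(4)] by (simp add: V_def W_def)
  from A_equivalent_trans[OF w(2) A_equivalent_trans[OF Y(2) A_equivalent_trans[OF Z(2) this]]]
  show ?thesis by (simp add: P_def)
qed

section \<open>The curves with prescribed curvature\<close>

lemma interval_integral_has_derivative:
  fixes f :: "real \<Rightarrow> 'a::euclidean_space"
  assumes "\<forall>\<^sub>F u in nhds 0. isCont f u"
  shows "\<forall>\<^sub>F s in nhds 0. ((\<lambda>s. LBINT u=ereal 0..ereal s. f u) has_vector_derivative f s) (at s)"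
proof -
  obtain d where d: "d > 0" "\<And>u. \<bar>u\<bar> < d \<Longrightarrow> isCont f u"
    using assms by (auto simp: eventually_nhds_metric dist_real_def)
  have "((\<lambda>s. LBINT u=ereal 0..ereal s. f u) has_vector_derivative f s) (at s)" if "\<bar>s\<bar> < d / 2" for s
  proof -
    have "continuous_on {- (d/2)..d/2} f"
      using d by (intro continuous_at_imp_continuous_on) auto
    then have "((\<lambda>s. LBINT u=ereal 0..ereal s. f u) has_vector_derivative f s) (at s within {- (d/2)..d/2})"
      by (intro interval_integral_FTC2) (use that d in auto)
    then have "((\<lambda>s. LBINT u=ereal 0..ereal s. f u) has_vector_derivative f s) (at s within {- (d/2)<..<d/2})"
      by (rule has_vector_derivative_within_subset) auto
    moreover have "at s within {- (d/2)<..<d/2} = at s" by (rule at_within_open) (use that in auto)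
    ultimately show ?thesis by (simp only:)
  qed
  then show ?thesis using d(1) by (auto simp: eventually_nhds_metric dist_real_def intro!: exI[of _ "d / 2"])
qed

lemma smooth_germ_eventually_isCont:
  assumes "smooth_germ f" shows "\<forall>\<^sub>F u in nhds 0. isCont f u"
proof -
  obtain U where U: "open U" "0 \<in> U" "smooth_on U f" using assms smooth_germ_def by blast
  then have "\<And>u. u \<in> U \<Longrightarrow> isCont f u" using smooth_on_continuous continuous_on_eq_continuous_at by blast
  then show ?thesis using U by (auto simp: eventually_nhds)
qed

lemma smooth_germ_antiderivative:
  assumes "smooth_germ (f :: real \<Rightarrow> real)"
  obtains F where "smooth_germ F" "F 0 = 0" "\<forall>\<^sub>F s in nhds 0. (F has_real_derivative f s) (at s)"
proof -
  let ?F = "\<lambda>s. LBINT u=ereal 0..ereal s. f u"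
  have d: "\<forall>\<^sub>F s in nhds 0. (?F has_real_derivative f s) (at s)"
    using interval_integral_has_derivative[OF smooth_germ_eventually_isCont[OF assms]]
    by (simp add: has_real_derivative_iff_has_vector_derivative)
  show ?thesis by (rule that[OF smooth_germ_real_I[OF d assms] _ d]) simp
qed

lemma turning_angle_smooth:
  assumes "smooth_germ \<kappa>"
  shows "smooth_germ (turning_angle \<kappa>)" "turning_angle \<kappa> 0 = 0"
    "co (turning_angle \<kappa>) (Suc i) = taylor_coeff \<kappa> i / fact (Suc i)"
proof -
  have d: "\<forall>\<^sub>F s in nhds 0. (turning_angle \<kappa> has_real_derivative \<kappa> s) (at s)"
    using interval_integral_has_derivative[OF smooth_germ_eventually_isCont[OF assms]]
    by (simp add: has_real_derivative_iff_has_vector_derivative turning_angle_def[abs_def])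
  show s: "smooth_germ (turning_angle \<kappa>)" by (rule smooth_germ_real_I[OF d assms])
  show "turning_angle \<kappa> 0 = 0" by (simp add: turning_angle_def)
  have "\<forall>\<^sub>F s in nhds 0. \<kappa> s = deriv (turning_angle \<kappa>) s" using d by eventually_elim (simp add: DERIV_imp_deriv)
  from co_cong[OF assms this, of i] have "real (Suc i) * co (turning_angle \<kappa>) (Suc i) = taylor_coeff \<kappa> i / fact i"
    by (simp only: co_deriv) (simp only: co_def)
  then show "co (turning_angle \<kappa>) (Suc i) = taylor_coeff \<kappa> i / fact (Suc i)"
    by (simp add: field_simps del: of_nat_Suc)
qed

lemma curve_components:
  assumes "smooth_germ \<kappa>"
  obtains x y where "curve_of_mult m \<kappa> = (\<lambda>t. (x t, y t))" "smooth_germ x" "smooth_germ y" "x 0 = 0" "y 0 = 0"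
    "\<forall>\<^sub>F t in nhds 0. (x has_real_derivative t ^ (m - 1) / fact (m - 1) * cos (turning_angle \<kappa> t)) (at t)"
    "\<forall>\<^sub>F t in nhds 0. (y has_real_derivative t ^ (m - 1) / fact (m - 1) * sin (turning_angle \<kappa> t)) (at t)"
proof -
  let ?\<theta> = "turning_angle \<kappa>"
  note s\<theta> = turning_angle_smooth(1)[OF assms]
  let ?g = "\<lambda>u. (u ^ (m - 1) / fact (m - 1)) *\<^sub>R unit_tangent \<kappa> u"
  have g: "?g = (\<lambda>u. (u ^ (m - 1) / fact (m - 1) * cos (?\<theta> u), u ^ (m - 1) / fact (m - 1) * sin (?\<theta> u)))"
    by (auto simp: unit_tangent_def)
  have sc: "smooth_germ (\<lambda>t. t ^ (m - 1) / fact (m - 1) * cos (?\<theta> t))" "smooth_germ (\<lambda>t. t ^ (m - 1) / fact (m - 1) * sin (?\<theta> t))"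
    by (intro smooth_germ_intros s\<theta>; simp)+
  have "smooth_germ ?g" unfolding g by (rule smooth_germ_Pair[OF sc])
  from interval_integral_has_derivative[OF smooth_germ_eventually_isCont[OF this]]
  have d: "\<forall>\<^sub>F s in nhds 0. (curve_of_mult m \<kappa> has_vector_derivative ?g s) (at s)" by (simp add: curve_of_mult_def[abs_def])
  define x y where "x t = fst (curve_of_mult m \<kappa> t)" and "y t = snd (curve_of_mult m \<kappa> t)" for t
  have dx: "\<forall>\<^sub>F t in nhds 0. (x has_real_derivative t ^ (m - 1) / fact (m - 1) * cos (?\<theta> t)) (at t)"
    using d
  proof eventually_elim
    case (elim t)
    from bounded_linear.has_vector_derivative[OF bounded_linear_fst elim]
    show ?case unfolding has_real_derivative_iff_has_vector_derivative x_def[abs_def] by (simp add: unit_tangent_def)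
  qed
  have dy: "\<forall>\<^sub>F t in nhds 0. (y has_real_derivative t ^ (m - 1) / fact (m - 1) * sin (?\<theta> t)) (at t)"
    using d
  proof eventually_elim
    case (elim t)
    from bounded_linear.has_vector_derivative[OF bounded_linear_snd elim]
    show ?case unfolding has_real_derivative_iff_has_vector_derivative y_def[abs_def] by (simp add: unit_tangent_def)
  qed
  show ?thesis
  proof (rule that)
    show "curve_of_mult m \<kappa> = (\<lambda>t. (x t, y t))" by (simp add: x_def y_def)
    show "x 0 = 0" "y 0 = 0" by (simp_all add: x_def y_def curve_of_mult_def)
    show "smooth_germ x" "smooth_germ y" using smooth_germ_real_I[OF dx sc(1)] smooth_germ_real_I[OF dy sc(2)] .
  qed (fact dx dy)+
qed

lemma sin_cos_order_2: "co (\<lambda>x. sin x - x) 0 = 0" "co (\<lambda>x. sin x - x) (Suc 0) = 0"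
  "co (\<lambda>x. cos x - 1) 0 = 0" "co (\<lambda>x. cos x - 1) (Suc 0) = 0"
proof -
  have "((\<lambda>x. sin x - x) has_real_derivative 0) (at 0)" "((\<lambda>x. cos x - 1) has_real_derivative 0) (at 0)"
    by (rule derivative_eq_intros refl | simp)+
  then show "co (\<lambda>x. sin x - x) 0 = 0" "co (\<lambda>x. sin x - x) (Suc 0) = 0"
    "co (\<lambda>x. cos x - 1) 0 = 0" "co (\<lambda>x. cos x - 1) (Suc 0) = 0"
    by (auto simp: co_0 co_1 DERIV_imp_deriv)
qed

text \<open>\<open>cos x - 1\<close> and \<open>sin x - x\<close> vanish to second order at 0, so
  \<open>smooth_order_diff_ord_ge\<close> with \<open>n = 1\<close> gains one order over
  \<open>k\<close>.\<close>

lemma sin_cos_diff_ord_ge: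
  assumes a: "smooth_germ a" "a 0 = 0" and b: "smooth_germ b" "b 0 = 0" and d: "ord_ge k (\<lambda>t. a t - b t)"
  shows "ord_ge (k + 1) (\<lambda>t. cos (a t) - cos (b t))" "ord_ge (k + 1) (\<lambda>t. sin (a t) - sin (b t) - (a t - b t))"
proof -
  have c: "isCont a 0" "isCont b 0" "ord_ge 1 a" "ord_ge 1 b"
    using smooth_germ_isCont a b ord_ge_iff_co[OF a(1), of 1] ord_ge_iff_co[OF b(1), of 1] by (auto simp: co_0)
  have s: "smooth_germ (\<lambda>x::real. cos x - 1)" "smooth_germ (\<lambda>x::real. sin x - x)" by (intro smooth_germ_intros)+
  have z: "co (\<lambda>x. cos x - 1) i = 0" "co (\<lambda>x. sin x - x) i = 0" if "i < Suc 1" for i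
    using that sin_cos_order_2 by (auto simp: less_Suc_eq)
  have "ord_ge (k + 1) (\<lambda>t. (cos (a t) - 1) - (cos (b t) - 1))"
    by (rule smooth_order_diff_ord_ge[OF s(1) _ c(1,3) a(2) c(2,4) b(2) d]) (rule z(1))
  then show "ord_ge (k + 1) (\<lambda>t. cos (a t) - cos (b t))" by simp
  have "ord_ge (k + 1) (\<lambda>t. (sin (a t) - a t) - (sin (b t) - b t))"
    by (rule smooth_order_diff_ord_ge[OF s(2) _ c(1,3) a(2) c(2,4) b(2) d]) (rule z(2))
  then show "ord_ge (k + 1) (\<lambda>t. sin (a t) - sin (b t) - (a t - b t))" by (simp add: algebra_simps)
qed

text \<open>Below index \<open>i0\<close> the angle contains only multiples of \<open>m\<close>,
  collected in \<open>P (t ^ m)\<close>. Against the weight \<open>t ^ (m - 1)\<close> any function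
  of \<open>t ^ m\<close> integrates to a function of \<open>t ^ m\<close>, so both components are
  such functions up to the contribution of \<open>e * t ^ i0\<close>. In the cosine this is pushed
  beyond order \<open>n\<close>; in the sine it yields \<open>c * t ^ n\<close>.\<close>

lemma curve_expansion:
  assumes \<kappa>: "smooth_germ \<kappa>" and m: "m \<ge> 1" and i0: "i0 \<ge> 1" "\<not> m dvd i0"
    and z: "\<And>i. i \<ge> 1 \<Longrightarrow> i < i0 \<Longrightarrow> \<not> m dvd i \<Longrightarrow> taylor_coeff \<kappa> (i - 1) = 0"
  obtains Y C where "C \<noteq> 0" "smooth_germ Y" "A_equivalent (curve_of_mult m \<kappa>) (\<lambda>t. (t ^ m, Y t))"
    "ord_ge (Suc (m + i0)) (\<lambda>t. Y t - (C * taylor_coeff \<kappa> (i0 - 1)) * t ^ (m + i0))"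
proof -
  define n where "n = m + i0"
  define \<theta> where "\<theta> = turning_angle \<kappa>"
  note s\<theta> = turning_angle_smooth[OF \<kappa>, folded \<theta>_def]
  have co\<theta>: "co \<theta> i = taylor_coeff \<kappa> (i - 1) / fact i" if "i \<ge> 1" for i using s\<theta>(3)[of "i - 1"] that by simp
  define e where "e = co \<theta> i0"
  \<comment> \<open>The coefficients beyond \<open>i0\<close> are included too, so one function
    \<open>P\<close> serves for every \<open>i0\<close>.\<close>
  obtain P where P: "smooth_germ P" "\<And>j. taylor_coeff P j = fact j * co \<theta> (m * j)"
    using borel_lemma[of "\<lambda>j. fact j * co \<theta> (m * j)"] by blast
  have coP: "co P j = co \<theta> (m * j)" for j using P(2) by (simp add: co_def[of P])
  have P0: "P 0 = 0" using coP[of 0] s\<theta>(2) by (simp add: co_0)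
  have st: "smooth_germ (\<lambda>t::real. t ^ m)" "(0::real) ^ m = 0" "isCont (\<lambda>t::real. t ^ m) 0"
    using m by (auto intro!: smooth_germ_intros)
  define b where "b t = P (t ^ m)" for t
  have sb: "smooth_germ b" "b 0 = 0"
    unfolding b_def by (rule smooth_germ_compose[OF st(1,2) P(1)]) (simp only: st(2) P0)
  have cob: "co b i = (if m dvd i then co \<theta> i else 0)" for i
    using co_monom_comp[OF P(1) m, of 0 i] m by (auto simp: b_def[abs_def] coP)
  have sd: "smooth_germ (\<lambda>t. \<theta> t - b t)" by (intro smooth_germ_diff s\<theta> sb)
  have "co (\<lambda>t. \<theta> t - b t) i = 0" if "i < i0" for i
    using that z[of i] co\<theta>[of i] m by (cases "i = 0") (auto simp: co_diff[OF s\<theta>(1) sb(1)] cob)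
  moreover have "co (\<lambda>t. \<theta> t - b t) i0 = e" using i0 by (simp add: co_diff[OF s\<theta>(1) sb(1)] cob e_def)
  ultimately have dlead: "ord_ge (Suc i0) (\<lambda>t. (\<theta> t - b t) - e * t ^ i0)" and dord: "ord_ge i0 (\<lambda>t. \<theta> t - b t)"
    using co_lead_iff[OF sd, of i0 e] ord_ge_iff_co[OF sd, of i0] by blast+
  have cosd: "ord_ge (i0 + 1) (\<lambda>t. cos (\<theta> t) - cos (b t))"
    and "ord_ge (i0 + 1) (\<lambda>t. sin (\<theta> t) - sin (b t) - (\<theta> t - b t))"
    using sin_cos_diff_ord_ge[OF s\<theta>(1,2) sb dord] by auto
  then have "ord_ge (i0 + 1) (\<lambda>t. (sin (\<theta> t) - sin (b t) - (\<theta> t - b t)) + ((\<theta> t - b t) - e * t ^ i0))"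
    using dlead by (intro ord_ge_add) auto
  then have sind: "ord_ge (i0 + 1) (\<lambda>t. sin (\<theta> t) - sin (b t) - e * t ^ i0)" by (simp add: algebra_simps)
  obtain x y where xy: "curve_of_mult m \<kappa> = (\<lambda>t. (x t, y t))" "smooth_germ x" "smooth_germ y" "x 0 = 0" "y 0 = 0"
    "\<forall>\<^sub>F t in nhds 0. (x has_real_derivative t ^ (m - 1) / fact (m - 1) * cos (\<theta> t)) (at t)"
    "\<forall>\<^sub>F t in nhds 0. (y has_real_derivative t ^ (m - 1) / fact (m - 1) * sin (\<theta> t)) (at t)"
    unfolding \<theta>_def using curve_components[OF \<kappa>] by blast
  \<comment> \<open>Substituting \<open>s = t ^ m\<close> in the integrals for \<open>m! x\<close>
    and \<open>y\<close> with \<open>P (t ^ m)\<close> in place of the angle gives \<alpha> and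
    \<beta>.\<close>
  obtain \<alpha> where \<alpha>: "smooth_germ \<alpha>" "\<alpha> 0 = 0" "\<forall>\<^sub>F s in nhds 0. (\<alpha> has_real_derivative cos (P s)) (at s)"
    using smooth_germ_antiderivative[OF smooth_germ_cos[OF P(1)]] by blast
  have "smooth_germ (\<lambda>s. sin (P s) / fact m)" by (intro smooth_germ_intros P) simp
  then obtain \<beta> where \<beta>: "smooth_germ \<beta>" "\<beta> 0 = 0" "\<forall>\<^sub>F s in nhds 0. (\<beta> has_real_derivative sin (P s) / fact m) (at s)"
    using smooth_germ_antiderivative by blast
  have fm: "fact m = real m * fact (m - 1)" using m fact_reduce[of m] by simp
  have tm: "((\<lambda>t. t ^ m) has_real_derivative real m * t ^ (m - 1)) (at t)" for t :: real using DERIV_pow[of m t] by simp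
  have "\<forall>\<^sub>F t in nhds 0. ((\<lambda>t. fact m * x t - \<alpha> (t ^ m)) has_real_derivative (real m * t ^ (m - 1)) * (cos (\<theta> t) - cos (b t))) (at t)"
    using xy(6) isCont_comp_0[OF st(3,2) \<alpha>(3)]
  proof eventually_elim
    case (elim t)
    have "((\<lambda>t. fact m * x t - \<alpha> (t ^ m)) has_real_derivative
        fact m * (t ^ (m - 1) / fact (m - 1) * cos (\<theta> t)) - cos (P (t ^ m)) * (real m * t ^ (m - 1))) (at t)"
      by (intro DERIV_diff DERIV_cmult elim(1) DERIV_chain2[OF elim(2) tm])
    then show ?case by (simp add: fm b_def algebra_simps)
  qed
  moreover have "fact m * x 0 - \<alpha> (0 ^ m) = 0" unfolding xy(4) st(2) \<alpha>(2) by simp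
  moreover have "ord_ge n (\<lambda>t. (real m * t ^ (m - 1)) * (cos (\<theta> t) - cos (b t)))"
  proof -
    have "ord_ge ((m - 1) + (i0 + 1)) (\<lambda>t. (real m * t ^ (m - 1)) * (cos (\<theta> t) - cos (b t)))"
      by (intro ord_ge_mult cosd ord_ge_cmult ord_ge_monom) simp
    then show ?thesis using m by (simp add: n_def)
  qed
  ultimately have dx: "ord_ge (Suc n) (\<lambda>t. fact m * x t - \<alpha> (t ^ m))" by (rule ord_ge_integrate)
  define c where "c = e / (fact (m - 1) * real n)"
  have n0: "real n \<noteq> 0" using m by (simp add: n_def)
  have "\<forall>\<^sub>F t in nhds 0. ((\<lambda>t. y t - \<beta> (t ^ m) - c * t ^ n) has_real_derivative
      (1 / fact (m - 1) * t ^ (m - 1)) * (sin (\<theta> t) - sin (b t) - e * t ^ i0)) (at t)"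
    using xy(7) isCont_comp_0[OF st(3,2) \<beta>(3)]
  proof eventually_elim
    case (elim t)
    have tn: "((\<lambda>t. t ^ n) has_real_derivative real n * t ^ (m - 1 + i0)) (at t)"
      using DERIV_pow[of n t] m by (simp add: n_def)
    have "((\<lambda>t. y t - \<beta> (t ^ m) - c * t ^ n) has_real_derivative
        (t ^ (m - 1) / fact (m - 1) * sin (\<theta> t)) - sin (P (t ^ m)) / fact m * (real m * t ^ (m - 1)) - c * (real n * t ^ (m - 1 + i0))) (at t)"
      by (intro DERIV_diff DERIV_cmult elim(1) DERIV_chain2[OF elim(2) tm] tn)
    moreover have "c * (real n * t ^ (m - 1 + i0)) = (1 / fact (m - 1) * t ^ (m - 1)) * (e * t ^ i0)"
      using n0 by (simp add: c_def power_add)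
    moreover have "sin (P (t ^ m)) / fact m * (real m * t ^ (m - 1)) = (1 / fact (m - 1) * t ^ (m - 1)) * sin (b t)"
      using m by (simp add: fm b_def)
    ultimately show ?case by (simp add: right_diff_distrib)
  qed
  moreover have "y 0 - \<beta> (0 ^ m) - c * 0 ^ n = 0" using n0 unfolding xy(5) st(2) \<beta>(2) by (simp add: zero_power)
  moreover have "ord_ge n (\<lambda>t. (1 / fact (m - 1) * t ^ (m - 1)) * (sin (\<theta> t) - sin (b t) - e * t ^ i0))"
  proof -
    have "ord_ge ((m - 1) + (i0 + 1)) (\<lambda>t. (1 / fact (m - 1) * t ^ (m - 1)) * (sin (\<theta> t) - sin (b t) - e * t ^ i0))"
      by (intro ord_ge_mult sind ord_ge_cmult ord_ge_monom) simp
    then show ?thesis using m by (simp add: n_def)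
  qed
  ultimately have dy: "ord_ge (Suc n) (\<lambda>t. y t - \<beta> (t ^ m) - c * t ^ n)" by (rule ord_ge_integrate)
  have "(\<alpha> has_real_derivative cos (P 0)) (at 0)" by (rule eventually_nhds_x_imp_x[OF \<alpha>(3)])
  then have d\<alpha>: "deriv \<alpha> 0 = 1" using P0 by (simp add: DERIV_imp_deriv)
  have "diffeo_germ \<alpha>" by (rule diffeo_germ_real[OF \<alpha>(1,2)]) (simp add: d\<alpha>)
  then obtain \<gamma> where \<gamma>: "diffeo_germ \<gamma>" "\<forall>\<^sub>F s in nhds 0. \<gamma> (\<alpha> s) = s" "\<forall>\<^sub>F s in nhds 0. \<alpha> (\<gamma> s) = s"
    using diffeo_germ_inverse by blast
  note s\<gamma> = diffeo_germ_smooth[OF \<gamma>(1)]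
  \<comment> \<open>Since \<open>m! x = \<alpha> (t ^ m)\<close> up to order \<open>n + 1\<close>,
    applying the inverse \<gamma> of \<alpha> gives \<open>t ^ m\<close> up to the same order;
    subtracting \<open>\<beta> (X t)\<close> is then the shear that clears the multiples of
    \<open>m\<close> below \<open>n\<close>.\<close>
  define X where "X t = \<gamma> (fact m * x t)" for t
  define Y where "Y t = y t - \<beta> (X t)" for t
  have sx: "smooth_germ (\<lambda>t. fact m * x t)" "fact m * x 0 = 0" using xy by (auto intro!: smooth_germ_intros)
  have sX: "smooth_germ X" "X 0 = 0" using smooth_germ_compose[OF sx s\<gamma>(1)] sx s\<gamma>(2) by (auto simp: X_def[abs_def])
  have sY: "smooth_germ Y" unfolding Y_def by (intro smooth_germ_diff xy smooth_germ_compose[OF sX \<beta>(1)])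
  have Y0: "Y 0 = 0" by (simp add: Y_def sX xy \<beta>)
  have s\<alpha>t: "smooth_germ (\<lambda>t. \<alpha> (t ^ m))" "\<alpha> (0 ^ m) = 0"
    by (rule smooth_germ_compose[OF st(1,2) \<alpha>(1)]) (simp only: st(2) \<alpha>(2))
  have "ord_ge (Suc n) (\<lambda>t. \<gamma> (fact m * x t) - \<gamma> (\<alpha> (t ^ m)))"
    by (rule smooth_diff_ord_ge[OF s\<gamma>(1) smooth_germ_isCont[OF sx(1)] sx(2) smooth_germ_isCont[OF s\<alpha>t(1)] s\<alpha>t(2) dx])
  moreover have "\<forall>\<^sub>F t in nhds 0. \<gamma> (fact m * x t) - \<gamma> (\<alpha> (t ^ m)) = X t - t ^ m"
    using isCont_comp_0[OF st(3,2) \<gamma>(2)] by eventually_elim (simp add: X_def)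
  ultimately have dX: "ord_ge (Suc n) (\<lambda>t. X t - t ^ m)" by (rule ord_ge_cong[rotated])
  have "ord_ge (Suc n) (\<lambda>t. \<beta> (X t) - \<beta> (t ^ m))"
    by (rule smooth_diff_ord_ge[OF \<beta>(1) smooth_germ_isCont[OF sX(1)] sX(2) st(3,2) dX])
  from ord_ge_diff[OF dy this] have dY: "ord_ge (Suc n) (\<lambda>t. Y t - c * t ^ n)" by (simp add: Y_def algebra_simps)
  have sXm: "smooth_germ (\<lambda>t. X t - t ^ m)" by (intro smooth_germ_diff sX st)
  \<comment> \<open>The deviation of \<open>X\<close> from \<open>t ^ m\<close> starts at
    \<open>n + 1 = m + (i0 + 1)\<close>, so straightening with \<open>d = i0 + 1\<close> alters the
    second component only beyond \<open>t ^ n\<close>.\<close>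
  define D where "D = co (\<lambda>t. X t - t ^ m) (Suc n)"
  have "ord_ge (Suc (Suc n)) (\<lambda>t. (X t - t ^ m) - D * t ^ Suc n)"
    using co_lead_iff[OF sXm, of "Suc n" D] ord_ge_iff_co[OF sXm, of "Suc n"] dX D_def by blast
  then have dX2: "ord_ge (m + (i0 + 1) + 1) (\<lambda>t. X t - t ^ m - D * t ^ (m + (i0 + 1)))" by (simp add: n_def)
  obtain V where V: "smooth_germ V" "V 0 = 0" "A_equivalent (\<lambda>t. (X t, Y t)) (\<lambda>t. (t ^ m, V t))"
    "ord_ge (n + (i0 + 1) + 1) (\<lambda>t. V t - Y t + real n * c * (D / real m) * t ^ (n + (i0 + 1)))"
    by (rule straighten[OF sX(1) dX2 sY Y0 dY m]) simp_all
  have "ord_ge (Suc n) (\<lambda>t. (V t - Y t + real n * c * (D / real m) * t ^ (n + (i0 + 1))) - real n * c * (D / real m) * t ^ (n + (i0 + 1)) + (Y t - c * t ^ n))"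
    by (intro ord_ge_add ord_ge_diff ord_ge_cmult ord_ge_monom dY ord_ge_mono[OF V(4)]) simp_all
  then have VC: "ord_ge (Suc n) (\<lambda>t. V t - c * t ^ n)" by (simp add: algebra_simps)
  have diffeo: "diffeo_germ (\<lambda>z :: real \<times> real. (\<alpha> (fst z) / fact m, \<beta> (fst z) + 1 * snd z + 0))"
  proof (rule fst_snd_smooth_diffeo[OF _ _ _ \<beta>(1,2) smooth_germ_const _ smooth_germ_const has_derivative_const refl])
    show "smooth_germ (\<lambda>s. \<alpha> s / fact m)" by (intro smooth_germ_intros \<alpha>) simp
    have "((\<lambda>s. \<alpha> s / fact m) has_real_derivative deriv \<alpha> 0 / fact m) (at 0)"
      by (rule DERIV_cdivide[OF smooth_germ_deriv(3)[OF \<alpha>(1)]])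
    then show "deriv (\<lambda>s. \<alpha> s / fact m) 0 \<noteq> 0" using d\<alpha> by (simp add: DERIV_imp_deriv)
  qed (simp_all add: \<alpha>)
  have "\<forall>\<^sub>F t in nhds 0. (x t, y t) = (\<alpha> (fst (X t, Y t)) / fact m, \<beta> (fst (X t, Y t)) + 1 * snd (X t, Y t) + 0)"
    using isCont_comp_0[OF smooth_germ_isCont[OF sx(1)] sx(2) \<gamma>(3)] by eventually_elim (simp add: X_def Y_def)
  from A_equivalent_left[OF _ _ diffeo this] have "A_equivalent (\<lambda>t. (x t, y t)) (\<lambda>t. (X t, Y t))"
    using smooth_germ_Pair[OF sX(1) sY] sX(2) Y0 by (simp add: zero_prod_def)
  from A_equivalent_trans[OF this V(3)] have eq: "A_equivalent (curve_of_mult m \<kappa>) (\<lambda>t. (t ^ m, V t))" by (simp add: xy(1))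
  define C where "C = 1 / (fact i0 * (fact (m - 1) * real n))"
  have "c = C * taylor_coeff \<kappa> (i0 - 1)" using co\<theta>[OF i0(1)] by (simp add: c_def e_def C_def)
  moreover have "C \<noteq> 0" using n0 by (simp add: C_def)
  ultimately show ?thesis using that[of C V] V(1) eq VC by (simp add: n_def)
qed

text \<open>Both ways to fail contradict the invariance of the leading exponent: an earlier nonzero
  coefficient of \<open>\<kappa>\<close> gives the curve the smaller exponent \<open>m + i0\<close>,
  and a vanishing \<open>taylor_coeff \<kappa> (i1 - 1)\<close> raises its order beyond
  \<open>m + i1\<close>. The left side leaves \<open>y\<close> free after its leading term, so that
  the classification of each type can be applied to it.\<close>

lemma curve_first_order_iff:
  assumes \<kappa>: "smooth_germ \<kappa>" and m: "m \<ge> 1" and i1: "i1 \<ge> 1" "\<not> m dvd i1"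
  shows "(\<exists>y. smooth_germ y \<and> ord_ge (Suc (m + i1)) (\<lambda>t. y t - t ^ (m + i1)) \<and>
      A_equivalent (curve_of_mult m \<kappa>) (\<lambda>t. (t ^ m, y t))) \<longleftrightarrow>
    (\<forall>i\<ge>1. \<not> m dvd i \<and> i < i1 \<longrightarrow> taylor_coeff \<kappa> (i - 1) = 0) \<and> taylor_coeff \<kappa> (i1 - 1) \<noteq> 0"
    (is "?L \<longleftrightarrow> ?R1 \<and> ?R2")
proof
  assume ?L
  then obtain y where y: "smooth_germ y" "ord_ge (Suc (m + i1)) (\<lambda>t. y t - t ^ (m + i1))"
    "A_equivalent (curve_of_mult m \<kappa>) (\<lambda>t. (t ^ m, y t))" by blast
  have "ord_ge (m + i1) (\<lambda>t. (y t - t ^ (m + i1)) + t ^ (m + i1))"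
    by (intro ord_ge_add ord_ge_monom ord_ge_mono[OF y(2)]) auto
  then have yo: "ord_ge (m + i1) y" by simp
  have R1: ?R1
  proof (rule ccontr)
    assume neg: "\<not> ?R1"
    define Q where "Q i \<longleftrightarrow> i \<ge> 1 \<and> \<not> m dvd i \<and> i < i1 \<and> taylor_coeff \<kappa> (i - 1) \<noteq> 0" for i
    define i0 where "i0 = (LEAST i. Q i)"
    have "Q i0" unfolding i0_def by (rule LeastI_ex) (use neg in \<open>auto simp: Q_def\<close>)
    then have i0: "i0 \<ge> 1" "\<not> m dvd i0" "i0 < i1" "taylor_coeff \<kappa> (i0 - 1) \<noteq> 0" by (auto simp: Q_def)
    have z: "taylor_coeff \<kappa> (i - 1) = 0" if "i \<ge> 1" "i < i0" "\<not> m dvd i" for i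
      using not_less_Least[of i Q] that i0(3) unfolding i0_def[symmetric] by (auto simp: Q_def)
    obtain Y C where Y: "C \<noteq> 0" "smooth_germ Y" "A_equivalent (curve_of_mult m \<kappa>) (\<lambda>t. (t ^ m, Y t))"
      "ord_ge (Suc (m + i0)) (\<lambda>t. Y t - (C * taylor_coeff \<kappa> (i0 - 1)) * t ^ (m + i0))"
      using curve_expansion[OF \<kappa> m i0(1,2) z] by blast
    have nd: "m < m + i0" "\<not> m dvd m + i0" using i0 by auto
    have nz: "C * taylor_coeff \<kappa> (i0 - 1) \<noteq> 0" using Y(1) i0(4) by simp
    have "ord_ge (Suc (m + i0)) y" by (rule ord_ge_mono[OF yo]) (use i0 in simp)
    from not_A_equivalent_order[OF m nd Y(2,4) nz this]
    show False using A_equivalent_trans[OF A_equivalent_sym[OF y(3)] Y(3)] by blast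
  qed
  moreover have ?R2
  proof
    assume 0: "taylor_coeff \<kappa> (i1 - 1) = 0"
    have z: "taylor_coeff \<kappa> (i - 1) = 0" if "i \<ge> 1" "i < i1" "\<not> m dvd i" for i using R1 that by blast
    obtain Y C where Y: "C \<noteq> 0" "smooth_germ Y" "A_equivalent (curve_of_mult m \<kappa>) (\<lambda>t. (t ^ m, Y t))"
      "ord_ge (Suc (m + i1)) (\<lambda>t. Y t - (C * taylor_coeff \<kappa> (i1 - 1)) * t ^ (m + i1))"
      using curve_expansion[OF \<kappa> m i1 z] by blast
    have nd: "m < m + i1" "\<not> m dvd m + i1" using i1 by auto
    have y1: "ord_ge (Suc (m + i1)) (\<lambda>t. y t - 1 * t ^ (m + i1))" using y(2) by simp
    have "ord_ge (Suc (m + i1)) Y" using Y(4) 0 by simp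
    from not_A_equivalent_order[OF m nd y(1) y1 one_neq_zero this]
    show False using A_equivalent_trans[OF A_equivalent_sym[OF Y(3)] y(3)] by blast
  qed
  ultimately show "?R1 \<and> ?R2" ..
next
  assume R: "?R1 \<and> ?R2"
  then have z: "taylor_coeff \<kappa> (i - 1) = 0" if "i \<ge> 1" "i < i1" "\<not> m dvd i" for i using that by blast
  obtain Y C where Y: "C \<noteq> 0" "smooth_germ Y" "A_equivalent (curve_of_mult m \<kappa>) (\<lambda>t. (t ^ m, Y t))"
    "ord_ge (Suc (m + i1)) (\<lambda>t. Y t - (C * taylor_coeff \<kappa> (i1 - 1)) * t ^ (m + i1))"
    using curve_expansion[OF \<kappa> m i1 z] by blast
  \<comment> \<open>Dividing by \<open>d\<close> makes the leading coefficient 1, the form expected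
    by the classification lemmas.\<close>
  define d where "d = C * taylor_coeff \<kappa> (i1 - 1)"
  have d: "d \<noteq> 0" using Y(1) R by (simp add: d_def)
  define y where "y t = (1 / d) * Y t" for t
  have sy: "smooth_germ y" unfolding y_def by (intro smooth_germ_intros Y) (use d in auto)
  have "ord_ge (Suc (m + i1)) (\<lambda>t. (1 / d) * (Y t - d * t ^ (m + i1)))"
    by (rule ord_ge_cmult) (use Y(4) in \<open>simp add: d_def\<close>)
  then have y1: "ord_ge (Suc (m + i1)) (\<lambda>t. y t - t ^ (m + i1))" using d by (simp add: y_def algebra_simps)
  have "Y 0 = 0" using Y(3) by (simp add: A_equivalent_def plane_curve_germ_def zero_prod_def)
  then have y0: "y 0 = 0" by (simp add: y_def)
  have "\<forall>\<^sub>F t in nhds 0. Y t = 0 + d * y t + 0" using d by (simp add: y_def)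
  from A_equivalent_graph[OF m sy y0 smooth_germ_const refl smooth_germ_const d critical_germ_0 this]
  have "A_equivalent (\<lambda>t. (t ^ m, Y t)) (\<lambda>t. (t ^ m, y t))" .
  from A_equivalent_trans[OF Y(3) this] show ?L using sy y1 by blast
qed

text \<open>The even coefficients of \<open>\<kappa>\<close> are, up to factors, the odd ones of the
  angle, so by hypothesis the angle is even up to order \<open>2 r + 1\<close>. Integration against
  the odd weight \<open>t ^ 3\<close> makes both components even up to order \<open>2 r + 5\<close>.
  It remains to check that the reparametrisation to \<open>t ^ 4\<close> preserves this, which holds
  because it almost commutes with \<open>t\<close> going to \<open>- t\<close>.\<close>

lemma curve_parity_expansion:
  assumes \<kappa>: "smooth_germ \<kappa>" and r: "r \<ge> 1" and z: "\<And>j. j < r \<Longrightarrow> taylor_coeff \<kappa> (2 * j) = 0"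
  obtains Y C C' where "C \<noteq> 0" "C' \<noteq> 0" "smooth_germ Y" "A_equivalent (curve_of_mult 4 \<kappa>) (\<lambda>t. (t ^ 4, Y t))"
    "ord_ge 7 (\<lambda>t. Y t - (C * taylor_coeff \<kappa> 1) * t ^ 6)"
    "ord_ge (2 * r + 6) (\<lambda>t. Y (- t) - Y t - (C' * taylor_coeff \<kappa> (2 * r)) * t ^ (2 * r + 5))"
proof -
  define N where "N = 2 * r + 5"
  define \<theta> where "\<theta> = turning_angle \<kappa>"
  note s\<theta> = turning_angle_smooth[OF \<kappa>, folded \<theta>_def]
  have sneg: "smooth_germ (\<lambda>t::real. - t)" "isCont (\<lambda>t::real. - t) 0" "- (0::real) = 0" by (auto intro!: smooth_germ_intros)
  have s\<theta>n: "smooth_germ (\<lambda>t. \<theta> (- t))" "\<theta> (- 0) = 0" using smooth_germ_compose[OF sneg(1,3) s\<theta>(1)] s\<theta>(2) by auto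
  define e where "e = co \<theta> (2 * r + 1)"
  have odd0: "co \<theta> i = 0" if i: "odd i" "i < 2 * r + 1" for i
  proof -
    obtain j where "i = 2 * j + 1" using i(1) by (elim oddE)
    then show ?thesis using s\<theta>(3)[of "2 * j"] z[of j] i(2) by simp
  qed
  have sd: "smooth_germ (\<lambda>t. \<theta> (- t) - \<theta> t)" by (intro smooth_germ_diff s\<theta>n s\<theta>)
  have cd: "co (\<lambda>t. \<theta> (- t) - \<theta> t) i = (- 1) ^ i * co \<theta> i - co \<theta> i" for i
    unfolding co_diff[OF s\<theta>n(1) s\<theta>(1)] co_reflect[OF s\<theta>(1)] ..
  have "co (\<lambda>t. \<theta> (- t) - \<theta> t) i = 0" if "i < 2 * r + 1" for i
    using odd0[of i] that by (cases "even i") (simp_all add: cd)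
  moreover have "co (\<lambda>t. \<theta> (- t) - \<theta> t) (2 * r + 1) = - 2 * e" by (simp add: cd e_def)
  ultimately have dlead: "ord_ge (Suc (2 * r + 1)) (\<lambda>t. (\<theta> (- t) - \<theta> t) - (- 2 * e) * t ^ (2 * r + 1))"
    and dord: "ord_ge (2 * r + 1) (\<lambda>t. \<theta> (- t) - \<theta> t)"
    using co_lead_iff[OF sd, of "2 * r + 1" "- 2 * e"] ord_ge_iff_co[OF sd, of "2 * r + 1"] by blast+
  have cosd: "ord_ge (2 * r + 1 + 1) (\<lambda>t. cos (\<theta> (- t)) - cos (\<theta> t))"
    and "ord_ge (2 * r + 1 + 1) (\<lambda>t. sin (\<theta> (- t)) - sin (\<theta> t) - (\<theta> (- t) - \<theta> t))"
    using sin_cos_diff_ord_ge[OF s\<theta>n s\<theta>(1,2) dord] by auto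
  then have "ord_ge (2 * r + 2) (\<lambda>t. (sin (\<theta> (- t)) - sin (\<theta> t) - (\<theta> (- t) - \<theta> t)) + ((\<theta> (- t) - \<theta> t) - (- 2 * e) * t ^ (2 * r + 1)))"
    using dlead by (intro ord_ge_add) simp_all
  then have sind: "ord_ge (2 * r + 2) (\<lambda>t. sin (\<theta> (- t)) - sin (\<theta> t) - (- 2 * e) * t ^ (2 * r + 1))" by (simp add: algebra_simps)
  obtain x y where xy: "curve_of_mult 4 \<kappa> = (\<lambda>t. (x t, y t))" "smooth_germ x" "smooth_germ y" "x 0 = 0" "y 0 = 0"
    "\<forall>\<^sub>F t in nhds 0. (x has_real_derivative t ^ (4 - 1) / fact (4 - 1) * cos (\<theta> t)) (at t)"
    "\<forall>\<^sub>F t in nhds 0. (y has_real_derivative t ^ (4 - 1) / fact (4 - 1) * sin (\<theta> t)) (at t)"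
    unfolding \<theta>_def using curve_components[OF \<kappa>, of 4] by blast
  have f3: "fact (4 - 1) = (6 :: real)" by (simp add: fact_numeral)
  \<comment> \<open>\<open>x\<close> starts with \<open>t ^ 4 / 24\<close>.\<close>
  define X where "X t = 24 * x t" for t
  have sX: "smooth_germ X" "X 0 = 0" unfolding X_def by (auto intro!: smooth_germ_intros xy simp: xy(4))
  have dX: "\<forall>\<^sub>F t in nhds 0. (X has_real_derivative 4 * t ^ 3 * cos (\<theta> t)) (at t)"
    using xy(6)
  proof eventually_elim
    case (elim t)
    from DERIV_cmult[OF elim, of 24] show ?case unfolding X_def[abs_def] f3 by (simp add: mult_ac)
  qed
  have dy: "\<forall>\<^sub>F t in nhds 0. (y has_real_derivative 1 / 6 * (t ^ 3 * sin (\<theta> t))) (at t)"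
    using xy(7) unfolding f3 by simp
  have reflect: "\<forall>\<^sub>F t in nhds 0. ((\<lambda>t. F (- t)) has_real_derivative F' (- t) * - 1) (at t)"
    if "\<forall>\<^sub>F t in nhds 0. (F has_real_derivative F' t) (at t)" for F F' :: "real \<Rightarrow> real"
    using isCont_comp_0[OF sneg(2,3) that]
  proof eventually_elim
    case (elim t)
    show ?case by (rule DERIV_chain2[where g = uminus, OF elim DERIV_minus[OF DERIV_ident]])
  qed
  have Xpar: "ord_ge (Suc N) (\<lambda>t. X (- t) - X t)"
  proof -
    have "\<forall>\<^sub>F t in nhds 0. ((\<lambda>t. X (- t) - X t) has_real_derivative 4 * (t ^ 3 * (cos (\<theta> (- t)) - cos (\<theta> t)))) (at t)"
      using reflect[OF dX] dX
    proof eventually_elim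
      case (elim t)
      from DERIV_diff[OF elim] show ?case by (simp add: algebra_simps)
    qed
    moreover have "ord_ge (3 + (2 * r + 1 + 1)) (\<lambda>t. 4 * (t ^ 3 * (cos (\<theta> (- t)) - cos (\<theta> t))))"
      by (intro ord_ge_cmult ord_ge_mult cosd ord_ge_monom order_refl)
    ultimately have "ord_ge (Suc (3 + (2 * r + 1 + 1))) (\<lambda>t. X (- t) - X t)" by (intro ord_ge_integrate) auto
    then show ?thesis by (simp add: N_def numeral_eq_Suc)
  qed
  \<comment> \<open>The odd part of the angle starts with \<open>e t ^ (2 r + 1)\<close>; the
    derivative of \<open>y (- t) - y t\<close> then starts with
    \<open>- e / 3 * t ^ (2 r + 4)\<close>, which integrates to \<open>c t ^ N\<close>.\<close>
  define c where "c = - e / (3 * real N)"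
  have N0: "real N \<noteq> 0" by (simp add: N_def)
  have ypar: "ord_ge (Suc N) (\<lambda>t. y (- t) - y t - c * t ^ N)"
  proof -
    have "\<forall>\<^sub>F t in nhds 0. ((\<lambda>t. y (- t) - y t - c * t ^ N) has_real_derivative
        1 / 6 * (t ^ 3 * (sin (\<theta> (- t)) - sin (\<theta> t) - (- 2 * e) * t ^ (2 * r + 1)))) (at t)"
      using reflect[OF dy] dy
    proof eventually_elim
      case (elim t)
      have "((\<lambda>t. t ^ N) has_real_derivative real N * (t ^ 3 * t ^ (2 * r + 1))) (at t)"
        using DERIV_pow[of N t] unfolding power_add[symmetric] by (simp add: N_def numeral_eq_Suc)
      from DERIV_diff[OF DERIV_diff[OF elim] DERIV_cmult[OF this, of c]]
      show ?case using N0 by (simp add: c_def algebra_simps)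
    qed
    moreover have "ord_ge (3 + (2 * r + 2)) (\<lambda>t. 1 / 6 * (t ^ 3 * (sin (\<theta> (- t)) - sin (\<theta> t) - (- 2 * e) * t ^ (2 * r + 1))))"
      by (intro ord_ge_cmult ord_ge_mult sind ord_ge_monom order_refl)
    ultimately have "ord_ge (Suc (3 + (2 * r + 2))) (\<lambda>t. y (- t) - y t - c * t ^ N)" by (intro ord_ge_integrate) (simp_all add: N_def)
    then show ?thesis by (simp add: N_def numeral_eq_Suc)
  qed
  define a2 where "a2 = co \<theta> 2"
  have "co \<theta> 0 = 0" "co \<theta> 1 = 0" using s\<theta>(2) odd0[of 1] r by (simp_all add: co_0)
  then have "ord_ge (Suc 2) (\<lambda>t. \<theta> t - a2 * t ^ 2)"
    using co_lead_iff[OF s\<theta>(1), of 2 a2] by (auto simp: a2_def numeral_2_eq_2 less_Suc_eq)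
  then have \<theta>3: "ord_ge 3 (\<lambda>t. \<theta> t - a2 * t ^ 2)" by simp
  have "ord_ge 2 (\<lambda>t. (\<theta> t - a2 * t ^ 2) + a2 * t ^ 2)"
    by (intro ord_ge_add ord_ge_cmult ord_ge_monom ord_ge_mono[OF \<theta>3]) auto
  then have \<theta>2: "ord_ge 2 (\<lambda>t. \<theta> t - 0)" by simp
  have cs: "ord_ge (2 + 1) (\<lambda>t. cos (\<theta> t) - 1)" "ord_ge (2 + 1) (\<lambda>t. sin (\<theta> t) - \<theta> t)"
    using sin_cos_diff_ord_ge[OF s\<theta>(1,2) smooth_germ_const refl \<theta>2] by simp_all
  have Xlead: "ord_ge 6 (\<lambda>t. X t - t ^ 4)"
  proof -
    have "\<forall>\<^sub>F t in nhds 0. ((\<lambda>t. X t - t ^ 4) has_real_derivative 4 * (t ^ 3 * (cos (\<theta> t) - 1))) (at t)"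
      using dX
    proof eventually_elim
      case (elim t)
      have "((\<lambda>t. t ^ 4) has_real_derivative 4 * t ^ 3) (at t)" using DERIV_pow[of 4 t] by simp
      from DERIV_diff[OF elim this] show ?case by (simp add: algebra_simps)
    qed
    moreover have "ord_ge (3 + (2 + 1)) (\<lambda>t. 4 * (t ^ 3 * (cos (\<theta> t) - 1)))"
      by (intro ord_ge_cmult ord_ge_mult cs ord_ge_monom order_refl)
    ultimately have "ord_ge (Suc (3 + (2 + 1))) (\<lambda>t. X t - t ^ 4)" by (intro ord_ge_integrate) (simp_all add: sX)
    then show ?thesis by (rule ord_ge_mono) simp
  qed
  have ylead: "ord_ge 7 (\<lambda>t. y t - a2 / 36 * t ^ 6)"
  proof -
    have "\<forall>\<^sub>F t in nhds 0. ((\<lambda>t. y t - a2 / 36 * t ^ 6) has_real_derivative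
        1 / 6 * (t ^ 3 * ((sin (\<theta> t) - \<theta> t) + (\<theta> t - a2 * t ^ 2)))) (at t)"
      using dy
    proof eventually_elim
      case (elim t)
      have "((\<lambda>t. t ^ 6) has_real_derivative 6 * (t ^ 3 * t ^ 2)) (at t)" using DERIV_pow[of 6 t] by (simp flip: power_add)
      from DERIV_diff[OF elim DERIV_cmult[OF this, of "a2 / 36"]] show ?case by (simp add: algebra_simps)
    qed
    moreover have "ord_ge (3 + 3) (\<lambda>t. 1 / 6 * (t ^ 3 * ((sin (\<theta> t) - \<theta> t) + (\<theta> t - a2 * t ^ 2))))"
      by (intro ord_ge_cmult ord_ge_mult ord_ge_add ord_ge_monom order_refl \<theta>3) (use cs in simp)
    ultimately have "ord_ge (Suc (3 + 3)) (\<lambda>t. y t - a2 / 36 * t ^ 6)" by (intro ord_ge_integrate) (simp_all add: xy)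
    then show ?thesis by simp
  qed
  \<comment> \<open>Since \<open>X\<close> has no term \<open>t ^ 5\<close>,
    \<open>root_parameter\<close> is used with \<open>D = 0\<close> and gives \<open>h\<close> and
    \<open>g\<close> equal to \<open>t\<close> up to order 3.\<close>
  have "ord_ge (4 + 1 + 1) (\<lambda>t. X t - t ^ 4 - 0 * t ^ (4 + 1))" using Xlead by simp
  from root_parameter[OF sX(1) this one_le_234(3) order_refl]
  obtain h where h: "diffeo_germ h" "\<forall>\<^sub>F t in nhds 0. X t = h t ^ 4" "ord_ge (1 + 2) (\<lambda>t. h t - t - 0 / real 4 * t ^ (1 + 1))"
    by blast
  obtain g where g: "diffeo_germ g" "\<forall>\<^sub>F t in nhds 0. h (g t) = t" "\<forall>\<^sub>F t in nhds 0. g (h t) = t" using diffeo_germ_inverse[OF h(1)] by blast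
  note sh = diffeo_germ_smooth[OF h(1)] and sg = diffeo_germ_smooth[OF g(1)]
  have gc: "isCont g 0" using sg smooth_germ_isCont by blast
  have "ord_ge (1 + 2) (\<lambda>t. g t - t - (- (0 / real 4)) * t ^ (1 + 1))"
    by (rule inverse_expansion[OF h(1,3) order_refl g(1,2)])
  then have gt3: "ord_ge 3 (\<lambda>t. g t - t)" by (simp add: numeral_3_eq_3)
  then have gt: "ord_ge 2 (\<lambda>t. g t - t)" by (rule ord_ge_mono) simp
  have g1: "ord_ge 1 g" using ord_ge_iff_co[OF sg(1), of 1] sg(2) by (simp add: co_0)
  have lead1: "deriv f 0 = 1" if "smooth_germ f" "ord_ge 2 (\<lambda>t. f t - t)" for f
    using co_lead_iff[OF that(1), of 1 1] that(2) by (simp add: numeral_2_eq_2 co_1)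
  have dg: "deriv g 0 = 1" by (rule lead1[OF sg(1) gt])
  have dh: "deriv h 0 = 1" by (rule lead1[OF sh(1)]) (rule ord_ge_mono[OF h(3), of 2, simplified])
  define Y where "Y t = y (g t)" for t
  have sY: "smooth_germ Y" unfolding Y_def by (rule smooth_germ_compose[OF sg xy(3)])
  have coy: "co y i = 0" if "i < Suc 5" for i
  proof -
    have "ord_ge 6 (\<lambda>t. (y t - a2 / 36 * t ^ 6) + a2 / 36 * t ^ 6)"
      by (intro ord_ge_add ord_ge_cmult ord_ge_monom ord_ge_mono[OF ylead]) auto
    then have "ord_ge 6 y" by simp
    then show ?thesis using ord_ge_iff_co[OF xy(3)] that by simp
  qed
  have "ord_ge (2 + 5) (\<lambda>t. y (g t) - y t)"
    by (rule smooth_order_diff_ord_ge[OF xy(3) _ gc g1 sg(2) _ ord_ge_id _ gt]) (use coy in auto)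
  then have gy: "ord_ge 7 (\<lambda>t. y (g t) - y t)" by simp
  have Ylead: "ord_ge 7 (\<lambda>t. Y t - a2 / 36 * t ^ 6)" using ord_ge_add[OF gy ylead] by (simp add: Y_def)
  \<comment> \<open>The reflection conjugated by the reparametrisation. Its fourth power is nearly
    \<open>t ^ 4\<close> and its derivative at 0 is \<open>- 1\<close>, so it is nearly
    \<open>- t\<close>.\<close>
  define H where "H t = h (- g t)" for t
  have sgn: "smooth_germ (\<lambda>t. - g t)" "- g 0 = 0" using sg by (auto intro: smooth_germ_minus)
  have sH: "smooth_germ H" "H 0 = 0" unfolding H_def using smooth_germ_compose[OF sgn sh(1)] sh(2) sg(2) by auto
  have dH: "deriv H 0 = - 1"
  proof -
    have 1: "((\<lambda>t. - g t) has_real_derivative - deriv g 0) (at 0)" by (rule DERIV_minus[OF smooth_germ_deriv(3)[OF sg(1)]])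
    have "(h has_real_derivative deriv h 0) (at (- g 0))" unfolding sgn(2) by (rule smooth_germ_deriv(3)[OF sh(1)])
    from DERIV_chain2[OF this 1] show ?thesis unfolding H_def[abs_def] using dg dh by (simp add: DERIV_imp_deriv)
  qed
  have "ord_ge (1 * Suc N) (\<lambda>t. X (- g t) - X (g t))" by (rule ord_ge_compose[OF Xpar g1 gc sg(2)])
  moreover have "\<forall>\<^sub>F t in nhds 0. X (- g t) - X (g t) = H t ^ 4 - (- t) ^ 4"
    using isCont_comp_0[OF smooth_germ_isCont[OF sgn(1)] sgn(2) h(2)] isCont_comp_0[OF gc sg(2) h(2)] g(2)
    by eventually_elim (simp add: H_def)
  ultimately have "ord_ge (1 * Suc N) (\<lambda>t. H t ^ 4 - (- t) ^ 4)" by (rule ord_ge_cong[rotated])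
  then have H4: "ord_ge (Suc N) (\<lambda>t. H t ^ 4 - (- t) ^ 4)" by (simp only: mult_1)
  have dneg: "deriv (\<lambda>t::real. - t) 0 = - 1" using DERIV_imp_deriv[OF DERIV_minus[OF DERIV_ident]] by simp
  have "ord_ge (N - 2) (\<lambda>t. H t - (- t))"
    by (rule fourth_power_cancel[OF sH sneg(1,3) _ _ _ H4]) (use dH dneg in \<open>simp_all add: N_def\<close>)
  then have "ord_ge (N - 2) (\<lambda>t. g (H t) - g (- t))"
    by (rule smooth_diff_ord_ge[OF sg(1) smooth_germ_isCont[OF sH(1)] sH(2) sneg(2,3)])
  moreover have "\<forall>\<^sub>F t in nhds 0. g (H t) - g (- t) = (- g t) - g (- t)"
    using isCont_comp_0[OF smooth_germ_isCont[OF sgn(1)] sgn(2) g(3)] by eventually_elim (simp add: H_def)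
  ultimately have ab: "ord_ge (N - 2) (\<lambda>t. (- g t) - g (- t))" by (rule ord_ge_cong[rotated])
  have sgm: "smooth_germ (\<lambda>t. g (- t))" "g (- 0) = 0" using smooth_germ_compose[OF sneg(1,3) sg(1)] sg(2) by auto
  have o1: "ord_ge 1 (\<lambda>t. - g t)" "ord_ge 1 (\<lambda>t. g (- t))"
    using ord_ge_iff_co[OF sgn(1), of 1] ord_ge_iff_co[OF sgm(1), of 1] sg(2) by (simp_all add: co_0)
  \<comment> \<open>\<open>y\<close> vanishes to order 6, which contributes five orders where three
    are needed to reach \<open>N + 1\<close>.\<close>
  have "ord_ge ((N - 2) + 5) (\<lambda>t. y (- g t) - y (g (- t)))"
    by (rule smooth_order_diff_ord_ge[OF xy(3) _ smooth_germ_isCont[OF sgn(1)] o1(1) sgn(2) smooth_germ_isCont[OF sgm(1)] o1(2) sgm(2) ab]) (use coy in auto)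
  then have y1: "ord_ge (Suc N) (\<lambda>t. y (- g t) - y (g (- t)))" by (rule ord_ge_mono) (simp add: N_def)
  have "ord_ge (1 * Suc N) (\<lambda>t. y (- g t) - y (g t) - c * g t ^ N)" by (rule ord_ge_compose[OF ypar g1 gc sg(2)])
  then have y2: "ord_ge (Suc N) (\<lambda>t. y (- g t) - y (g t) - c * g t ^ N)" by (simp only: mult_1)
  have "ord_ge (2 + (N - 1)) (\<lambda>t. g t ^ Suc (N - 1) - t ^ Suc (N - 1))" by (rule power_diff_ord_ge[OF g1 ord_ge_id gt])
  moreover have "2 + (N - 1) = Suc N" "Suc (N - 1) = N" by (simp_all add: N_def)
  ultimately have y3: "ord_ge (Suc N) (\<lambda>t. c * (g t ^ N - t ^ N))" by (intro ord_ge_cmult) (simp only:)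
  have "ord_ge (Suc N) (\<lambda>t. (y (- g t) - y (g t) - c * g t ^ N) - (y (- g t) - y (g (- t))) + c * (g t ^ N - t ^ N))"
    by (intro ord_ge_add[OF ord_ge_diff[OF y2 y1] y3])
  then have Ypar: "ord_ge (Suc N) (\<lambda>t. Y (- t) - Y t - c * t ^ N)" by (simp add: Y_def algebra_simps)
  have "\<forall>\<^sub>F t in nhds 0. (X (g t), y (g t)) = (t ^ 4, Y t)"
    using isCont_comp_0[OF gc sg(2) h(2)] g(2) by eventually_elim (simp add: Y_def)
  from A_equivalent_right[OF smooth_germ_Pair[OF sX(1) xy(3)] _ g(1) this]
  have e1: "A_equivalent (\<lambda>t. (X t, y t)) (\<lambda>t. (t ^ 4, Y t))" by (simp add: sX xy zero_prod_def)
  have "diffeo_germ (\<lambda>z :: real \<times> real. (fst z / 24, 0 + 1 * snd z + 0))"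
  proof (rule fst_snd_smooth_diffeo[OF _ _ _ smooth_germ_const refl smooth_germ_const _ smooth_germ_const has_derivative_const refl])
    show "smooth_germ (\<lambda>s::real. s / 24)" by (intro smooth_germ_intros) simp
    have "((\<lambda>s::real. s / 24) has_real_derivative 1 / 24) (at 0)" by (rule DERIV_cdivide[OF DERIV_ident])
    then show "deriv (\<lambda>s::real. s / 24) 0 \<noteq> 0" by (simp add: DERIV_imp_deriv)
  qed simp_all
  from A_equivalent_left[OF smooth_germ_Pair[OF sX(1) xy(3)] _ this, of "\<lambda>t. (x t, y t)"]
  have "A_equivalent (\<lambda>t. (x t, y t)) (\<lambda>t. (X t, y t))" by (simp add: X_def sX xy zero_prod_def)
  from A_equivalent_trans[OF this e1] have eq: "A_equivalent (curve_of_mult 4 \<kappa>) (\<lambda>t. (t ^ 4, Y t))" by (simp add: xy(1))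
  have a2: "a2 / 36 = (1 / 72) * taylor_coeff \<kappa> 1" using s\<theta>(3)[of 1] by (simp add: a2_def numeral_2_eq_2)
  define C' where "C' = - 1 / (3 * real N * fact (2 * r + 1))"
  have cC: "c = C' * taylor_coeff \<kappa> (2 * r)" using s\<theta>(3)[of "2 * r"] by (simp add: c_def C'_def e_def)
  have "C' \<noteq> 0" using N0 by (simp add: C'_def)
  show ?thesis
    by (rule that[of "1/72" C' Y]) (use \<open>C' \<noteq> 0\<close> sY eq Ylead Ypar in \<open>simp_all add: a2 cC N_def numeral_eq_Suc\<close>)
qed

section \<open>Criteria for the individual types\<close>

lemma binomial_lead: "n < e \<Longrightarrow> ord_ge (Suc n) (\<lambda>t. (t ^ n + c * t ^ e) - t ^ n)"
  using ord_ge_cmult[OF ord_ge_monom[of "Suc n" e], of c] by simp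

lemma A_even_iff:
  assumes \<kappa>: "smooth_germ \<kappa>" and k: "k \<ge> 1"
  shows "defines_singularity (curve_of_mult 2 \<kappa>) (A_even k) \<longleftrightarrow>
    (\<forall>j. 2 * j + 4 \<le> 2 * k \<longrightarrow> taylor_coeff \<kappa> (2 * j) = 0) \<and> taylor_coeff \<kappa> (2 * k - 2) \<noteq> 0"
proof -
  have i1: "1 \<le> 2 * k - 1" "\<not> 2 dvd 2 * k - 1" and n: "2 + (2 * k - 1) = 2 * k + 1" and o: "odd (2 * k + 1)" using k by auto
  have "defines_singularity (curve_of_mult 2 \<kappa>) (A_even k) \<longleftrightarrow>
    (\<exists>y. smooth_germ y \<and> ord_ge (Suc (2 * k + 1)) (\<lambda>t. y t - t ^ (2 * k + 1)) \<and>
      A_equivalent (curve_of_mult 2 \<kappa>) (\<lambda>t. (t ^ 2, y t)))" (is "_ \<longleftrightarrow> ?R")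
  proof
    assume "defines_singularity (curve_of_mult 2 \<kappa>) (A_even k)"
    then have "A_equivalent (curve_of_mult 2 \<kappa>) (\<lambda>t. (t ^ 2, t ^ (2 * k + 1)))"
      by (simp add: defines_singularity_def A_even_def)
    moreover have "smooth_germ (\<lambda>t::real. t ^ (2 * k + 1))" by (intro smooth_germ_intros)
    moreover have "ord_ge (Suc (2 * k + 1)) (\<lambda>t. t ^ (2 * k + 1) - t ^ (2 * k + 1))" by (simp add: ord_ge_zero)
    ultimately show ?R by blast
  next
    assume ?R
    then obtain y where y: "smooth_germ y" "ord_ge (Suc (2 * k + 1)) (\<lambda>t. y t - t ^ (2 * k + 1))"
      "A_equivalent (curve_of_mult 2 \<kappa>) (\<lambda>t. (t ^ 2, y t))" by blast
    from A_equivalent_trans[OF y(3) classify_mult_2[OF y(1,2) o]]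
    show "defines_singularity (curve_of_mult 2 \<kappa>) (A_even k)" by (simp add: defines_singularity_def A_even_def)
  qed
  also have "\<dots> \<longleftrightarrow> (\<forall>i\<ge>1. \<not> 2 dvd i \<and> i < 2 * k - 1 \<longrightarrow> taylor_coeff \<kappa> (i - 1) = 0) \<and> taylor_coeff \<kappa> (2 * k - 1 - 1) \<noteq> 0"
    using curve_first_order_iff[OF \<kappa> one_le_234(1) i1] unfolding n .
  \<comment> \<open>For an odd index \<open>i = 2 j + 1\<close> the bound \<open>i < 2 k - 1\<close>
    amounts to \<open>2 j + 4 \<le> 2 k\<close>, an empty condition when
    \<open>k = 1\<close>.\<close>
  also have "(\<forall>i\<ge>1. \<not> 2 dvd i \<and> i < 2 * k - 1 \<longrightarrow> taylor_coeff \<kappa> (i - 1) = 0) \<longleftrightarrow>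
      (\<forall>j. 2 * j + 4 \<le> 2 * k \<longrightarrow> taylor_coeff \<kappa> (2 * j) = 0)"
  proof (intro iffI allI impI)
    fix j assume *: "\<forall>i\<ge>1. \<not> 2 dvd i \<and> i < 2 * k - 1 \<longrightarrow> taylor_coeff \<kappa> (i - 1) = 0" "2 * j + 4 \<le> 2 * k"
    show "taylor_coeff \<kappa> (2 * j) = 0" using *(1)[rule_format, of "2 * j + 1"] *(2) by simp
  next
    fix i assume *: "\<forall>j. 2 * j + 4 \<le> 2 * k \<longrightarrow> taylor_coeff \<kappa> (2 * j) = 0" "1 \<le> i" "\<not> 2 dvd i \<and> i < 2 * k - 1"
    then obtain j where "i = 2 * j + 1" by (auto elim: oddE)
    moreover from this have "2 * j + 4 \<le> 2 * k" using *(3) by presburger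
    ultimately show "taylor_coeff \<kappa> (i - 1) = 0" using *(1) by simp
  qed
  also have "2 * k - 1 - 1 = 2 * k - 2" by simp
  finally show ?thesis .
qed

text \<open>Stated for an abstract set \<open>S\<close> so that both triple-point series share it:
  \<open>S\<close> must contain every form that \<open>classify_mult_3\<close> can return, and all
  its members must have leading exponent \<open>3 + i1\<close>.\<close>

lemma mult_3_iff:
  assumes \<kappa>: "smooth_germ \<kappa>" and i1: "i1 \<ge> 1" "\<not> 3 dvd i1"
    and monom: "(\<lambda>t. (t ^ 3, t ^ (3 + i1))) \<in> S"
    and binom: "\<And>e c. 3 + i1 < e \<Longrightarrow> e + 6 \<le> 2 * (3 + i1) \<Longrightarrow> e mod 3 = (2 * (3 + i1)) mod 3 \<Longrightarrow> c \<in> {1, -1} \<Longrightarrow>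
      (odd (e - (3 + i1)) \<longrightarrow> c = 1) \<Longrightarrow> (\<lambda>t. (t ^ 3, t ^ (3 + i1) + c * t ^ e)) \<in> S"
    and S: "\<And>g. g \<in> S \<Longrightarrow> \<exists>e c. 3 + i1 < e \<and> g = (\<lambda>t. (t ^ 3, t ^ (3 + i1) + c * t ^ e))"
  shows "defines_singularity (curve_of_mult 3 \<kappa>) S \<longleftrightarrow>
    (\<forall>i\<ge>1. \<not> 3 dvd i \<and> i < i1 \<longrightarrow> taylor_coeff \<kappa> (i - 1) = 0) \<and> taylor_coeff \<kappa> (i1 - 1) \<noteq> 0"
proof -
  have nd: "3 < 3 + i1" "\<not> 3 dvd 3 + i1" using i1 by (auto simp: dvd_add_right_iff)
  have "defines_singularity (curve_of_mult 3 \<kappa>) S \<longleftrightarrow>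
    (\<exists>y. smooth_germ y \<and> ord_ge (Suc (3 + i1)) (\<lambda>t. y t - t ^ (3 + i1)) \<and>
      A_equivalent (curve_of_mult 3 \<kappa>) (\<lambda>t. (t ^ 3, y t)))" (is "_ \<longleftrightarrow> ?R")
  proof
    assume "defines_singularity (curve_of_mult 3 \<kappa>) S"
    then obtain g where g: "g \<in> S" "A_equivalent (curve_of_mult 3 \<kappa>) g" by (auto simp: defines_singularity_def)
    obtain e c where e: "3 + i1 < e" "g = (\<lambda>t. (t ^ 3, t ^ (3 + i1) + c * t ^ e))" using S[OF g(1)] by blast
    have "smooth_germ (\<lambda>t. t ^ (3 + i1) + c * t ^ e)" by (intro smooth_germ_intros)
    then show ?R using binomial_lead[OF e(1), of c] g(2) unfolding e(2) by blast
  next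
    assume ?R
    then obtain y where y: "smooth_germ y" "ord_ge (Suc (3 + i1)) (\<lambda>t. y t - t ^ (3 + i1))"
      "A_equivalent (curve_of_mult 3 \<kappa>) (\<lambda>t. (t ^ 3, y t))" by blast
    from classify_mult_3[OF y(1,2) nd]
    show "defines_singularity (curve_of_mult 3 \<kappa>) S"
    proof (elim disjE exE conjE)
      assume "A_equivalent (\<lambda>t. (t ^ 3, y t)) (\<lambda>t. (t ^ 3, t ^ (3 + i1)))"
      from A_equivalent_trans[OF y(3) this] show ?thesis using monom unfolding defines_singularity_def by (rule rev_bexI[rotated])
    next
      fix e c
      assume e: "3 + i1 < e" "e + 6 \<le> 2 * (3 + i1)" "e mod 3 = 2 * (3 + i1) mod 3" "c \<in> {1, -1}" "odd (e - (3 + i1)) \<longrightarrow> c = 1"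
        and eq: "A_equivalent (\<lambda>t. (t ^ 3, y t)) (\<lambda>t. (t ^ 3, t ^ (3 + i1) + c * t ^ e))"
      from A_equivalent_trans[OF y(3) eq] binom[OF e] show ?thesis unfolding defines_singularity_def by (rule rev_bexI[rotated])
    qed
  qed
  also have "\<dots> \<longleftrightarrow> (\<forall>i\<ge>1. \<not> 3 dvd i \<and> i < i1 \<longrightarrow> taylor_coeff \<kappa> (i - 1) = 0) \<and> taylor_coeff \<kappa> (i1 - 1) \<noteq> 0"
    by (rule curve_first_order_iff[OF \<kappa> one_le_234(2) i1])
  finally show ?thesis .
qed

lemma mult_4_iff:
  assumes \<kappa>: "smooth_germ \<kappa>" and i1: "i1 = 1 \<or> i1 = 3"
    and monom: "(\<lambda>t. (t ^ 4, t ^ (4 + i1))) \<in> S"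
    and binom: "\<And>e c. 4 + i1 < e \<Longrightarrow> e + 8 \<le> 3 * (4 + i1) \<Longrightarrow> e mod 4 = (3 * (4 + i1)) mod 4 \<Longrightarrow> c \<in> {1, -1} \<Longrightarrow>
      (\<lambda>t. (t ^ 4, t ^ (4 + i1) + c * t ^ e)) \<in> S"
    and S: "\<And>g. g \<in> S \<Longrightarrow> \<exists>e c. 4 + i1 < e \<and> g = (\<lambda>t. (t ^ 4, t ^ (4 + i1) + c * t ^ e))"
  shows "defines_singularity (curve_of_mult 4 \<kappa>) S \<longleftrightarrow>
    (\<forall>i\<ge>1. \<not> 4 dvd i \<and> i < i1 \<longrightarrow> taylor_coeff \<kappa> (i - 1) = 0) \<and> taylor_coeff \<kappa> (i1 - 1) \<noteq> 0"
proof -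
  have nd: "4 < 4 + i1" "4 + i1 < 8" "odd (4 + i1)" "1 \<le> i1" "\<not> 4 dvd i1" using i1 by auto
  have "defines_singularity (curve_of_mult 4 \<kappa>) S \<longleftrightarrow>
    (\<exists>y. smooth_germ y \<and> ord_ge (Suc (4 + i1)) (\<lambda>t. y t - t ^ (4 + i1)) \<and>
      A_equivalent (curve_of_mult 4 \<kappa>) (\<lambda>t. (t ^ 4, y t)))" (is "_ \<longleftrightarrow> ?R")
  proof
    assume "defines_singularity (curve_of_mult 4 \<kappa>) S"
    then obtain g where g: "g \<in> S" "A_equivalent (curve_of_mult 4 \<kappa>) g" by (auto simp: defines_singularity_def)
    obtain e c where e: "4 + i1 < e" "g = (\<lambda>t. (t ^ 4, t ^ (4 + i1) + c * t ^ e))" using S[OF g(1)] by blast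
    have "smooth_germ (\<lambda>t. t ^ (4 + i1) + c * t ^ e)" by (intro smooth_germ_intros)
    then show ?R using binomial_lead[OF e(1), of c] g(2) unfolding e(2) by blast
  next
    assume ?R
    then obtain y where y: "smooth_germ y" "ord_ge (Suc (4 + i1)) (\<lambda>t. y t - t ^ (4 + i1))"
      "A_equivalent (curve_of_mult 4 \<kappa>) (\<lambda>t. (t ^ 4, y t))" by blast
    from classify_mult_4[OF y(1,2) nd(1-3)]
    show "defines_singularity (curve_of_mult 4 \<kappa>) S"
    proof (elim disjE exE conjE)
      assume "A_equivalent (\<lambda>t. (t ^ 4, y t)) (\<lambda>t. (t ^ 4, t ^ (4 + i1)))"
      from A_equivalent_trans[OF y(3) this] show ?thesis using monom unfolding defines_singularity_def by (rule rev_bexI[rotated])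
    next
      fix e c
      assume e: "4 + i1 < e" "e + 8 \<le> 3 * (4 + i1)" "e mod 4 = 3 * (4 + i1) mod 4" "c \<in> {1, -1}"
        and eq: "A_equivalent (\<lambda>t. (t ^ 4, y t)) (\<lambda>t. (t ^ 4, t ^ (4 + i1) + c * t ^ e))"
      from A_equivalent_trans[OF y(3) eq] binom[OF e] show ?thesis unfolding defines_singularity_def by (rule rev_bexI[rotated])
    qed
  qed
  also have "\<dots> \<longleftrightarrow> (\<forall>i\<ge>1. \<not> 4 dvd i \<and> i < i1 \<longrightarrow> taylor_coeff \<kappa> (i - 1) = 0) \<and> taylor_coeff \<kappa> (i1 - 1) \<noteq> 0"
    by (rule curve_first_order_iff[OF \<kappa> one_le_234(3) nd(4,5)])
  finally show ?thesis .
qed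

text \<open>The exponent 6 settles the first two coefficients through
  \<open>curve_first_order_iff\<close>. The index \<open>q\<close> is read off from the defect
  \<open>y (- t) - y t\<close>, whose leading exponent in the normal form is
  \<open>2 q + 5\<close>.\<close>

lemma W_sharp_iff:
  assumes \<kappa>: "smooth_germ \<kappa>" and q: "q \<ge> 1"
  shows "defines_singularity (curve_of_mult 4 \<kappa>) (W_sharp q) \<longleftrightarrow>
    taylor_coeff \<kappa> 0 = 0 \<and> taylor_coeff \<kappa> 1 \<noteq> 0 \<and>
    (\<forall>j. 1 \<le> j \<and> j < q \<longrightarrow> taylor_coeff \<kappa> (2 * j) = 0) \<and> taylor_coeff \<kappa> (2 * q) \<noteq> 0"
    (is "?L \<longleftrightarrow> ?k0 \<and> ?k1 \<and> ?kj \<and> ?kq")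
proof
  assume ?L
  then have L: "A_equivalent (curve_of_mult 4 \<kappa>) (\<lambda>t. (t ^ 4, t ^ 6 + t ^ (2 * q + 5)))"
    by (simp add: defines_singularity_def W_sharp_def)
  let ?y = "\<lambda>t::real. t ^ 6 + t ^ (2 * q + 5)"
  have sy: "smooth_germ ?y" by (intro smooth_germ_intros)
  have "ord_ge (Suc 6) (\<lambda>t. ?y t - t ^ 6)" using binomial_lead[of 6 "2 * q + 5" 1] q by simp
  then have "\<exists>y. smooth_germ y \<and> ord_ge (Suc (4 + 2)) (\<lambda>t. y t - t ^ (4 + 2)) \<and> A_equivalent (curve_of_mult 4 \<kappa>) (\<lambda>t. (t ^ 4, y t))"
    using sy L by (intro exI[of _ ?y]) simp
  then have *: "(\<forall>i\<ge>1. \<not> 4 dvd i \<and> i < 2 \<longrightarrow> taylor_coeff \<kappa> (i - 1) = 0) \<and> taylor_coeff \<kappa> (2 - 1) \<noteq> 0"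
    using curve_first_order_iff[OF \<kappa> one_le_234(3), of 2] by simp
  have k0: ?k0 using conjunct1[OF *, rule_format, of 1] by simp
  have k1: ?k1 using * by simp
  have oy: "ord_ge 4 ?y" using q by (intro ord_ge_add ord_ge_monom) auto
  have yN: "?y (- t) - ?y t = (- 2) * t ^ (2 * q + 5)" for t by (simp add: power_minus_odd)
  have kj: ?kj
  proof (rule ccontr)
    assume neg: "\<not> ?kj"
    define Q where "Q j \<longleftrightarrow> 1 \<le> j \<and> j < q \<and> taylor_coeff \<kappa> (2 * j) \<noteq> 0" for j
    \<comment> \<open>At the least offending index the curve has a parity defect in degree
      \<open>2 r + 5\<close>, below that of the normal form.\<close>
    define r where "r = (LEAST j. Q j)"
    have "Q r" unfolding r_def by (rule LeastI_ex) (use neg in \<open>auto simp: Q_def\<close>)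
    then have r: "1 \<le> r" "r < q" "taylor_coeff \<kappa> (2 * r) \<noteq> 0" by (auto simp: Q_def)
    have z: "taylor_coeff \<kappa> (2 * j) = 0" if "j < r" for j
      using not_less_Least[of j Q] that r(2) k0 unfolding r_def[symmetric] by (cases "j = 0") (auto simp: Q_def)
    obtain Y C C' where Y: "C \<noteq> 0" "C' \<noteq> 0" "smooth_germ Y" "A_equivalent (curve_of_mult 4 \<kappa>) (\<lambda>t. (t ^ 4, Y t))"
      "ord_ge 7 (\<lambda>t. Y t - (C * taylor_coeff \<kappa> 1) * t ^ 6)"
      "ord_ge (2 * r + 6) (\<lambda>t. Y (- t) - Y t - (C' * taylor_coeff \<kappa> (2 * r)) * t ^ (2 * r + 5))"
      by (rule curve_parity_expansion[OF \<kappa> r(1) z])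
    have "ord_ge 4 (\<lambda>t. (Y t - (C * taylor_coeff \<kappa> 1) * t ^ 6) + (C * taylor_coeff \<kappa> 1) * t ^ 6)"
      by (intro ord_ge_add ord_ge_cmult ord_ge_monom ord_ge_mono[OF Y(5)]) auto
    then have oY: "ord_ge 4 Y" by simp
    have pY: "ord_ge (Suc (2 * r + 5)) (\<lambda>t. Y (- t) - Y t - (C' * taylor_coeff \<kappa> (2 * r)) * t ^ (2 * r + 5))"
      using Y(6) by (simp add: numeral_eq_Suc)
    have nz: "C' * taylor_coeff \<kappa> (2 * r) \<noteq> 0" using Y(2) r(3) by simp
    have "ord_ge (Suc (2 * r + 5)) (\<lambda>t. ?y (- t) - ?y t)" unfolding yN by (intro ord_ge_cmult ord_ge_monom) (use r in simp)
    from not_A_equivalent_parity[OF _ Y(3) oY pY nz this]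
    show False using A_equivalent_trans[OF A_equivalent_sym[OF Y(4)] L] by simp
  qed
  moreover have ?kq
  proof
    \<comment> \<open>The roles are exchanged: now the normal form has the defect
      \<open>- 2 t ^ (2 q + 5)\<close> and the curve has none in that degree.\<close>
    assume 0: "taylor_coeff \<kappa> (2 * q) = 0"
    have z: "taylor_coeff \<kappa> (2 * j) = 0" if "j < q" for j using kj k0 that by (cases "j = 0") auto
    obtain Y C C' where Y: "C \<noteq> 0" "C' \<noteq> 0" "smooth_germ Y" "A_equivalent (curve_of_mult 4 \<kappa>) (\<lambda>t. (t ^ 4, Y t))"
      "ord_ge 7 (\<lambda>t. Y t - (C * taylor_coeff \<kappa> 1) * t ^ 6)"
      "ord_ge (2 * q + 6) (\<lambda>t. Y (- t) - Y t - (C' * taylor_coeff \<kappa> (2 * q)) * t ^ (2 * q + 5))"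
      by (rule curve_parity_expansion[OF \<kappa> q z])
    have pY: "ord_ge (Suc (2 * q + 5)) (\<lambda>t. Y (- t) - Y t)" using Y(6) 0 by (simp add: numeral_eq_Suc)
    have "ord_ge (Suc (2 * q + 5)) (\<lambda>t. ?y (- t) - ?y t - (- 2) * t ^ (2 * q + 5))" unfolding yN by (simp add: ord_ge_zero)
    from not_A_equivalent_parity[OF _ sy oy this _ pY]
    show False using A_equivalent_trans[OF A_equivalent_sym[OF L] Y(4)] by simp
  qed
  ultimately show "?k0 \<and> ?k1 \<and> ?kj \<and> ?kq" using k0 k1 by blast
next
  assume R: "?k0 \<and> ?k1 \<and> ?kj \<and> ?kq"
  have z: "taylor_coeff \<kappa> (2 * j) = 0" if "j < q" for j using R that by (cases "j = 0") auto
  obtain Y C C' where Y: "C \<noteq> 0" "C' \<noteq> 0" "smooth_germ Y" "A_equivalent (curve_of_mult 4 \<kappa>) (\<lambda>t. (t ^ 4, Y t))"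
    "ord_ge 7 (\<lambda>t. Y t - (C * taylor_coeff \<kappa> 1) * t ^ 6)"
    "ord_ge (2 * q + 6) (\<lambda>t. Y (- t) - Y t - (C' * taylor_coeff \<kappa> (2 * q)) * t ^ (2 * q + 5))"
    by (rule curve_parity_expansion[OF \<kappa> q z])
  have "ord_ge (Suc 6) (\<lambda>t. Y t - (C * taylor_coeff \<kappa> 1) * t ^ 6)" using Y(5) by simp
  then have c6: "\<And>i. i < 6 \<Longrightarrow> co Y i = 0" "co Y 6 \<noteq> 0" using co_lead_iff[OF Y(3), of 6] Y(1) R by auto
  have sYn: "smooth_germ (\<lambda>t. Y (- t))" by (rule smooth_germ_compose[OF _ _ Y(3)]) (auto intro!: smooth_germ_intros)
  have "ord_ge (Suc (2 * q + 5)) (\<lambda>t. (Y (- t) - Y t) - (C' * taylor_coeff \<kappa> (2 * q)) * t ^ (2 * q + 5))"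
    using Y(6) by (simp add: numeral_eq_Suc)
  then have "(\<forall>i<2 * q + 5. co (\<lambda>t. Y (- t) - Y t) i = 0) \<and> co (\<lambda>t. Y (- t) - Y t) (2 * q + 5) = C' * taylor_coeff \<kappa> (2 * q)"
    using co_lead_iff[OF smooth_germ_diff[OF sYn Y(3)]] by blast
  moreover have "co (\<lambda>t. Y (- t) - Y t) i = - 2 * co Y i" if "odd i" for i
    using that by (simp add: co_diff[OF sYn Y(3)] co_reflect[OF Y(3)])
  ultimately have odd: "\<And>i. odd i \<Longrightarrow> i < 2 * q + 5 \<Longrightarrow> co Y i = 0" "co Y (2 * q + 5) \<noteq> 0"
    using Y(2) R by (force, force)
  from A_equivalent_trans[OF Y(4) classify_W_sharp[OF q Y(3) c6 odd]]
  show ?L by (simp add: defines_singularity_def W_sharp_def)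
qed

lemma exponent_E_6k:
  fixes e k :: nat
  assumes "3 * k + 1 < e" "e mod 3 = 2 * (3 * k + 1) mod 3"
  obtains p where "e = 3 * (k + p) + 2"
proof -
  have "2 * (3 * k + 1) = 3 * (2 * k) + 2" by simp
  then have "e mod 3 = 2" using assms(2) by (simp only: mod_mult_self4) simp
  then have "e = 3 * (e div 3) + 2" using div_mult_mod_eq[of e 3] by simp
  moreover from this have "k \<le> e div 3" using assms(1) by linarith
  ultimately show thesis using that[of "e div 3 - k"] by simp
qed

lemma exponent_E_6k2:
  fixes e k :: nat
  assumes "3 * k + 2 < e" "e mod 3 = 2 * (3 * k + 2) mod 3"
  obtains p where "e = 3 * (k + p) + 4"
proof -
  have "2 * (3 * k + 2) = 3 * (2 * k + 1) + 1" by simp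
  then have "e mod 3 = 1" using assms(2) by (simp only: mod_mult_self4) simp
  then have e: "e = 3 * (e div 3) + 1" using div_mult_mod_eq[of e 3] by simp
  moreover from this have "k + 1 \<le> e div 3" using assms(1) by linarith
  ultimately show thesis using that[of "e div 3 - (k + 1)"] by simp
qed

lemma E_6k_iff:
  assumes \<kappa>: "smooth_germ \<kappa>" and k: "k \<ge> 1"
  shows "defines_singularity (curve_of_mult 3 \<kappa>) (E_6k k) \<longleftrightarrow>
    (\<forall>i\<ge>1. \<not> 3 dvd i \<and> i < 3 * k - 2 \<longrightarrow> taylor_coeff \<kappa> (i - 1) = 0) \<and> taylor_coeff \<kappa> (3 * k - 2 - 1) \<noteq> 0"
proof (rule mult_3_iff[OF \<kappa>])
  have n: "3 + (3 * k - 2) = 3 * k + 1" using k by simp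
  show "1 \<le> 3 * k - 2" "\<not> 3 dvd 3 * k - 2" using k by presburger+
  show "(\<lambda>t. (t ^ 3, t ^ (3 + (3 * k - 2)))) \<in> E_6k k" unfolding n E_6k_def by blast
  show "(\<lambda>t. (t ^ 3, t ^ (3 + (3 * k - 2)) + c * t ^ e)) \<in> E_6k k"
    if e: "3 + (3 * k - 2) < e" "e + 6 \<le> 2 * (3 + (3 * k - 2))" "e mod 3 = 2 * (3 + (3 * k - 2)) mod 3" "c \<in> {1, -1}"
      "odd (e - (3 + (3 * k - 2))) \<longrightarrow> c = 1" for e c
  proof -
    obtain p where p: "e = 3 * (k + p) + 2" by (rule exponent_E_6k[OF e(1,3)[unfolded n]])
    have "p + 2 \<le> k" using e(2) unfolding n p by simp
    \<comment> \<open>Here \<open>e - n\<close> is \<open>3 p + 1\<close>, odd exactly when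
      \<open>p\<close> is even; this is the parity rule for the signs.\<close>
    moreover have "c \<in> sign_choices p" using e(4,5) unfolding n p by (auto simp: sign_choices_def)
    ultimately show ?thesis unfolding n p E_6k_def by blast
  qed
  show "\<exists>e c. 3 + (3 * k - 2) < e \<and> g = (\<lambda>t. (t ^ 3, t ^ (3 + (3 * k - 2)) + c * t ^ e))" if "g \<in> E_6k k" for g
  proof -
    from that consider p \<epsilon> where "g = (\<lambda>t. (t ^ 3, t ^ (3 * k + 1) + \<epsilon> * t ^ (3 * (k + p) + 2)))" | "g = (\<lambda>t. (t ^ 3, t ^ (3 * k + 1)))"
      unfolding E_6k_def by blast
    then show ?thesis unfolding n
    proof cases
      case 1
      then show "\<exists>e c. 3 * k + 1 < e \<and> g = (\<lambda>t. (t ^ 3, t ^ (3 * k + 1) + c * t ^ e))"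
        by (intro exI[of _ "3 * (k + p) + 2"] exI[of _ \<epsilon>]) simp
    next
      case 2
      \<comment> \<open>The monomial form is read as a binomial with coefficient 0.\<close>
      then show "\<exists>e c. 3 * k + 1 < e \<and> g = (\<lambda>t. (t ^ 3, t ^ (3 * k + 1) + c * t ^ e))"
        by (intro exI[of _ "3 * k + 2"] exI[of _ 0]) simp
    qed
  qed
qed

lemma E_6k2_iff:
  assumes \<kappa>: "smooth_germ \<kappa>" and k: "k \<ge> 1"
  shows "defines_singularity (curve_of_mult 3 \<kappa>) (E_6k2 k) \<longleftrightarrow>
    (\<forall>i\<ge>1. \<not> 3 dvd i \<and> i < 3 * k - 1 \<longrightarrow> taylor_coeff \<kappa> (i - 1) = 0) \<and> taylor_coeff \<kappa> (3 * k - 1 - 1) \<noteq> 0"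
proof (rule mult_3_iff[OF \<kappa>])
  have n: "3 + (3 * k - 1) = 3 * k + 2" using k by simp
  show "1 \<le> 3 * k - 1" "\<not> 3 dvd 3 * k - 1" using k by presburger+
  show "(\<lambda>t. (t ^ 3, t ^ (3 + (3 * k - 1)))) \<in> E_6k2 k" unfolding n E_6k2_def by blast
  show "(\<lambda>t. (t ^ 3, t ^ (3 + (3 * k - 1)) + c * t ^ e)) \<in> E_6k2 k"
    if e: "3 + (3 * k - 1) < e" "e + 6 \<le> 2 * (3 + (3 * k - 1))" "e mod 3 = 2 * (3 + (3 * k - 1)) mod 3" "c \<in> {1, -1}"
      "odd (e - (3 + (3 * k - 1))) \<longrightarrow> c = 1" for e c
  proof -
    obtain p where p: "e = 3 * (k + p) + 4" by (rule exponent_E_6k2[OF e(1,3)[unfolded n]])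
    have "p + 2 \<le> k" using e(2) unfolding n p by simp
    \<comment> \<open>Here \<open>e - n\<close> is \<open>3 p + 2\<close>, odd exactly when
      \<open>p + 1\<close> is even.\<close>
    moreover have "c \<in> sign_choices (p + 1)" using e(4,5) unfolding n p by (auto simp: sign_choices_def)
    ultimately show ?thesis unfolding n p E_6k2_def by blast
  qed
  show "\<exists>e c. 3 + (3 * k - 1) < e \<and> g = (\<lambda>t. (t ^ 3, t ^ (3 + (3 * k - 1)) + c * t ^ e))" if "g \<in> E_6k2 k" for g
  proof -
    from that consider p \<epsilon> where "g = (\<lambda>t. (t ^ 3, t ^ (3 * k + 2) + \<epsilon> * t ^ (3 * (k + p) + 4)))" | "g = (\<lambda>t. (t ^ 3, t ^ (3 * k + 2)))"
      unfolding E_6k2_def by blast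
    then show ?thesis unfolding n
    proof cases
      case 1
      then show "\<exists>e c. 3 * k + 2 < e \<and> g = (\<lambda>t. (t ^ 3, t ^ (3 * k + 2) + c * t ^ e))"
        by (intro exI[of _ "3 * (k + p) + 4"] exI[of _ \<epsilon>]) simp
    next
      case 2
      then show "\<exists>e c. 3 * k + 2 < e \<and> g = (\<lambda>t. (t ^ 3, t ^ (3 * k + 2) + c * t ^ e))"
        by (intro exI[of _ "3 * k + 3"] exI[of _ 0]) simp
    qed
  qed
qed

lemma W_12_iff:
  assumes \<kappa>: "smooth_germ \<kappa>"
  shows "defines_singularity (curve_of_mult 4 \<kappa>) W_12 \<longleftrightarrow> taylor_coeff \<kappa> 0 \<noteq> 0"
proof -
  have "defines_singularity (curve_of_mult 4 \<kappa>) W_12 \<longleftrightarrow>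
    (\<forall>i\<ge>1. \<not> 4 dvd i \<and> i < 1 \<longrightarrow> taylor_coeff \<kappa> (i - 1) = 0) \<and> taylor_coeff \<kappa> (1 - 1) \<noteq> 0"
  proof (rule mult_4_iff[OF \<kappa>])
    show "(\<lambda>t. (t ^ 4, t ^ (4 + 1) + c * t ^ e)) \<in> W_12"
      if "4 + 1 < e" "e + 8 \<le> 3 * (4 + 1)" "e mod 4 = 3 * (4 + 1) mod 4" "c \<in> {1, -1}" for e c
    proof -
      have "e = 7" using that(1-3) by presburger
      then show ?thesis using that(4) by (auto simp: W_12_def)
    qed
    show "\<exists>e c. 4 + 1 < e \<and> g = (\<lambda>t. (t ^ 4, t ^ (4 + 1) + c * t ^ e))" if "g \<in> W_12" for g
    proof -
      have "\<exists>c. g = (\<lambda>t. (t ^ 4, t ^ 5 + c * t ^ 7))"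
        using that unfolding W_12_def by (auto intro: exI[of _ 1] exI[of _ "-1"] exI[of _ 0])
      then show ?thesis by (intro exI[of _ "7::nat"]) simp
    qed
  qed (simp_all add: W_12_def)
  then show ?thesis by simp
qed

lemma W_18_iff:
  assumes \<kappa>: "smooth_germ \<kappa>"
  shows "defines_singularity (curve_of_mult 4 \<kappa>) W_18 \<longleftrightarrow>
    taylor_coeff \<kappa> 0 = 0 \<and> taylor_coeff \<kappa> 1 = 0 \<and> taylor_coeff \<kappa> 2 \<noteq> 0"
proof -
  have "defines_singularity (curve_of_mult 4 \<kappa>) W_18 \<longleftrightarrow>
    (\<forall>i\<ge>1. \<not> 4 dvd i \<and> i < 3 \<longrightarrow> taylor_coeff \<kappa> (i - 1) = 0) \<and> taylor_coeff \<kappa> (3 - 1) \<noteq> 0"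
  proof (rule mult_4_iff[OF \<kappa>])
    show "(\<lambda>t. (t ^ 4, t ^ (4 + 3) + c * t ^ e)) \<in> W_18"
      if "4 + 3 < e" "e + 8 \<le> 3 * (4 + 3)" "e mod 4 = 3 * (4 + 3) mod 4" "c \<in> {1, -1}" for e c
    proof -
      have "e = 9 \<or> e = 13" using that(1-3) by presburger
      then show ?thesis using that(4) by (auto simp: W_18_def)
    qed
    show "\<exists>e c. 4 + 3 < e \<and> g = (\<lambda>t. (t ^ 4, t ^ (4 + 3) + c * t ^ e))" if "g \<in> W_18" for g
    proof -
      have "(\<exists>c. g = (\<lambda>t. (t ^ 4, t ^ 7 + c * t ^ 9))) \<or> (\<exists>c. g = (\<lambda>t. (t ^ 4, t ^ 7 + c * t ^ 13)))"
        using that unfolding W_18_def by (auto intro: exI[of _ 1] exI[of _ "-1"] exI[of _ 0])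
      then show ?thesis
      proof
        assume "\<exists>c. g = (\<lambda>t. (t ^ 4, t ^ 7 + c * t ^ 9))"
        then show ?thesis by (intro exI[of _ "9::nat"]) simp
      next
        assume "\<exists>c. g = (\<lambda>t. (t ^ 4, t ^ 7 + c * t ^ 13))"
        then show ?thesis by (intro exI[of _ "13::nat"]) simp
      qed
    qed
  qed (simp_all add: W_18_def)
  also have "(\<forall>i\<ge>1. \<not> 4 dvd i \<and> i < 3 \<longrightarrow> taylor_coeff \<kappa> (i - 1) = 0) \<longleftrightarrow> taylor_coeff \<kappa> 0 = 0 \<and> taylor_coeff \<kappa> 1 = 0"
  proof
    assume *: "\<forall>i\<ge>1. \<not> 4 dvd i \<and> i < 3 \<longrightarrow> taylor_coeff \<kappa> (i - 1) = 0"
    show "taylor_coeff \<kappa> 0 = 0 \<and> taylor_coeff \<kappa> 1 = 0" using *[rule_format, of 1] *[rule_format, of 2] by simp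
  next
    assume *: "taylor_coeff \<kappa> 0 = 0 \<and> taylor_coeff \<kappa> 1 = 0"
    show "\<forall>i\<ge>1. \<not> 4 dvd i \<and> i < 3 \<longrightarrow> taylor_coeff \<kappa> (i - 1) = 0"
    proof (intro allI impI)
      fix i :: nat assume "1 \<le> i" "\<not> 4 dvd i \<and> i < 3"
      then have "i = 1 \<or> i = 2" by auto
      then show "taylor_coeff \<kappa> (i - 1) = 0" using * by auto
    qed
  qed
  finally show ?thesis by simp
qed

theorem theorem3p1:
  fixes \<kappa> :: "real \<Rightarrow> real" and k q :: nat
  assumes "smooth_germ \<kappa>" and "k \<ge> 1" and "q \<ge> 1"
  shows
    "(defines_singularity (curve_of_mult 2 \<kappa>) (A_even k) \<longleftrightarrow>
        (\<forall>j. 2 * j + 4 \<le> 2 * k \<longrightarrow> taylor_coeff \<kappa> (2 * j) = 0) \<and>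
        taylor_coeff \<kappa> (2 * k - 2) \<noteq> 0) \<and>
     (defines_singularity (curve_of_mult 3 \<kappa>) (E_6k k) \<longleftrightarrow>
        (\<forall>i\<ge>1. i mod 3 \<noteq> 0 \<and> i < 3 * k - 2 \<longrightarrow> taylor_coeff \<kappa> (i - 1) = 0) \<and>
        taylor_coeff \<kappa> (3 * k - 3) \<noteq> 0) \<and>
     (defines_singularity (curve_of_mult 3 \<kappa>) (E_6k2 k) \<longleftrightarrow>
        (\<forall>i\<ge>1. i mod 3 \<noteq> 0 \<and> i < 3 * k - 1 \<longrightarrow> taylor_coeff \<kappa> (i - 1) = 0) \<and>
        taylor_coeff \<kappa> (3 * k - 2) \<noteq> 0) \<and>
     (defines_singularity (curve_of_mult 4 \<kappa>) W_12 \<longleftrightarrow> taylor_coeff \<kappa> 0 \<noteq> 0) \<and>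
     (defines_singularity (curve_of_mult 4 \<kappa>) (W_sharp q) \<longleftrightarrow>
        taylor_coeff \<kappa> 0 = 0 \<and> taylor_coeff \<kappa> 1 \<noteq> 0 \<and>
        (\<forall>j. 1 \<le> j \<and> j < q \<longrightarrow> taylor_coeff \<kappa> (2 * j) = 0) \<and>
        taylor_coeff \<kappa> (2 * q) \<noteq> 0) \<and>
     (defines_singularity (curve_of_mult 4 \<kappa>) W_18 \<longleftrightarrow>
        taylor_coeff \<kappa> 0 = 0 \<and> taylor_coeff \<kappa> 1 = 0 \<and> taylor_coeff \<kappa> 2 \<noteq> 0)"
proof -
  have e1: "3 * k - 2 - 1 = 3 * k - 3" "3 * k - 1 - 1 = 3 * k - 2" by simp_all
  show ?thesis
    using A_even_iff[OF assms(1,2)] E_6k_iff[OF assms(1,2)] E_6k2_iff[OF assms(1,2)] W_12_iff[OF assms(1)]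
      W_sharp_iff[OF assms(1,3)] W_18_iff[OF assms(1)]
    unfolding e1 dvd_eq_mod_eq_0 by blast
qed

end
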